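(* Let $F=K(x,y)/K(x)$ be the Kummer extension defined by $y^m=f(x)=\alpha\prod_{i=1}^r p_i(x)^{\lambda_i}$ described in the context. Let $\bar r=\min\{r+1,|K|\}-1$ (with $\bar r=r$ if $K$ is infinite), let $(\ell_0,\ell_1,\dots,\ell_r)$ be a permutation of $(0,1,\dots,r)$, let $1\leq s\leq\bar r$, and let $\lambda\in\mathbb{Z}$ with $\gcd(m,\lambda)=1$. Suppose that $d_{\ell_k}=\gcd(m,\lambda_{\ell_k})=1$ for all $0\leq k\leq s$. Then $\Gamma(Q_{\ell_0},\dots,Q_{\ell_s})$ equals the set of all tuples $$(mj_0+i\lambda\lambda_{\ell_0},\dots,mj_s+i\lambda\lambda_{\ell_s})\in\mathbb{N}^{s+1}$$ with integers $i,j_0,\dots,j_s$ satisfying $1\leq i\leq m-1$, $j_k\geq\left\lceil\frac{-i\lambda\lambda_{\ell_k}}{m}\right\rceil$ for $0\leq k\leq s$, and $$\sum_{k=0}^s j_k=\sum_{k=0}^r\left\lceil\frac{i\lambda\lambda_k}{m}\right\rceil d_k-\sum_{k=0}^s\left\lceil\frac{i\lambda\lambda_{\ell_k}}{m}\right\rceil.$$ Moreover, for each such tuple (with its $i,j_0,\dots,j_s$), $$\left(\frac{\prod_{k=s+1}^r z_{\ell_k}^{\lceil i\lambda\lambda_{\ell_k}/m\rceil}}{y^{i\lambda}\prod_{k=0}^s z_{\ell_k}^{j_k}}\right)_\infty=\sum_{k=0}^s(mj_k+i\lambda\lambda_{\ell_k})Q_{\ell_k}.$$ In addition, $\Gamma(Q_{\ell_0},\dots,Q_{\ell_s})=\varnothing$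 if and only if $\max_{1\leq i\leq m}\sum_{k=0}^r\left\lceil\frac{i\lambda_k}{m}\right\rceil d_k\leq s$ $(\leq\bar r)$.
   Context: Setting. Let $q$ be a prime power, $K$ an algebraic extension of $\mathbb{F}_q$, $m\geq 2$ an integer with $\gcd(m,q)=1$, and $r\geq 2$. Let $F=K(x,y)$ with $y^m=f(x)=\alpha\prod_{i=1}^r p_i(x)^{\lambda_i}$, where $\alpha\in K\setminus\{0\}$, $\lambda_i\in\mathbb{Z}\setminus\{0\}$, the $p_i(x)\in K[x]$ are pairwise distinct monic irreducible polynomials, and for every $d\mid m$ with $d\geq 2$, $f(x)$ is not a $d$-th power of an element of $K(x)$. ($K$ is not required to contain a primitive $m$-th root of unity; $K$ is the full constant field of $F$.) Put $d_i=\deg p_i$ for $1\leq i\leq r$, $d_0=1$, $\lambda_0=-\sum_{i=1}^r\lambda_i d_i$, $z_0=1$, and $z_i=p_i(x)$ for $1\leq i\leq r$. Let $P_i$ ($1\leq i\leq r$) be the place of $K(x)$ that is the zero of $p_i(x)$, and $P_0$ the pole of $x$. If $\gcd(m,\lambda_i)=1$, then $P_i$ is totally ramified in $F$ and $Q_i$ denotes the unique place of $F$ over $P_i$; it has degree $d_i$. $\mathbb{N}=\{1,2,\dots\}$, $\mathbb{N}_0=\mathbb{N}\cup\{0\}$, and $(z)_\infty$ denotes the pole divisor of $z$. For $t\geq2$ distinct rational places $R_1,\dots,R_t$ of $F$, $H(R_1,\dots,R_t)=\{(n_1,\dots,n_t)\in\mathbb{N}_0^t:\exists z\in F,\ (z)_\infty=\sum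 n_iR_i\}$. With the componentwise partial order $\preceq$ on $\mathbb{N}_0^t$ (an element $\mathbf a$ of a set $S$ is minimal in $S$ if $\mathbf b\not\preceq\mathbf a$ for all $\mathbf b\in S\setminus\{\mathbf a\}$), $\Gamma(R_1,\dots,R_t)$ is the set of all $\mathbf a=(a_1,\dots,a_t)\in\mathbb{N}^t$ such that, for some $1\leq i\leq t$, $\mathbf a$ is minimal in $\{\mathbf n\in H(R_1,\dots,R_t): n_i=a_i\}$. *)

theory Defs
  imports
    "HOL-Computational_Algebra.Polynomial_Factorial"
    "HOL-Computational_Algebra.Fraction_Field"
    "HOL-Number_Theory.Prime_Powers"
    "HOL.Hull"
begin

section \<open>Subfields, algebraic elements, field embeddings\<close>

definition is_subfield :: "'a::field set \<Rightarrow> bool" where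
  "is_subfield S \<longleftrightarrow> 0 \<in> S \<and> 1 \<in> S \<and>
     (\<forall>a\<in>S. \<forall>b\<in>S. a - b \<in> S \<and> a * b \<in> S) \<and> (\<forall>a\<in>S. inverse a \<in> S)"

definition algebraic_over :: "'a::field set \<Rightarrow> 'a \<Rightarrow> bool" where
  "algebraic_over S a \<longleftrightarrow> (\<exists>g. g \<noteq> 0 \<and> (\<forall>n. coeff g n \<in> S) \<and> poly g a = 0)"

definition field_embedding :: "('a::field \<Rightarrow> 'b::field) \<Rightarrow> bool" where
  "field_embedding h \<longleftrightarrow> h 1 = 1 \<and> (\<forall>a b. h (a + b) = h a + h b \<and> h (a * b) = h a * h b)"

text \<open>
  The rational function field \<open>K(x)\<close> is the type \<open>'k poly fract\<close>. An extension field \<open>F\<close> of \<open>K(x)\<close>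
  is a type \<open>'f\<close> together with a field embedding of \<open>K(x)\<close> into it.
\<close>

definition rat_of_poly :: "'k::field poly \<Rightarrow> 'k poly fract" where
  "rat_of_poly g = Fract g 1"

definition rat_x :: "'k::field poly fract" where
  "rat_x = rat_of_poly [:0, 1:]"

definition rat_consts :: "'k::field poly fract set" where
  "rat_consts = range (\<lambda>c. rat_of_poly [:c:])"

section \<open>Places, valuations and pole divisors\<close>

text \<open>
  Below, \<open>C\<close> is the field of constants, a subset of the function field (the whole type).
\<close>

definition valuation_ring :: "'f::field set \<Rightarrow> 'f set \<Rightarrow> bool" where
  "valuation_ring C V \<longleftrightarrow> C \<subset> V \<and> V \<subset> UNIV \<and>
     (\<forall>a\<in>V. \<forall>b\<in>V. a - b \<in> V \<and> a * b \<in> V) \<and> (\<forall>a. a \<in> V \<or> inverse a \<in> V)"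

text \<open>
  A place is the maximal ideal of a valuation ring, i.e. its set of non-units. The case \<open>a = 0\<close> is
  listed separately because \<open>inverse 0 = 0\<close>; the same applies to \<open>place_ring\<close>, which recovers the
  valuation ring from the place.
\<close>

definition is_place :: "'f::field set \<Rightarrow> 'f set \<Rightarrow> bool" where
  "is_place C P \<longleftrightarrow> (\<exists>V. valuation_ring C V \<and> P = {a \<in> V. a = 0 \<or> inverse a \<notin> V})"

definition place_ring :: "'f::field set \<Rightarrow> 'f set" where
  "place_ring P = {a. a = 0 \<or> inverse a \<notin> P}"

definition prime_element :: "'f::field set \<Rightarrow> 'f \<Rightarrow> bool" where
  "prime_element P t \<longleftrightarrow> t \<in> P \<and> P = (\<lambda>a. t * a) ` place_ring P"

text \<open>
  The normalized discrete valuation: \<open>a = t\<^sup>n u\<close> with \<open>t\<close> a prime element and \<open>u\<close> a unit.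
  It is meaningful only for \<open>a \<noteq> 0\<close> (conventionally the value at 0 is infinite).
\<close>

definition place_val :: "'f::field set \<Rightarrow> 'f \<Rightarrow> int" where
  "place_val P a = (THE n. \<exists>t u. prime_element P t \<and>
     u \<noteq> 0 \<and> u \<in> place_ring P \<and> inverse u \<in> place_ring P \<and> a = t powi n * u)"

definition lies_over :: "('e::field \<Rightarrow> 'f::field) \<Rightarrow> 'f set \<Rightarrow> 'e set \<Rightarrow> bool" where
  "lies_over h Q P \<longleftrightarrow> h ` P \<subseteq> Q"

text \<open>A divisor is given by its coefficient function on places.\<close>

type_synonym 'f divisor = "'f set \<Rightarrow> int"

definition pole_divisor :: "'f::field set \<Rightarrow> 'f \<Rightarrow> 'f divisor" where
  "pole_divisor C a =
     (\<lambda>P. if is_place C P \<and> a \<noteq> 0 \<and> place_val P a < 0 then - place_val P a else 0)"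

text \<open>The divisor \<open>n\<^sub>1 R\<^sub>1 + \<dots> + n\<^sub>t R\<^sub>t\<close> for lists \<open>ns\<close>, \<open>Rs\<close> of equal length.\<close>

definition divisor_sum :: "int list \<Rightarrow> 'f set list \<Rightarrow> 'f divisor" where
  "divisor_sum ns Rs = (\<lambda>P. \<Sum>k<length Rs. if P = Rs ! k then ns ! k else 0)"

section \<open>Weierstrass semigroups\<close>

text \<open>Tuples of natural numbers are lists of the same length as the list of places. The definitions make
  sense for any list of places; they are meant for at least two, pairwise distinct, rational ones.\<close>

definition weierstrass_semigroup :: "'f::field set \<Rightarrow> 'f set list \<Rightarrow> nat list set" where
  "weierstrass_semigroup C Rs =
     {ns. length ns = length Rs \<and> (\<exists>a. pole_divisor C a = divisor_sum (map int ns) Rs)}"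

definition minimal_tuple :: "nat list set \<Rightarrow> nat list \<Rightarrow> bool" where
  "minimal_tuple S a \<longleftrightarrow> a \<in> S \<and> (\<forall>b \<in> S - {a}. \<not> list_all2 (\<le>) b a)"

definition min_gen_set :: "'f::field set \<Rightarrow> 'f set list \<Rightarrow> nat list set" where
  "min_gen_set C Rs =
     {a. length a = length Rs \<and> (\<forall>n\<in>set a. 1 \<le> n) \<and>
         (\<exists>i<length Rs. minimal_tuple {ns \<in> weierstrass_semigroup C Rs. ns ! i = a ! i} a)}"

end

theory Submission
  imports Defs "HOL-Algebra.Algebraic_Closure_Type" "HOL-Number_Theory.Cong"
begin

text \<open>
  Write \<open>a \<in> F\<close> as a sum of terms \<open>g\<^sub>i(x) y\<^sup>i\<close> with \<open>0 \<le> i < m\<close>. At a totally ramified place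
  the values of the terms are distinct modulo \<open>m\<close>, so the value of \<open>a\<close> is their minimum. If \<open>a\<close>
  has no pole outside the chosen places, neither does any single term: a valuation ring of the algebraic
  closure pulls back along the \<open>m\<close> conjugate embeddings \<open>y \<mapsto> \<zeta> y\<close>, and the terms are averages of
  conjugates. Hence minimal pole tuples come from single terms \<open>g y\<^sup>-\<^sup>i\<^sup>\<lambda>\<close>. For those, the orders of \<open>g\<close> away
  from the chosen places are bounded below by \<open>\<lceil>i\<lambda>\<lambda>\<^sub>k/m\<rceil>\<close>, and the degree formula on \<open>K(x)\<close>
  forces \<open>\<Sum>j\<^sub>k\<close> to be at least the stated value; minimality is the case of equality, in which
  \<open>g\<close> is the explicit product.
\<close>

hide_const (open) Divisibility.irreducible Polynomials.degree Polynomials.lead_coeff UnivPoly.coeff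
  UnivPoly.monom Coset.order module.smult
hide_fact (open) Divisibility.irreducible_def Divisibility.irreducibleI Divisibility.irreducibleD

section \<open>Valuation rings and discrete valuations\<close>

text \<open>The obstacle is that K need not contain the m-th roots of unity: F may lack the
  automorphisms y -> \<zeta> y, so conjugates exist only in an algebraic closure and places of F
  cannot be permuted. This is why valuation rings are the working objects. They pull back along
  embeddings, they lift by Chevalley's theorem, and having no pole is plain membership. Integer
  values are attached afterwards, but at every place, also where the ramification is unknown:
  \<open>place_val\<close> is a definite description and has a meaning only where a uniformizer
  exists. The powers of y are independent because of a single totally ramified place. The factor
  \<lambda> merely reindexes the terms: it is invertible modulo m, so y^n is a power of f times some
  y^(-i\<lambda>) with 0 \<le> i < m. A minimal tuple attains the bound on the sum because s \<ge> 1
  leaves a second place at which one j_k can be lowered while the prescribed coordinate stays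
  fixed.\<close>

definition is_subring :: "'a::field set \<Rightarrow> bool" where
  "is_subring B \<longleftrightarrow> 1 \<in> B \<and> (\<forall>a\<in>B. \<forall>b\<in>B. a - b \<in> B \<and> a * b \<in> B)"

lemma subringD:
  assumes "is_subring B"
  shows "1 \<in> B" "0 \<in> B" "a \<in> B \<Longrightarrow> b \<in> B \<Longrightarrow> a - b \<in> B" "a \<in> B \<Longrightarrow> b \<in> B \<Longrightarrow> a * b \<in> B"
    "a \<in> B \<Longrightarrow> - a \<in> B" "a \<in> B \<Longrightarrow> b \<in> B \<Longrightarrow> a + b \<in> B" "a \<in> B \<Longrightarrow> a ^ n \<in> B"
proof -
  show 1: "1 \<in> B" using assms by (simp add: is_subring_def)
  show d: "a - b \<in> B" if "a \<in> B" "b \<in> B" for a b using assms that by (simp add: is_subring_def)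
  show m: "a * b \<in> B" if "a \<in> B" "b \<in> B" for a b using assms that by (simp add: is_subring_def)
  show 0: "0 \<in> B" using d[OF 1 1] by simp
  show neg: "- a \<in> B" if "a \<in> B" for a using d[OF 0 that] by simp
  show "a + b \<in> B" if "a \<in> B" "b \<in> B" for a b using d[OF that(1) neg[OF that(2)]] by simp
  show "a ^ n \<in> B" if "a \<in> B" for a n by (induction n) (use that 1 m in auto)
qed

lemma subring_sum: "is_subring B \<Longrightarrow> (\<And>i. i \<in> I \<Longrightarrow> f i \<in> B) \<Longrightarrow> sum f I \<in> B"
  by (induction I rule: infinite_finite_induct) (auto simp: subringD)

text \<open>No constants are required to lie in \<open>V\<close>, so the notion passes to fields
  without distinguished constants, such as an algebraic closure, and back along embeddings.\<close>

definition valring :: "'a::field set \<Rightarrow> bool" where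
  "valring V \<longleftrightarrow> is_subring V \<and> (\<forall>a. a \<in> V \<or> inverse a \<in> V) \<and> V \<noteq> UNIV"

definition maxideal :: "'a::field set \<Rightarrow> 'a set" where
  "maxideal V = {a \<in> V. a = 0 \<or> inverse a \<notin> V}"

definition vunit :: "'a::field set \<Rightarrow> 'a \<Rightarrow> bool" where
  "vunit V a \<longleftrightarrow> a \<noteq> 0 \<and> a \<in> V \<and> inverse a \<in> V"

lemma valring_subring: "valring V \<Longrightarrow> is_subring V" by (simp add: valring_def)

lemma valring_total: "valring V \<Longrightarrow> a \<in> V \<or> inverse a \<in> V" by (simp add: valring_def)

lemma valuation_ring_iff: "valuation_ring C V \<longleftrightarrow> C \<subset> V \<and> valring V"
proof -
  have "1 \<in> V" if "\<forall>a. a \<in> V \<or> inverse a \<in> V"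
    using that[rule_format, of 1] by simp
  then show ?thesis unfolding valuation_ring_def valring_def is_subring_def by auto
qed

lemma is_place_iff: "is_place C P \<longleftrightarrow> (\<exists>V. C \<subset> V \<and> valring V \<and> P = maxideal V)"
  by (auto simp: is_place_def valuation_ring_iff maxideal_def)

lemma maxideal_iff: "valring V \<Longrightarrow> a \<in> maxideal V \<longleftrightarrow> a = 0 \<or> inverse a \<notin> V"
  using valring_total[of V a] subringD(2)[OF valring_subring] by (auto simp: maxideal_def)

lemma place_ring_maxideal: "valring V \<Longrightarrow> place_ring (maxideal V) = V"
  using subringD(2)[OF valring_subring] by (auto simp: place_ring_def maxideal_iff)

lemma vunit_mult: "valring V \<Longrightarrow> vunit V a \<Longrightarrow> vunit V b \<Longrightarrow> vunit V (a * b)"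
  using subringD(4)[OF valring_subring] by (auto simp: vunit_def)

lemma vunit_power: "valring V \<Longrightarrow> vunit V a \<Longrightarrow> vunit V (a ^ n)"
  proof (induction n)
  case 0
  then show ?case using subringD(1)[OF valring_subring] by (simp add: vunit_def)
next
  case (Suc n)
  then show ?case unfolding power_Suc by (intro vunit_mult)
qed

lemma vunit_inverse: "vunit V a \<Longrightarrow> vunit V (inverse a)"
  by (auto simp: vunit_def)

lemma maxideal_mult:
  assumes "valring V" "a \<in> maxideal V" "b \<in> V" shows "a * b \<in> maxideal V"
proof (cases "a = 0 \<or> b = 0")
  case True then show ?thesis using assms by (auto simp: maxideal_iff)
next
  case False
  have "inverse (a * b) \<notin> V"
  proof
    assume "inverse (a * b) \<in> V"
    then have "b * inverse (a * b) \<in> V" using assms subringD(4)[OF valring_subring] by blast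
    moreover have "b * inverse (a * b) = inverse a" using False by (simp add: field_simps)
    ultimately have "inverse a \<in> V" by metis
    then show False using assms False by (simp add: maxideal_iff)
  qed
  then show ?thesis using assms by (simp add: maxideal_iff)
qed

lemma vunit_1_plus_maxideal:
  assumes "valring V" "e \<in> maxideal V" shows "vunit V (1 + e)"
proof -
  note R = subringD[OF valring_subring[OF assms(1)]]
  have e: "e \<in> V" using assms by (auto simp: maxideal_def)
  have ne: "1 + e \<noteq> 0"
  proof
    assume "1 + e = 0" then have "e = - 1" by (simp add: add_eq_0_iff)
    then show False using assms R(1) R(5)[of 1] by (auto simp: maxideal_iff)
  qed
  have "inverse (1 + e) \<in> V"
  proof (rule ccontr)
    assume "inverse (1 + e) \<notin> V"
    then have "1 + e \<in> maxideal V" using assms by (simp add: maxideal_iff)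
    have "e \<noteq> 0" using \<open>inverse (1 + e) \<notin> V\<close> R by auto
    \<comment> \<open>\<open>1 + inverse e\<close> is outside \<open>V\<close> because
      \<open>inverse e\<close> is. Its inverse \<open>e / (1 + e)\<close> is then in
      \<open>V\<close>, and \<open>1 - e / (1 + e)\<close> is the inverse of
      \<open>1 + e\<close>.\<close>
    have "inverse e * (1+e) \<notin> V"
    proof
      assume "inverse e * (1+e) \<in> V"
      then have "inverse e * (1+e) - 1 \<in> V" using R by blast
      then show False using assms \<open>e \<noteq> 0\<close> by (auto simp: maxideal_iff algebra_simps)
    qed
    then have "inverse (inverse e * (1+e)) \<in> V" using valring_total[OF assms(1)] by blast
    then have "1 - e * inverse (1 + e) \<in> V" using R by simp
    moreover have "1 - e * inverse (1 + e) = inverse (1 + e)" using ne by (simp add: field_simps)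
    ultimately show False using \<open>inverse (1 + e) \<notin> V\<close> by simp
  qed
  then show ?thesis using ne e R by (auto simp: vunit_def)
qed

text \<open>Integral closedness for pure equations: if \<open>a\<close> is outside \<open>V\<close>,
  its inverse is a non-unit, and so is every positive power of the inverse. The m-th power of a term
  \<open>c y^i\<close> lies in the base field, which makes this the membership test for
  terms.\<close>

lemma valring_power_mem:
  assumes "valring V" "n > 0" "a ^ n \<in> V" shows "a \<in> V"
proof (rule ccontr)
  assume a: "a \<notin> V"
  then have i: "inverse a \<in> maxideal V" "inverse a \<in> V"
    using assms(1) valring_total by (auto simp: maxideal_iff)
  have "inverse a ^ n \<in> maxideal V"
    using maxideal_mult[OF assms(1) i(1), of "inverse a ^ (n - 1)"] i(2) assms
      subringD(7)[OF valring_subring[OF assms(1)]] by (cases n) auto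
  then show False using assms a subringD(2)[OF valring_subring[OF assms(1)]]
    by (auto simp: maxideal_iff power_inverse)
qed

lemma valring_power_iff:
  assumes "valring V" "n > 0" shows "a ^ n \<in> V \<longleftrightarrow> a \<in> V"
  using valring_power_mem[OF assms] subringD(7)[OF valring_subring[OF assms(1)]] by blast

text \<open>The ultrametric law for summands of pairwise different value, phrased with quotients and
  units. No value group occurs, so it applies before \<open>V\<close> is known to be
  discrete.\<close>

lemma dominant_term:
  assumes V: "valring V" and "finite I" "I \<noteq> {}" and nz: "\<And>i. i \<in> I \<Longrightarrow> b i \<noteq> 0"
    and na: "\<And>i j. i \<in> I \<Longrightarrow> j \<in> I \<Longrightarrow> i \<noteq> j \<Longrightarrow> \<not> vunit V (b i / b j)"
  shows "\<exists>i\<in>I. vunit V (sum b I / b i) \<and> (\<forall>j\<in>I. b j / b i \<in> V)"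
  using assms(2-)
proof (induction I rule: finite_ne_induct)
  case (singleton x)
  then show ?case using subringD(1)[OF valring_subring[OF V]] by (auto simp: vunit_def)
next
  case (insert x I)
  then obtain i where i: "i \<in> I" "vunit V (sum b I / b i)" "\<forall>j\<in>I. b j / b i \<in> V"
    by (metis insertCI)
  note R = subringD[OF valring_subring[OF V]]
  have nz: "b x \<noteq> 0" "b i \<noteq> 0" "sum b I \<noteq> 0" using insert i by (auto simp: vunit_def)
  have nu: "\<not> vunit V (b x / b i)" using insert i by auto
  show ?case
  proof (cases "b x / b i \<in> V")
    case True
    then have "b x / b i \<in> maxideal V" using nu nz by (auto simp: maxideal_def vunit_def)
    then have "(b x / b i) * (b i / sum b I) \<in> maxideal V"
      using i(2) by (intro maxideal_mult[OF V]) (auto simp: vunit_def)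
    then have "vunit V (1 + b x / sum b I)" using vunit_1_plus_maxideal[OF V] nz by simp
    then have "vunit V ((sum b I / b i) * (1 + b x / sum b I))" using vunit_mult[OF V i(2)] by blast
    moreover have "(sum b I / b i) * (1 + b x / sum b I) = sum b (insert x I) / b i"
      using insert nz by (simp add: field_simps)
    ultimately have "vunit V (sum b (insert x I) / b i)" by metis
    moreover have "\<forall>j\<in>insert x I. b j / b i \<in> V" using i True by blast
    ultimately show ?thesis using i(1) by blast
  next
    case False
    then have f: "b i / b x \<in> maxideal V" "b i / b x \<in> V" 
      using V valring_total[OF V, of "b x / b i"] by (auto simp: maxideal_iff)
    then have "(b i / b x) * (sum b I / b i) \<in> maxideal V"
      using i(2) by (intro maxideal_mult[OF V]) (auto simp: vunit_def)
    then have "vunit V (1 + sum b I / b x)" using vunit_1_plus_maxideal[OF V] nz by simp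
    moreover have "1 + sum b I / b x = sum b (insert x I) / b x"
      using insert nz by (simp add: field_simps)
    moreover have "b j / b x \<in> V" if "j \<in> I" for j
      using R(4)[OF i(3)[rule_format, OF that] f(2)] nz by simp
    moreover have "b x / b x \<in> V" using R(1) nz by simp
    ultimately have "vunit V (sum b (insert x I) / b x)" "\<forall>j\<in>insert x I. b j / b x \<in> V" by auto
    then show ?thesis by blast
  qed
qed

text \<open>\<open>V\<close> is the set of elements of nonnegative value; the ultrametric inequality follows since
  \<open>V\<close> is a ring.\<close>

definition valuation_of :: "'a::field set \<Rightarrow> ('a \<Rightarrow> int) \<Rightarrow> bool" where
  "valuation_of V v \<longleftrightarrow> (\<forall>a b. a \<noteq> 0 \<longrightarrow> b \<noteq> 0 \<longrightarrow> v (a * b) = v a + v b) \<and>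
     (\<forall>a. a \<noteq> 0 \<longrightarrow> (a \<in> V \<longleftrightarrow> 0 \<le> v a))"

lemma valuation_ofD:
  assumes "valuation_of V v"
  shows "a \<noteq> 0 \<Longrightarrow> b \<noteq> 0 \<Longrightarrow> v (a * b) = v a + v b" "a \<noteq> 0 \<Longrightarrow> a \<in> V \<longleftrightarrow> 0 \<le> v a"
    "v 1 = 0" "a \<noteq> 0 \<Longrightarrow> v (inverse a) = - v a" "a \<noteq> 0 \<Longrightarrow> b \<noteq> 0 \<Longrightarrow> v (a / b) = v a - v b"
    "a \<noteq> 0 \<Longrightarrow> v (a ^ n) = int n * v a" "a \<noteq> 0 \<Longrightarrow> v (a powi k) = k * v a"
    "vunit V a \<longleftrightarrow> a \<noteq> 0 \<and> v a = 0"
proof -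
  show m: "v (a * b) = v a + v b" if "a \<noteq> 0" "b \<noteq> 0" for a b
    using assms that by (simp add: valuation_of_def)
  show V: "a \<in> V \<longleftrightarrow> 0 \<le> v a" if "a \<noteq> 0" for a
    using assms that by (simp add: valuation_of_def)
  show 1: "v 1 = 0" using m[of 1 1] by simp
  show i: "v (inverse a) = - v a" if "a \<noteq> 0" for a
    using m[of a "inverse a"] that 1 by simp
  show "v (a / b) = v a - v b" if "a \<noteq> 0" "b \<noteq> 0" for a b
    using m[of a "inverse b"] i[of b] that by (simp add: divide_inverse)
  show p: "v (a ^ n) = int n * v a" if "a \<noteq> 0" for a n
    by (induction n) (use that 1 m in \<open>auto simp: algebra_simps\<close>)
  show "v (a powi k) = k * v a" if "a \<noteq> 0" for a k
    using that p[of a "nat k"] p[of "inverse a" "nat (- k)"] i[of a]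
    by (auto simp: power_int_def)
  show "vunit V a \<longleftrightarrow> a \<noteq> 0 \<and> v a = 0" 
    using V[of a] V[of "inverse a"] i[of a] by (auto simp: vunit_def)
qed

lemma valuation_of_prod:
  assumes "valuation_of V v" "\<And>i. i \<in> I \<Longrightarrow> b i \<noteq> 0"
  shows "v (prod b I) = (\<Sum>i\<in>I. v (b i))"
  using assms(2) by (induction I rule: infinite_finite_induct) 
    (auto simp: valuation_ofD[OF assms(1)] prod_zero_iff)

text \<open>The definite description in \<open>place_val\<close> ranges over prime elements. The
  element \<open>t\<close> of value 1 shows that there are some and that they are exactly the
  elements of value 1.\<close>

lemma place_val_eq:
  assumes V: "valring V" and v: "valuation_of V v" and t: "t \<noteq> 0" "v t = 1" and a: "a \<noteq> 0"
  shows "place_val (maxideal V) a = v a"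
proof -
  note D = valuation_ofD[OF v]
  have mi: "x \<in> maxideal V \<longleftrightarrow> x = 0 \<or> 0 < v x" for x
    using V D(2)[of "inverse x"] D(4)[of x] by (cases "x = 0") (auto simp: maxideal_iff)
  have pe: "prime_element (maxideal V) x \<longleftrightarrow> x \<noteq> 0 \<and> v x = 1" for x
  proof
    assume x: "prime_element (maxideal V) x"
    then have "t \<in> (\<lambda>a. x * a) ` V" using t place_ring_maxideal[OF V] mi[of t]
      by (auto simp: prime_element_def)
    then obtain b where b: "t = x * b" "b \<in> V" by auto
    with t have "x \<noteq> 0" "b \<noteq> 0" by auto
    moreover have "v x > 0" using x \<open>x \<noteq> 0\<close> by (auto simp: prime_element_def mi)
    ultimately show "x \<noteq> 0 \<and> v x = 1" using D(1)[of x b] D(2)[of b] b t by auto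
  next
    assume x: "x \<noteq> 0 \<and> v x = 1"
    have "y \<in> (\<lambda>a. x * a) ` V" if "y \<in> maxideal V" for y
    proof -
      have "y / x \<in> V" using that x D(2)[of "y/x"] D(5)[of y x] mi[of y] subringD(2)[OF valring_subring[OF V]]
        by (cases "y = 0") auto
      then show ?thesis using x by (auto intro!: image_eqI[of _ _ "y / x"])
    qed
    moreover have "x * y \<in> maxideal V" if "y \<in> V" for y
      using that x D(1)[of x y] D(2)[of y] by (cases "y = 0") (auto simp: mi)
    ultimately show "prime_element (maxideal V) x"
      using x mi[of x] place_ring_maxideal[OF V] by (auto simp: prime_element_def)
  qed
  show ?thesis unfolding place_val_def pe place_ring_maxideal[OF V]
  proof (rule the_equality)
    have "v (a / t powi v a) = 0" using t a D(5)[of a "t powi v a"] D(7)[of t] by simp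
    then have "vunit V (a / t powi v a)" using a t by (simp add: D(8))
    then show "\<exists>s u. (s \<noteq> 0 \<and> v s = 1) \<and> u \<noteq> 0 \<and> u \<in> V \<and> inverse u \<in> V \<and> a = s powi v a * u"
      using t by (intro exI[of _ t] exI[of _ "a / t powi v a"]) (auto simp: vunit_def)
  next
    fix n assume "\<exists>s u. (s \<noteq> 0 \<and> v s = 1) \<and> u \<noteq> 0 \<and> u \<in> V \<and> inverse u \<in> V \<and> a = s powi n * u"
    then obtain s u where "s \<noteq> 0" "v s = 1" "vunit V u" "a = s powi n * u" by (auto simp: vunit_def)
    then show "n = v a" using D(1)[of "s powi n" u] D(7)[of s n] by (simp add: D(8))
  qed
qed

text \<open>A nonzero homomorphism to the integers becomes surjective after dividing by the least positive value.\<close>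

lemma normalize_valuation:
  assumes w: "valuation_of V w" and s: "s \<noteq> 0" "w s \<noteq> 0"
  shows "\<exists>v t. valuation_of V v \<and> t \<noteq> 0 \<and> v t = 1"
proof -
  note D = valuation_ofD[OF w]
  define Q where "Q n \<longleftrightarrow> n > 0 \<and> (\<exists>t. t \<noteq> 0 \<and> w t = int n)" for n
  have "Q (nat \<bar>w s\<bar>)" unfolding Q_def using s D(4)[of s]
    by (cases "w s > 0") (auto intro: exI[of _ "inverse s"])
  then have QL: "Q (Least Q)" by (rule LeastI)
  define g where "g = int (Least Q)"
  obtain t where t: "t \<noteq> 0" "w t = g" and g: "g > 0" using QL by (auto simp: Q_def g_def)
  have dv: "g dvd w a" if "a \<noteq> 0" for a
  proof (rule ccontr)
    assume "\<not> g dvd w a"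
    then have m: "w a mod g > 0" using g by (simp add: dvd_eq_mod_eq_0 order_less_le)
    have "w (a / t powi (w a div g)) = w a mod g" using that t
      by (simp add: D(5) D(7) minus_div_mult_eq_mod)
    then have "Q (nat (w a mod g))" unfolding Q_def using m that t
      by (auto intro!: exI[of _ "a / t powi (w a div g)"])
    then have "Least Q \<le> nat (w a mod g)" by (rule Least_le)
    then show False using m g pos_mod_bound[of g "w a"] unfolding g_def by linarith
  qed
  have "valuation_of V (\<lambda>a. w a div g)" unfolding valuation_of_def
    using dv D(1) D(2) g by (auto simp: div_plus_div_distrib_dvd_left pos_imp_zdiv_nonneg_iff)
  moreover have "w t div g = 1" using t g by simp
  ultimately show ?thesis using t by blast
qed

section \<open>Field embeddings and extension of valuations\<close>

lemma field_embeddingD: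
  assumes "field_embedding h"
  shows "h 0 = 0" "h 1 = 1" "h (a + b) = h a + h b" "h (a * b) = h a * h b" "h (- a) = - h a"
    "h (a - b) = h a - h b" "h (inverse a) = inverse (h a)" "h (a / b) = h a / h b"
    "h a = 0 \<longleftrightarrow> a = 0" "h (a ^ n) = h a ^ n" "h (a powi k) = h a powi k" "h a = h b \<longleftrightarrow> a = b"
proof -
  show 1: "h 1 = 1" and p: "h (a + b) = h a + h b" and m: "h (a * b) = h a * h b" for a b
    using assms by (auto simp: field_embedding_def)
  show z: "h 0 = 0" using p[of 0 0] by (metis add.right_neutral add_left_cancel)
  show u: "h (- a) = - h a" for a using p[of a "- a"] z by (simp add: eq_neg_iff_add_eq_0 add.commute)
  show d: "h (a - b) = h a - h b" for a b using p[of a "- b"] u by simp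
  show n: "h a = 0 \<longleftrightarrow> a = 0" for a using m[of a "inverse a"] 1 z by (cases "a = 0") auto
  show i: "h (inverse a) = inverse (h a)" for a using m[of a "inverse a"] 1 z n[of a]
    by (cases "a = 0") (auto simp: inverse_unique)
  show "h (a / b) = h a / h b" by (simp add: divide_inverse m i)
  show e: "h (a ^ n) = h a ^ n" for a n by (induction n) (auto simp: 1 m)
  show "h (a powi k) = h a powi k" by (simp add: power_int_def e i)
  show "h a = h b \<longleftrightarrow> a = b" using d[of a b] n[of "a - b"] by auto
qed

lemma field_embedding_sum: "field_embedding h \<Longrightarrow> h (sum f I) = (\<Sum>i\<in>I. h (f i))"
  by (induction I rule: infinite_finite_induct) (auto simp: field_embeddingD)

lemma field_embedding_prod: "field_embedding h \<Longrightarrow> h (prod f I) = (\<Prod>i\<in>I. h (f i))"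
  by (induction I rule: infinite_finite_induct) (auto simp: field_embeddingD)

lemma field_embedding_of_nat: "field_embedding h \<Longrightarrow> h (of_nat n) = of_nat n"
  by (induction n) (auto simp: field_embeddingD)

text \<open>Valuations extend along radical-type extensions: the value of \<open>a\<close> is \<open>N\<close> times the value
  it would have in the divisible hull.\<close>

lemma extend_valuation:
  assumes h: "field_embedding h" and V: "valring V" and v0: "valuation_of W v0"
    and over: "\<And>c. h c \<in> V \<longleftrightarrow> c \<in> W" and N: "N > 0"
    and ex: "\<And>a. a \<noteq> 0 \<Longrightarrow> \<exists>c. c \<noteq> 0 \<and> vunit V (a ^ N / h c)"
  shows "\<exists>w. valuation_of V w \<and> (\<forall>a c. a \<noteq> 0 \<longrightarrow> c \<noteq> 0 \<longrightarrow> vunit V (a ^ N / h c) \<longrightarrow> w a = v0 c)"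
proof -
  note H = field_embeddingD[OF h] and D = valuation_ofD[OF v0]
  \<comment> \<open>Two admissible \<open>c\<close> differ by an element whose image is a unit of
    \<open>V\<close>, hence by a unit of \<open>W\<close>; the choice made in \<open>cc\<close>
    therefore does not affect the value.\<close>
  have uniq: "v0 c = v0 c'" if "a \<noteq> 0" "c \<noteq> 0" "c' \<noteq> 0" "vunit V (a ^ N / h c)" "vunit V (a ^ N / h c')"
    for a c c'
  proof -
    have "vunit V ((a ^ N / h c') * inverse (a ^ N / h c))"
      using that by (intro vunit_mult[OF V] vunit_inverse)
    then have "vunit V (h (c / c'))" using that by (simp add: H field_simps)
    then have "vunit W (c / c')" using over[of "c / c'"] over[of "inverse (c / c')"]
      by (auto simp: vunit_def H)
    then show ?thesis using that by (simp add: D)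
  qed
  define cc where "cc a = (SOME c. c \<noteq> 0 \<and> vunit V (a ^ N / h c))" for a
  have cc: "cc a \<noteq> 0 \<and> vunit V (a ^ N / h (cc a))" if "a \<noteq> 0" for a
    unfolding cc_def by (rule someI_ex[OF ex[OF that]])
  have e: "v0 (cc a) = v0 c" if "a \<noteq> 0" "c \<noteq> 0" "vunit V (a ^ N / h c)" for a c
    using cc[OF that(1)] that uniq by blast
  have "valuation_of V (\<lambda>a. v0 (cc a))" unfolding valuation_of_def
  proof (intro conjI allI impI)
    fix a b :: 'b assume ab: "a \<noteq> 0" "b \<noteq> 0"
    have "vunit V ((a ^ N / h (cc a)) * (b ^ N / h (cc b)))" using cc ab by (intro vunit_mult[OF V]) auto
    then have "vunit V ((a * b) ^ N / h (cc a * cc b))" by (simp add: H power_mult_distrib)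
    then have "v0 (cc (a * b)) = v0 (cc a * cc b)" using ab cc by (intro e) auto
    then show "v0 (cc (a * b)) = v0 (cc a) + v0 (cc b)" using ab cc by (simp add: D)
  next
    fix a :: 'b assume a: "a \<noteq> 0"
    note c = cc[OF a]
    have "a \<in> V \<longleftrightarrow> a ^ N \<in> V" using valring_power_iff[OF V N] by simp
    also have "\<dots> \<longleftrightarrow> h (cc a) \<in> V"
    proof
      assume "a ^ N \<in> V"
      then have "a ^ N * inverse (a ^ N / h (cc a)) \<in> V"
        using c subringD(4)[OF valring_subring[OF V]] unfolding vunit_def by blast
      moreover have "a ^ N * inverse (a ^ N / h (cc a)) = h (cc a)" using a c by simp
      ultimately show "h (cc a) \<in> V" by simp
    next
      assume "h (cc a) \<in> V"
      then have "h (cc a) * (a ^ N / h (cc a)) \<in> V"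
        using c subringD(4)[OF valring_subring[OF V]] unfolding vunit_def by blast
      moreover have "h (cc a) * (a ^ N / h (cc a)) = a ^ N" using a c by (simp add: H)
      ultimately show "a ^ N \<in> V" by simp
    qed
    also have "\<dots> \<longleftrightarrow> 0 \<le> v0 (cc a)" using c by (simp add: over D)
    finally show "a \<in> V \<longleftrightarrow> 0 \<le> v0 (cc a)" .
  qed
  then show ?thesis using e by blast
qed

text \<open>Zorn's lemma yields a subring \<open>B\<close> above \<open>A\<close> that is maximal
  among those omitting \<open>inverse t\<close>. Maximality acts twice: the elements
  \<open>1 + t * b\<close> are already invertible in \<open>B\<close>, and adjoining any
  \<open>u\<close> outside \<open>B\<close> produces \<open>inverse t\<close>. If the latter
  happened for both \<open>u\<close> and \<open>inverse u\<close>, the two resulting relations could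
  be shortened against each other down to length 0, which is impossible.\<close>

lemma chevalley:
  fixes A :: "'a::field set"
  assumes A: "is_subring A" and t: "t \<in> A" "inverse t \<notin> A"
  shows "\<exists>V. valring V \<and> A \<subseteq> V \<and> inverse t \<notin> V"
proof -
  define S where "S = {B. A \<subseteq> B \<and> is_subring B \<and> inverse t \<notin> B}"
  have "\<exists>B\<in>S. \<forall>T\<in>S. B \<subseteq> T \<longrightarrow> T = B"
  proof (rule subset_Zorn_nonempty)
    show "S \<noteq> {}" using A t by (auto simp: S_def)
  next
    fix CC assume "CC \<noteq> {}" and ch: "subset.chain S CC"
    then obtain B0 where B0: "B0 \<in> CC" by auto
    have sub: "T \<in> S" if "T \<in> CC" for T using ch that by (auto simp: subset.chain_def)
    have two: "\<exists>T\<in>CC. a \<in> T \<and> b \<in> T" if "a \<in> \<Union>CC" "b \<in> \<Union>CC" for a b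
    proof -
      obtain T Y where XY: "T \<in> CC" "a \<in> T" "Y \<in> CC" "b \<in> Y"
        using \<open>a \<in> \<Union>CC\<close> \<open>b \<in> \<Union>CC\<close> by auto
      then have "T \<subseteq> Y \<or> Y \<subseteq> T" using ch unfolding subset.chain_def by blast
      then show ?thesis using XY by blast
    qed
    have "is_subring (\<Union>CC)" unfolding is_subring_def
    proof (intro conjI ballI)
      show "1 \<in> \<Union>CC" using B0 sub[OF B0] by (auto simp: S_def is_subring_def)
      fix a b assume "a \<in> \<Union>CC" "b \<in> \<Union>CC"
      from two[OF this] obtain T where "T \<in> CC" "a \<in> T" "b \<in> T" by blast
      then show "a - b \<in> \<Union>CC" "a * b \<in> \<Union>CC" using sub by (auto simp: S_def is_subring_def)
    qed
    then show "\<Union>CC \<in> S" using sub B0 by (auto simp: S_def)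
  qed
  then obtain B where B: "A \<subseteq> B" "is_subring B" "inverse t \<notin> B"
    and max: "\<And>T. A \<subseteq> T \<Longrightarrow> is_subring T \<Longrightarrow> inverse t \<notin> T \<Longrightarrow> B \<subseteq> T \<Longrightarrow> T = B"
    by (auto simp: S_def)
  note R = subringD[OF B(2)]
  have tB: "t \<in> B" using B t by auto
  have t0: "t \<noteq> 0" using R(2) B(3) by auto
  have ne: "1 + t * b \<noteq> 0" if "b \<in> B" for b
  proof
    assume "1 + t * b = 0"
    then have "t * (- b) = 1" by (simp add: add_eq_0_iff)
    then have "inverse t = - b" by (rule inverse_unique)
    then show False using R(5)[OF that] B(3) by simp
  qed
  \<comment> \<open>The fractions with denominators \<open>1 + t * c\<close> form a ring that still
    omits \<open>inverse t\<close>: from \<open>inverse t = b / (1 + t * c)\<close> would follow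
    \<open>t * (b - c) = 1\<close> with \<open>b - c\<close> in \<open>B\<close>.\<close>
  have unit: "inverse (1 + t * b) \<in> B" if b: "b \<in> B" for b
  proof -
    define T where "T = {x. \<exists>b\<in>B. \<exists>c\<in>B. x = b / (1 + t * c)}"
    have TI: "b / (1 + t * c) \<in> T" if "b \<in> B" "c \<in> B" for b c using that by (auto simp: T_def)
    have BT: "B \<subseteq> T" using TI[OF _ R(2)] by auto
    have "is_subring T" unfolding is_subring_def
    proof (intro conjI ballI)
      show "1 \<in> T" using R(1) BT by auto
      fix x x' assume "x \<in> T" "x' \<in> T"
      then obtain b c b' c' where *: "b \<in> B" "c \<in> B" "x = b / (1 + t * c)"
        "b' \<in> B" "c' \<in> B" "x' = b' / (1 + t * c')" by (auto simp: T_def)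
      have nn: "1 + t * c \<noteq> 0" "1 + t * c' \<noteq> 0" using ne * by auto
      have e: "(1 + t * c) * (1 + t * c') = 1 + t * (c + c' + t * c * c')" by (simp add: algebra_simps)
      have "x - x' = (b * (1 + t * c') - b' * (1 + t * c)) / ((1 + t * c) * (1 + t * c'))"
        using nn by (simp add: * diff_frac_eq)
      also have "\<dots> \<in> T" unfolding e by (rule TI) (use * R tB in auto)
      finally show "x - x' \<in> T" .
      have "x * x' = (b * b') / ((1 + t * c) * (1 + t * c'))"
        by (simp add: *)
      also have "\<dots> \<in> T" unfolding e by (rule TI) (use * R tB in auto)
      finally show "x * x' \<in> T" .
    qed
    moreover have "inverse t \<notin> T"
    proof
      assume "inverse t \<in> T"
      then obtain b c where bc: "b \<in> B" "c \<in> B" "inverse t = b / (1 + t * c)" by (auto simp: T_def)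
      then have "t * (b - c) = 1" using ne[OF bc(2)] t0 by (simp add: field_simps)
      then have "inverse t = b - c" by (rule inverse_unique)
      then show False using R(3)[OF bc(1,2)] B(3) by simp
    qed
    ultimately have "T = B" using max[of T] B(1) BT by auto
    then show ?thesis using TI[OF R(1) b] by (simp add: divide_inverse)
  qed
  \<comment> \<open>\<open>rel u n\<close> says that \<open>inverse t\<close> is a polynomial in
    \<open>u\<close> of degree at most \<open>n\<close> over \<open>B\<close>. With \<open>t\<close>
    moved to the right, the constant term leaves \<open>1 - t * c 0\<close>, to which
    \<open>unit\<close> applies.\<close>
  define rel where "rel u n \<longleftrightarrow> (\<exists>c::nat\<Rightarrow>'a. (\<forall>k. c k \<in> B) \<and> 1 = t * (\<Sum>k\<le>n. c k * u ^ k))" for u n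
  have rel0: "\<not> rel u 0" for u
  proof
    assume "rel u 0"
    then obtain c where "c \<in> B" "t * c = 1" by (auto simp: rel_def)
    then show False using inverse_unique[of t c] B(3) by simp
  qed
  have relmono: "rel u n'" if r: "rel u n" and le: "n \<le> n'" for u n n'
  proof -
    obtain c where c: "\<forall>k. c k \<in> B" "1 = t * (\<Sum>k\<le>n. c k * u ^ k)" using r by (auto simp: rel_def)
    have "(\<Sum>k\<le>n'. (if k \<le> n then c k else 0) * u ^ k) = (\<Sum>k\<le>n. c k * u ^ k)"
      by (rule sum.mono_neutral_cong_right) (use le in auto)
    then show ?thesis unfolding rel_def using c R(2)
      by (intro exI[of _ "\<lambda>k. if k \<le> n then c k else 0"]) auto
  qed
  have ex: "\<exists>n. rel u n" if u: "u \<notin> B" for u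
  proof -
    define T where "T = {poly g u | g. \<forall>n. coeff g n \<in> B}"
    have BT: "B \<subseteq> T"
    proof
      fix b assume "b \<in> B"
      then show "b \<in> T" unfolding T_def using R(2)
        by (intro CollectI exI[of _ "[:b:]"]) (auto simp: coeff_pCons split: nat.split)
    qed
    have "u \<in> T" unfolding T_def using R(1,2)
      by (intro CollectI exI[of _ "[:0,1:]"]) (auto simp: coeff_pCons split: nat.split)
    then have "T \<noteq> B" using u by auto
    moreover have "is_subring T" unfolding is_subring_def
    proof (intro conjI ballI)
      show "1 \<in> T" using R(1) BT by auto
      fix x x' assume "x \<in> T" "x' \<in> T"
      then obtain g g' where g: "x = poly g u" "x' = poly g' u" "\<forall>n. coeff g n \<in> B" "\<forall>n. coeff g' n \<in> B"
        by (auto simp: T_def)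
      show "x - x' \<in> T" unfolding T_def using g R(3)
        by (intro CollectI exI[of _ "g - g'"]) auto
      have "coeff (g * g') n \<in> B" for n unfolding coeff_mult
        by (intro subring_sum[OF B(2)]) (use g R(4) in blast)
      then show "x * x' \<in> T" unfolding T_def using g
        by (intro CollectI exI[of _ "g * g'"]) auto
    qed
    ultimately have "inverse t \<in> T" using max[of T] B(1) BT by auto
    then obtain g where g: "inverse t = poly g u" "\<forall>n. coeff g n \<in> B" by (auto simp: T_def)
    then have "1 = t * (\<Sum>k\<le>degree g. coeff g k * u ^ k)" using t0 by (simp add: poly_altdef[symmetric] g(1)[symmetric])
    then show ?thesis using g(2) unfolding rel_def by (intro exI[of _ "degree g"] exI[of _ "coeff g"]) auto
  qed
  \<comment> \<open>Dividing the relation for \<open>inverse u\<close> by the unit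
    \<open>1 - t * c 0\<close> and multiplying by \<open>u ^ Suc n\<close> expresses
    \<open>u ^ Suc n\<close> through lower powers; substitution removes the top term from the
    relation for \<open>u\<close>.\<close>
  have step: "rel u n" if u0: "u \<noteq> 0" and r: "rel u (Suc n)" "rel (inverse u) (Suc n)" for u n
  proof -
    obtain b c where b: "\<forall>k. b k \<in> B" "1 = t * (\<Sum>k\<le>Suc n. b k * u ^ k)"
      and c: "\<forall>k. c k \<in> B" "1 = t * (\<Sum>k\<le>Suc n. c k * inverse u ^ k)" using r by (auto simp: rel_def)
    define e where "e = inverse (1 + t * (- c 0))"
    have eB: "e \<in> B" unfolding e_def using c R(5) by (intro unit) auto
    have e1: "e * (1 - t * c 0) = 1" using ne[of "- c 0"] c R(5) by (simp add: e_def)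
    have "(\<Sum>k\<le>Suc n. c k * inverse u ^ k) = c 0 + (\<Sum>k\<le>n. c (Suc k) * inverse u ^ Suc k)"
      by (subst sum.atMost_Suc_shift) simp
    then have c1: "1 - t * c 0 = t * (\<Sum>k\<le>n. c (Suc k) * inverse u ^ Suc k)" 
      using c(2) by (simp add: algebra_simps)
    have "u ^ Suc n = u ^ Suc n * (e * (1 - t * c 0))" by (simp add: e1)
    also have "\<dots> = e * t * (\<Sum>k\<le>n. c (Suc k) * (u ^ Suc n * inverse u ^ Suc k))"
      unfolding c1 by (simp add: sum_distrib_left mult_ac)
    also have "(\<Sum>k\<le>n. c (Suc k) * (u ^ Suc n * inverse u ^ Suc k)) = (\<Sum>k\<le>n. c (Suc k) * u ^ (n - k))"
    proof (rule sum.cong[OF refl])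
      fix k assume "k \<in> {..n}"
      then have "u ^ Suc n = u ^ (n - k) * u ^ Suc k" by (simp add: power_add[symmetric] del: power_Suc)
      then show "c (Suc k) * (u ^ Suc n * inverse u ^ Suc k) = c (Suc k) * u ^ (n - k)"
        using u0 by (simp add: power_inverse field_simps)
    qed
    also have "\<dots> = (\<Sum>k\<le>n. c (Suc n - k) * u ^ k)"
      by (rule sum.reindex_bij_witness[of _ "\<lambda>k. n - k" "\<lambda>k. n - k"]) (auto simp: Suc_diff_le)
    finally have us: "u ^ Suc n = e * t * (\<Sum>k\<le>n. c (Suc n - k) * u ^ k)" .
    have "1 = t * ((\<Sum>k\<le>n. b k * u ^ k) + b (Suc n) * u ^ Suc n)" using b(2) by simp
    also have "\<dots> = t * (\<Sum>k\<le>n. (b k + b (Suc n) * e * t * c (Suc n - k)) * u ^ k)"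
      unfolding us by (simp add: sum.distrib sum_distrib_left algebra_simps)
    finally show ?thesis unfolding rel_def using b(1) c(1) eB tB R
      by (intro exI[of _ "\<lambda>k. b k + b (Suc n) * e * t * c (Suc n - k)"]) auto
  qed
  have no: "\<not> (rel u n \<and> rel (inverse u) n)" if "u \<noteq> 0" for u n
  proof (induction n)
    case (Suc n)
    then show ?case using step[OF that, of n] step[of "inverse u" n] that by auto
  qed (use rel0 in auto)
  have "u \<in> B \<or> inverse u \<in> B" for u
  proof (rule ccontr)
    assume nu: "\<not> ?thesis"
    then obtain n n' where "rel u n" "rel (inverse u) n'" using ex by blast
    then have "rel u (max n n')" "rel (inverse u) (max n n')" using relmono by auto
    moreover have "u \<noteq> 0" using nu R(2) by auto
    ultimately show False using no by blast
  qed
  then show ?thesis using B unfolding valring_def by blast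
qed

section \<open>Places of the rational function field\<close>

text \<open>Valuation rings are maximal under domination: an element outside \<open>W\<close> has
  its inverse among the non-units of \<open>W\<close>, hence of \<open>V\<close>, and so lies
  outside \<open>V\<close> too.\<close>

lemma valring_eqI:
  assumes V: "valring V" and W: "valring W" and sub: "W \<subseteq> V" and m: "maxideal W \<subseteq> maxideal V"
  shows "V = W"
proof -
  have "a \<in> W" if "a \<in> V" for a
  proof (rule ccontr)
    assume "a \<notin> W"
    then have "inverse a \<in> maxideal V" "a \<noteq> 0"
      using m W subringD(2)[OF valring_subring[OF W]] by (auto simp: maxideal_iff)
    then show False using V that by (simp add: maxideal_iff)
  qed
  then show ?thesis using sub by auto
qed

section \<open>Multiplicities of irreducible polynomials\<close>

lemma irreducible_degree_pos: "irreducible (p :: 'k::field poly) \<Longrightarrow> degree p > 0"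
  by (metis irreducible_def is_unit_iff_degree bot_nat_0.not_eq_extremum)

lemma irreducible_factor_exists:
  fixes b :: "'k::field poly"
  assumes "degree b > 0"
  shows "\<exists>p. irreducible p \<and> p dvd b"
proof -
  define Q where "Q n \<longleftrightarrow> (\<exists>p. degree p = n \<and> n > 0 \<and> p dvd b)" for n
  have "Q (degree b)" using assms by (auto simp: Q_def)
  then have "Q (Least Q)" by (rule LeastI)
  then obtain p where p: "degree p = Least Q" "degree p > 0" "p dvd b" by (auto simp: Q_def)
  have "irreducible p"
  proof (rule irreducibleI)
    show "p \<noteq> 0" using p by auto
    then show "\<not> is_unit p" using p by (simp add: is_unit_iff_degree)
    fix c d assume cd: "p = c * d"
    with p have n: "c \<noteq> 0" "d \<noteq> 0" by auto
    have "is_unit d" if "degree c > 0"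
    proof -
      have "Q (degree c)" using that cd dvd_trans[of c p b] p(3) by (auto simp: Q_def)
      then have "degree p \<le> degree c" using p(1) by (simp add: Least_le)
      then show ?thesis using cd n by (simp add: degree_mult_eq is_unit_iff_degree)
    qed
    then show "is_unit c \<or> is_unit d" using n by (metis is_unit_iff_degree neq0_conv)
  qed
  then show ?thesis using p by auto
qed

lemma irreducible_monic_associate:
  fixes p :: "'k::field poly"
  assumes "irreducible p"
  shows "\<exists>q. irreducible q \<and> lead_coeff q = 1 \<and> p dvd q \<and> q dvd p"
proof -
  let ?u = "[:inverse (lead_coeff p):]"
  have l: "lead_coeff p \<noteq> 0" using assms by auto
  have u: "is_unit ?u" using l by (simp add: is_unit_iff_degree)
  have "irreducible (?u * p)" using assms u by (simp only: irreducible_mult_unit_left)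
  moreover have "lead_coeff (?u * p) = 1" using l by simp
  moreover have "p dvd ?u * p" by (rule dvd_triv_right)
  moreover have "?u * p dvd p" using u by (simp only: mult_unit_dvd_iff') simp
  ultimately show ?thesis by blast
qed

definition pord :: "'k::field poly \<Rightarrow> 'k poly \<Rightarrow> nat" where
  "pord p a = (THE n. \<exists>b. a = p ^ n * b \<and> \<not> p dvd b)"

lemma pord_eq:
  fixes p :: "'k::field poly"
  assumes p: "p \<noteq> 0" and b: "\<not> p dvd b"
  shows "pord p (p ^ n * b) = n"
  unfolding pord_def
proof (rule the_equality)
  fix k assume "\<exists>c. p ^ n * b = p ^ k * c \<and> \<not> p dvd c"
  then obtain c where c: "p ^ n * b = p ^ k * c" "\<not> p dvd c" by auto
  show "k = n"
  proof (rule linorder_cases[of k n])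
    assume "k < n"
    then obtain j where "n = k + Suc j" using less_iff_Suc_add by auto
    then have "p * (p ^ j * b) = c" using c(1) p by (auto simp: power_add mult.assoc)
    then show ?thesis using c(2) by auto
  next
    assume "n < k"
    then obtain j where "k = n + Suc j" using less_iff_Suc_add by auto
    then have "b = p * (p ^ j * c)" using c(1) p by (auto simp: power_add mult.assoc)
    then show ?thesis using b by auto
  qed auto
qed (use b in auto)

lemma pord_decomp:
  fixes p :: "'k::field poly"
  assumes p: "degree p > 0" and a: "a \<noteq> 0"
  obtains b where "a = p ^ pord p a * b" "\<not> p dvd b"
proof -
  have "\<exists>n b. a = p ^ n * b \<and> \<not> p dvd b" using a
  proof (induction "degree a" arbitrary: a rule: less_induct)
    case less
    show ?case
    proof (cases "p dvd a")
      case True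
      then obtain c where c: "a = p * c" by auto
      then have "c \<noteq> 0" "p \<noteq> 0" using less by auto
      then have "degree c < degree a" using c p by (simp add: degree_mult_eq)
      then obtain n b where "c = p ^ n * b" "\<not> p dvd b" using less \<open>c \<noteq> 0\<close> by blast
      then show ?thesis using c by (intro exI[of _ "Suc n"] exI[of _ b]) (simp add: mult.assoc)
    qed (auto intro: exI[of _ 0])
  qed
  then obtain n b where nb: "a = p ^ n * b" "\<not> p dvd b" by auto
  moreover have "p \<noteq> 0" using p by auto
  ultimately have "pord p a = n" using pord_eq by blast
  then show ?thesis using nb that by auto
qed

lemma pord_mult:
  fixes p :: "'k::field poly"
  assumes p: "irreducible p" and "a \<noteq> 0" "b \<noteq> 0"
  shows "pord p (a * b) = pord p a + pord p b"
proof -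
  note d = irreducible_degree_pos[OF p]
  obtain a' where a: "a = p ^ pord p a * a'" "\<not> p dvd a'" using pord_decomp[OF d] assms by blast
  obtain b' where b: "b = p ^ pord p b * b'" "\<not> p dvd b'" using pord_decomp[OF d] assms by blast
  have "\<not> p dvd a' * b'" using a b field_poly_irreducible_imp_prime[OF p] prime_elem_dvd_mult_iff by blast
  moreover have "a * b = p ^ (pord p a + pord p b) * (a' * b')"
    by (subst a(1), subst b(1)) (simp add: power_add)
  ultimately show ?thesis using pord_eq[of p] p by (metis not_irreducible_zero)
qed

lemma pord_geI:
  fixes p :: "'k::field poly"
  assumes p: "degree p > 0" and "a \<noteq> 0" "p ^ n dvd a" shows "n \<le> pord p a"
proof (rule ccontr)
  assume "\<not> n \<le> pord p a"
  then have "p ^ Suc (pord p a) dvd a" using assms(3) by (meson not_less_eq_eq power_le_dvd)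
  moreover obtain b where b: "a = p ^ pord p a * b" "\<not> p dvd b" using pord_decomp[OF p assms(2)] .
  ultimately have "p ^ pord p a * p dvd p ^ pord p a * b" by (metis power_Suc2)
  moreover have "p \<noteq> 0" using p by auto
  ultimately show False using b(2) by simp
qed

lemma pord_diff:
  fixes p :: "'k::field poly"
  assumes p: "irreducible p" and "a \<noteq> 0" "b \<noteq> 0" "a - b \<noteq> 0"
  shows "min (pord p a) (pord p b) \<le> pord p (a - b)"
proof (rule pord_geI)
  show d: "degree p > 0" by (rule irreducible_degree_pos[OF p])
  have "p ^ min (pord p a) (pord p b) dvd c" if "c = a \<or> c = b" for c
    using that pord_decomp[OF d \<open>a \<noteq> 0\<close>] pord_decomp[OF d \<open>b \<noteq> 0\<close>]
    by (metis dvd_triv_left le_imp_power_dvd dvd_trans min.cobounded1 min.cobounded2)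
  then show "p ^ min (pord p a) (pord p b) dvd a - b" by (intro dvd_diff) auto
qed fact

section \<open>Valuations of the rational function field\<close>

text \<open>One extension from polynomials to quotients serves both the order at an irreducible
  polynomial and minus the degree.\<close>

definition fval :: "('k::field poly \<Rightarrow> int) \<Rightarrow> 'k poly fract \<Rightarrow> int" where
  "fval \<mu> g = (THE n. \<exists>a b. a \<noteq> 0 \<and> b \<noteq> 0 \<and> g = Fract a b \<and> n = \<mu> a - \<mu> b)"

text \<open>Zero is added by hand because the value of \<open>v\<close> at 0 is arbitrary.\<close>

definition nonneg_ring :: "('a::zero \<Rightarrow> int) \<Rightarrow> 'a set" where
  "nonneg_ring v = {g. g = 0 \<or> 0 \<le> v g}"

definition vp :: "'k::field poly \<Rightarrow> 'k poly fract \<Rightarrow> int" where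
  "vp p = fval (\<lambda>a. int (pord p a))"

definition vinf :: "'k::field poly fract \<Rightarrow> int" where
  "vinf = fval (\<lambda>a. - int (degree a))"

lemma fval_Fract:
  assumes m: "\<And>a b. a \<noteq> 0 \<Longrightarrow> b \<noteq> 0 \<Longrightarrow> \<mu> (a * b) = \<mu> a + \<mu> b" and "a \<noteq> 0" "b \<noteq> 0"
  shows "fval \<mu> (Fract a b) = \<mu> a - \<mu> b"
  unfolding fval_def
proof (rule the_equality)
  fix n assume "\<exists>c d. c \<noteq> 0 \<and> d \<noteq> 0 \<and> Fract a b = Fract c d \<and> n = \<mu> c - \<mu> d"
  then obtain c d where *: "c \<noteq> 0" "d \<noteq> 0" "Fract a b = Fract c d" "n = \<mu> c - \<mu> d" by auto
  then have "\<mu> (a * d) = \<mu> (c * b)" using assms by (simp add: eq_fract)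
  then show "n = \<mu> a - \<mu> b" using * assms by (simp add: m)
qed (use assms in blast)

text \<open>Common denominators carry additivity and the ultrametric inequality from polynomials to
  quotients; the element \<open>t\<close> of nonzero order keeps the ring from being the whole
  field.\<close>

lemma fval_valuation:
  assumes m: "\<And>a b. a \<noteq> 0 \<Longrightarrow> b \<noteq> 0 \<Longrightarrow> \<mu> (a * b) = \<mu> a + \<mu> b"
    and u: "\<And>a b. a \<noteq> 0 \<Longrightarrow> b \<noteq> 0 \<Longrightarrow> a - b \<noteq> 0 \<Longrightarrow> min (\<mu> a) (\<mu> b) \<le> \<mu> (a - b)"
    and t: "t \<noteq> 0" "\<mu> t \<noteq> 0"
  shows "valring (nonneg_ring (fval \<mu>))" "valuation_of (nonneg_ring (fval \<mu>)) (fval \<mu>)"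
proof -
  let ?v = "fval \<mu>"
  note F = fval_Fract[OF m]
  have mult: "?v (g * h) = ?v g + ?v h" if "g \<noteq> 0" "h \<noteq> 0" for g h
  proof -
    obtain a b c d where "g = Fract a b" "b \<noteq> 0" "a \<noteq> 0" "h = Fract c d" "d \<noteq> 0" "c \<noteq> 0"
      using \<open>g \<noteq> 0\<close> \<open>h \<noteq> 0\<close> by (metis Fract_cases_nonzero)
    then show ?thesis by (simp add: F m)
  qed
  then show v: "valuation_of (nonneg_ring ?v) ?v" by (auto simp: valuation_of_def nonneg_ring_def)
  note D = valuation_ofD[OF v]
  have diff: "min (?v g) (?v h) \<le> ?v (g - h)" if gh: "g \<noteq> 0" "h \<noteq> 0" "g - h \<noteq> 0" for g h
  proof -
    obtain a b c d where *: "g = Fract a b" "b \<noteq> 0" "a \<noteq> 0" "h = Fract c d" "d \<noteq> 0" "c \<noteq> 0"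
      using gh(1,2) by (metis Fract_cases_nonzero)
    have "a * d - c * b \<noteq> 0" using gh(3) * by (auto simp: fract_collapse)
    then show ?thesis using u[of "a * d" "c * b"] * by (auto simp: F m)
  qed
  have "?v (- h) = ?v h" if "h \<noteq> 0" for h
  proof -
    have "(-1 :: 'a poly fract) * -1 = 1" "(-1 :: 'a poly fract) \<noteq> 0" by auto
    then have "?v (-1) = 0" using mult[of "-1" "-1"] D(3) by simp
    then show ?thesis using mult[of "-1" h] that by simp
  qed
  note neg = this
  have "g - k \<in> nonneg_ring ?v" if "g \<in> nonneg_ring ?v" "k \<in> nonneg_ring ?v" for g k
    using diff[of g k] neg[of k] that unfolding nonneg_ring_def
    by (cases "g = 0"; cases "k = 0"; cases "g - k = 0") auto
  moreover have "g * k \<in> nonneg_ring ?v" if "g \<in> nonneg_ring ?v" "k \<in> nonneg_ring ?v" for g k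
    using mult[of g k] that unfolding nonneg_ring_def by (cases "g = 0"; cases "k = 0") auto
  ultimately have "is_subring (nonneg_ring ?v)" using D(3) by (auto simp: is_subring_def nonneg_ring_def)
  moreover have "a \<in> nonneg_ring ?v \<or> inverse a \<in> nonneg_ring ?v" for a
    using D(4)[of a] by (auto simp: nonneg_ring_def)
  moreover have "nonneg_ring ?v \<noteq> UNIV"
  proof -
    have "?v (Fract t 1) \<noteq> 0" using F[of t 1] m[of 1 1] t by simp
    moreover have "Fract t 1 \<noteq> 0" using t by (simp add: Zero_fract_def eq_fract)
    ultimately have "Fract t 1 \<notin> nonneg_ring ?v \<or> inverse (Fract t 1) \<notin> nonneg_ring ?v"
      using D(4)[of "Fract t 1"] nonzero_imp_inverse_nonzero[of "Fract t 1"] by (auto simp: nonneg_ring_def simp del: inverse_fract)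
    then show ?thesis by blast
  qed
  ultimately show "valring (nonneg_ring ?v)" by (auto simp: valring_def)
qed

lemma vp_valuation:
  assumes "irreducible p"
  shows "valring (nonneg_ring (vp p))" "valuation_of (nonneg_ring (vp p)) (vp p)"
proof -
  have 1: "int (pord p (a * b)) = int (pord p a) + int (pord p b)" if "a \<noteq> 0" "b \<noteq> 0" for a b
    using pord_mult[OF assms that] by simp
  have 2: "min (int (pord p a)) (int (pord p b)) \<le> int (pord p (a - b))" if "a \<noteq> 0" "b \<noteq> 0" "a - b \<noteq> 0" for a b
    using pord_diff[OF assms that] by linarith
  have "\<not> p dvd 1" "p \<noteq> 0" using assms by (auto simp: irreducible_def)
  then have 3: "p \<noteq> 0" "int (pord p p) \<noteq> 0" using pord_eq[of p 1 1] by auto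
  show "valring (nonneg_ring (vp p))" "valuation_of (nonneg_ring (vp p)) (vp p)"
    unfolding vp_def using fval_valuation[of "\<lambda>a. int (pord p a)" p, OF 1 2 3] by auto
qed

lemma vinf_valuation:
  "valring (nonneg_ring (vinf :: 'k::field poly fract \<Rightarrow> int))" "valuation_of (nonneg_ring vinf) (vinf :: 'k poly fract \<Rightarrow> int)"
proof -
  have 1: "- int (degree (a * b)) = - int (degree a) + - int (degree b)" if "a \<noteq> 0" "b \<noteq> 0" for a b :: "'k poly"
    using that by (simp add: degree_mult_eq)
  have 2: "min (- int (degree a)) (- int (degree b)) \<le> - int (degree (a - b))" for a b :: "'k poly"
    using degree_diff_le_max[of a b] by linarith
  have 3: "[:0, 1 :: 'k:] \<noteq> 0" "- int (degree [:0, 1 :: 'k:]) \<noteq> 0" by auto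
  show "valring (nonneg_ring (vinf :: 'k::field poly fract \<Rightarrow> int))" "valuation_of (nonneg_ring vinf) (vinf :: 'k poly fract \<Rightarrow> int)"
    unfolding vinf_def using fval_valuation[of "\<lambda>a. - int (degree a)" "[:0, 1 :: 'k:]", OF 1 2 3] by auto
qed

lemma vp_Fract: "irreducible p \<Longrightarrow> a \<noteq> 0 \<Longrightarrow> b \<noteq> 0 \<Longrightarrow> vp p (Fract a b) = int (pord p a) - int (pord p b)"
  unfolding vp_def by (rule fval_Fract) (simp_all add: pord_mult)

lemma vinf_Fract: "a \<noteq> 0 \<Longrightarrow> b \<noteq> 0 \<Longrightarrow> vinf (Fract a b) = int (degree b) - int (degree a)"
  unfolding vinf_def by (subst fval_Fract) (simp_all add: degree_mult_eq)

lemma pord_1: "irreducible p \<Longrightarrow> pord p 1 = 0"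
  using pord_eq[of p 1 0] by (auto simp: irreducible_def)

lemma pord_eq_0: "p \<noteq> 0 \<Longrightarrow> \<not> p dvd a \<Longrightarrow> pord p a = 0"
  using pord_eq[of p a 0] by auto

lemma vp_rat: "irreducible p \<Longrightarrow> a \<noteq> 0 \<Longrightarrow> vp p (rat_of_poly a) = int (pord p a)"
  by (simp add: rat_of_poly_def vp_Fract pord_1)

lemma vp_self: "irreducible p \<Longrightarrow> vp p (rat_of_poly p) = 1"
  using pord_eq[of p 1 1] by (auto simp: vp_rat irreducible_def)

lemma vinf_rat: "a \<noteq> 0 \<Longrightarrow> vinf (rat_of_poly a) = - int (degree a)"
  by (simp add: rat_of_poly_def vinf_Fract)

lemma rat_of_poly_embedding:
  "rat_of_poly (a + b) = rat_of_poly a + rat_of_poly b" "rat_of_poly (a * b) = rat_of_poly a * rat_of_poly b"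
  "rat_of_poly 0 = 0" "rat_of_poly 1 = 1" "rat_of_poly a = 0 \<longleftrightarrow> a = 0"
  by (simp_all add: rat_of_poly_def Zero_fract_def One_fract_def eq_fract)

lemma irreducible_monic_dvd_eq:
  fixes p q :: "'k::field poly"
  assumes "irreducible p" "irreducible q" "lead_coeff p = 1" "lead_coeff q = 1" "p dvd q"
  shows "p = q"
proof -
  obtain c where c: "q = p * c" using assms by auto
  then have "is_unit c" using assms by (metis irreducible_def)
  then obtain u where u: "c = [:u:]" by (metis is_unit_polyE)
  then have "lead_coeff q = lead_coeff p * u" using c by (simp only: lead_coeff_mult) simp
  then have "u = 1" using assms(3,4) by simp
  then show ?thesis using c u by simp
qed

lemma vp_other:
  assumes "irreducible p" "irreducible q" "lead_coeff p = 1" "lead_coeff q = 1" "p \<noteq> q"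
  shows "vp p (rat_of_poly q) = 0"
proof -
  have "\<not> p dvd q" using irreducible_monic_dvd_eq assms by blast
  moreover have "p \<noteq> 0" "q \<noteq> 0" using assms by auto
  ultimately show ?thesis using assms(1) by (simp add: vp_rat pord_eq_0)
qed

lemma vp_const:
  assumes "irreducible p" "c \<noteq> 0" shows "vp p (rat_of_poly [:c:]) = 0"
proof -
  have "\<not> p dvd [:c:]" using assms irreducible_degree_pos[of p] dvd_imp_degree_le[of p "[:c:]"] by auto
  moreover have "p \<noteq> 0" using assms by auto
  ultimately have "pord p [:c:] = 0" by (rule pord_eq_0[rotated])
  then show ?thesis using assms by (simp add: vp_rat)
qed

lemma vinf_const: "c \<noteq> 0 \<Longrightarrow> vinf (rat_of_poly [:c:]) = 0"
  by (simp add: vinf_rat)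

text \<open>An element without finite poles is a polynomial: an irreducible factor of the
  denominator must divide the numerator and cancels. This is the only global input of the degree
  count.\<close>

lemma vinf_nonpos:
  fixes g :: "'k::field poly fract"
  assumes "g \<noteq> 0" and pos: "\<And>p. irreducible p \<Longrightarrow> lead_coeff p = 1 \<Longrightarrow> 0 \<le> vp p g"
  shows "vinf g \<le> 0"
proof -
  obtain a b where g: "g = Fract a b" "a \<noteq> 0" "b \<noteq> 0" using assms(1) by (metis Fract_cases_nonzero)
  have "degree b \<le> degree a" if "Fract a b = g" "a \<noteq> 0" "b \<noteq> 0" for a b using that
  proof (induction "degree b" arbitrary: a b rule: less_induct)
    case less
    show ?case
    proof (cases "degree b = 0")
      case False
      then obtain p where p: "irreducible p" "p dvd b" "lead_coeff p = 1"
        using irreducible_factor_exists[of b] irreducible_monic_associate by (metis dvd_trans neq0_conv)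
      have p': "p \<noteq> 0" "degree p > 0" using p irreducible_degree_pos by auto
      have "int (pord p b) \<le> int (pord p a)" using pos[OF p(1,3)] less(2-) p(1) vp_Fract[of p a b] by simp
      moreover have "1 \<le> pord p b" using pord_geI[OF p'(2), of b 1] less p by simp
      ultimately have "p dvd a" using pord_eq_0[OF p'(1), of a] by auto
      then obtain c d where cd: "a = p * c" "b = p * d" using p(2) by blast
      then have n: "c \<noteq> 0" "d \<noteq> 0" using less by auto
      have "Fract c d = g" using less(2) cd p' by (simp add: mult_fract_cancel)
      moreover have "degree d < degree b" using cd p' n by (simp add: degree_mult_eq)
      ultimately have "degree d \<le> degree c" using less(1) n by blast
      then show ?thesis using cd n p' by (simp add: degree_mult_eq)
    qed simp
  qed
  then show ?thesis using g by (simp add: vinf_Fract)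
qed

section \<open>Classification of the valuation rings of K(x) over K\<close>

lemma rat_polys_subset:
  assumes V: "valring V" and K: "rat_consts \<subseteq> V" and x: "rat_x \<in> V"
  shows "rat_of_poly a \<in> V"
proof (induction a)
  case 0
  then show ?case using subringD(2)[OF valring_subring[OF V]] by (simp add: rat_of_poly_embedding)
next
  case (pCons c a)
  have "pCons c a = [:c:] + [:0,1:] * a" by simp
  then have "rat_of_poly (pCons c a) = rat_of_poly [:c:] + rat_x * rat_of_poly a"
    by (metis rat_of_poly_embedding(1,2) rat_x_def)
  moreover have "rat_of_poly [:c:] \<in> V" using K by (auto simp: rat_consts_def)
  ultimately show ?case using pCons x subringD[OF valring_subring[OF V]] by auto
qed

text \<open>After powers of \<open>p\<close> are cancelled, the denominator is prime to
  \<open>p\<close> and hence a unit of \<open>V\<close>. The exponent \<open>n\<close> left in the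
  numerator is tracked because non-units must be seen to go to non-units, as
  \<open>valring_eqI\<close> demands.\<close>

lemma rat_place_finite_eq:
  assumes V: "valring V" and R: "\<And>a. rat_of_poly a \<in> V" and p: "irreducible p"
    and I: "\<And>a. rat_of_poly a \<in> maxideal V \<longleftrightarrow> p dvd a"
  shows "V = nonneg_ring (vp p)"
proof (rule valring_eqI[OF V])
  note v = vp_valuation[OF p] and S = subringD[OF valring_subring[OF V]] 
  note D = valuation_ofD[OF v(2)] and d = irreducible_degree_pos[OF p]
  show "valring (nonneg_ring (vp p))" by fact
  have key: "\<exists>n c u. g = rat_of_poly (p ^ n * c) * u \<and> u \<in> V \<and> (0 < vp p g \<longrightarrow> n > 0)" 
    if g: "g \<noteq> 0" "0 \<le> vp p g" for g
  proof -
    obtain a b where ab: "g = Fract a b" "a \<noteq> 0" "b \<noteq> 0" using g(1) by (metis Fract_cases_nonzero)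
    obtain a' where a: "a = p ^ pord p a * a'" "\<not> p dvd a'" using pord_decomp[OF d] ab by blast
    obtain b' where b: "b = p ^ pord p b * b'" "\<not> p dvd b'" using pord_decomp[OF d] ab by blast
    have vg: "vp p g = int (pord p a) - int (pord p b)" using ab p by (simp add: vp_Fract)
    then obtain n where n: "pord p a = pord p b + n" using g by (metis le_Suc_ex of_nat_le_iff diff_ge_0_iff_ge)
    have "p \<noteq> 0" using p by auto
    have "a = p ^ pord p b * (p ^ n * a')" using a(1) n by (metis power_add mult.assoc)
    then have "g = Fract (p ^ n * a') b'" using ab(1) b(1) \<open>p \<noteq> 0\<close> 
      by (metis mult_fract_cancel power_not_zero)
    then have "g = rat_of_poly (p ^ n * a') * inverse (rat_of_poly b')"
      by (simp add: rat_of_poly_def)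
    moreover have "inverse (rat_of_poly b') \<in> V" using I[of b'] b(2) V by (auto simp: maxideal_iff)
    ultimately show ?thesis using n vg by (intro exI[of _ n] exI[of _ a'] exI[of _ "inverse (rat_of_poly b')"]) auto
  qed
  show "nonneg_ring (vp p) \<subseteq> V" 
  proof
    fix g assume g: "g \<in> nonneg_ring (vp p)"
    show "g \<in> V"
    proof (cases "g = 0")
      case False
      then show ?thesis using key[of g] g R S by (auto simp: nonneg_ring_def)
    qed (use S in auto)
  qed
  show "maxideal (nonneg_ring (vp p)) \<subseteq> maxideal V"
  proof
    fix g assume g: "g \<in> maxideal (nonneg_ring (vp p))"
    show "g \<in> maxideal V"
    proof (cases "g = 0")
      case False
      then have "0 < vp p g" using g v D(4)[of g] by (auto simp: maxideal_iff nonneg_ring_def)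
      then obtain n c u where *: "g = rat_of_poly (p ^ n * c) * u" "u \<in> V" "n > 0" 
        using key[OF False] by auto
      then have "rat_of_poly (p ^ n * c) \<in> maxideal V" unfolding I by (auto intro: dvd_mult2 dvd_power)
      then show ?thesis using * maxideal_mult[OF V] by blast
    qed (use V in \<open>simp add: maxideal_iff\<close>)
  qed
qed

text \<open>The non-units of \<open>V\<close> cut out a prime ideal \<open>I\<close> of K[x]. It is
  not zero, as otherwise all denominators would be invertible and \<open>V\<close> everything; an
  element of least degree generates it.\<close>

lemma rat_place_prime:
  fixes V :: "'k::field poly fract set"
  assumes V: "valring V" and K: "rat_consts \<subseteq> V" and R: "\<And>a. rat_of_poly a \<in> V"
  shows "\<exists>p. irreducible p \<and> (\<forall>a. rat_of_poly a \<in> maxideal V \<longleftrightarrow> p dvd a)"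
proof -
  note S = subringD[OF valring_subring[OF V]]
  define I where "I = {a. rat_of_poly a \<in> maxideal V}"
  have unit: "inverse (rat_of_poly a) \<in> V" "a \<noteq> 0" if "a \<notin> I" for a 
    using that V by (auto simp: I_def maxideal_iff rat_of_poly_embedding)
  have Im: "a * b \<in> I" if "a \<in> I" for a b
    using that R maxideal_mult[OF V] by (auto simp: I_def rat_of_poly_embedding)
  \<comment> \<open>If \<open>a - b\<close> were a unit, then
    \<open>a / (a - b) = 1 + b / (a - b)\<close> would be both a non-unit and of the form 1 plus a
    non-unit.\<close>
  have Id: "a - b \<in> I" if "a \<in> I" "b \<in> I" for a b
  proof (rule ccontr)
    assume n: "a - b \<notin> I"
    have e: "rat_of_poly (a - b) = rat_of_poly a - rat_of_poly b"
      using rat_of_poly_embedding(1)[of "a - b" b] by simp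
    let ?u = "inverse (rat_of_poly (a - b))"
    have n0: "rat_of_poly (a - b) \<noteq> 0" using unit(2)[OF n] by (simp add: rat_of_poly_embedding)
    have ab: "rat_of_poly a * ?u \<in> maxideal V" "rat_of_poly b * ?u \<in> maxideal V" using that maxideal_mult[OF V] unit[OF n] by (auto simp: I_def)
    have "vunit V (1 + rat_of_poly b * ?u)" using ab vunit_1_plus_maxideal[OF V] by blast
    moreover have "1 + rat_of_poly b * ?u = rat_of_poly a * ?u" using n0 by (simp add: e field_simps)
    ultimately show False using ab(1) V by (auto simp: vunit_def maxideal_iff)
  qed
  have Ip: "a \<in> I \<or> b \<in> I" if "a * b \<in> I" for a b
  proof (rule ccontr)
    assume n: "\<not> (a \<in> I \<or> b \<in> I)"
    then have "inverse (rat_of_poly (a * b)) \<in> V" 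
      using unit[of a] unit[of b] S by (auto simp: rat_of_poly_embedding)
    moreover have "a * b \<noteq> 0" using n unit[of a] unit[of b] by auto
    ultimately show False using that V by (simp add: I_def maxideal_iff rat_of_poly_embedding)
  qed
  have Ic: "degree a > 0" if "a \<in> I" "a \<noteq> 0" for a
  proof (rule ccontr)
    assume "\<not> degree a > 0"
    then obtain c where c: "a = [:c:]" by (metis degree_eq_zeroE not_gr_zero)
    have "rat_of_poly a * rat_of_poly [:inverse c:] = 1" using that c by (simp flip: rat_of_poly_embedding(2,3,4) add: one_pCons)
    then have "inverse (rat_of_poly a) = rat_of_poly [:inverse c:]" by (rule inverse_unique)
    then have "inverse (rat_of_poly a) \<in> V" using K by (auto simp: rat_consts_def)
    then show False using that V by (simp add: I_def maxideal_iff rat_of_poly_embedding)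
  qed
  have "\<exists>a. a \<in> I \<and> a \<noteq> 0"
  proof (rule ccontr)
    assume n: "\<not> ?thesis"
    have "g \<in> V" for g
    proof (cases g)
      case (Fract a b)
      then have "g = rat_of_poly a * inverse (rat_of_poly b)" by (simp add: rat_of_poly_def)
      moreover have "inverse (rat_of_poly b) \<in> V" using unit n Fract by blast
      ultimately show ?thesis using S R by simp
    qed
    then show False using V by (auto simp: valring_def)
  qed
  define Q where "Q n \<longleftrightarrow> (\<exists>a. a \<in> I \<and> a \<noteq> 0 \<and> degree a = n)" for n
  have "\<exists>n. Q n" using \<open>\<exists>a. a \<in> I \<and> a \<noteq> 0\<close> by (auto simp: Q_def)
  then have "Q (Least Q)" by (rule LeastI_ex)
  then obtain p where p: "p \<in> I" "p \<noteq> 0" "degree p = Least Q" by (auto simp: Q_def)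
  have pm: "degree p \<le> degree a" if "a \<in> I" "a \<noteq> 0" for a
    using that p(3) by (auto simp: Q_def intro!: Least_le)
  have dv: "p dvd a" if "a \<in> I" for a
  proof (rule ccontr)
    assume nd: "\<not> p dvd a"
    have "a mod p = a - p * (a div p)" by (simp add: minus_mult_div_eq_mod)
    then have "a mod p \<in> I" using Id[OF that Im[OF p(1)]] by simp
    moreover have "a mod p \<noteq> 0" using nd by (simp add: dvd_eq_mod_eq_0)
    ultimately show False using pm degree_mod_less[of p a] p(2) by force
  qed
  have "irreducible p"
  proof (rule irreducibleI)
    show "p \<noteq> 0" by fact
    show "\<not> is_unit p" using p(1,2) Ic by (metis is_unit_iff_degree less_irrefl)
    fix c d assume cd: "p = c * d"
    have *: "is_unit e" if "e' \<in> I" "p = e' * e" for e e'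
    proof -
      have "e' \<noteq> 0" "e \<noteq> 0" using that p by auto
      then show ?thesis using pm[OF that(1)] that(2) by (simp add: degree_mult_eq is_unit_iff_degree)
    qed
    have "c \<in> I \<or> d \<in> I" using Ip[of c d] cd p(1) by simp
    moreover have "p = d * c" using cd by (simp only: mult.commute)
    ultimately show "is_unit c \<or> is_unit d" using *[OF _ cd] *[of d c] by blast
  qed
  moreover have "a \<in> I" if "p dvd a" for a using that Im[OF p(1)] by auto
  ultimately show ?thesis using dv by (auto simp: I_def)
qed

text \<open>Where \<open>x\<close> has a pole, the lower coefficients are non-units relative to the
  leading power of \<open>x\<close>, so dividing by that power leaves a unit.\<close>

lemma poly_over_lead_power:
  fixes V :: "'k::field poly fract set"
  assumes V: "valring V" and K: "rat_consts \<subseteq> V" and x: "rat_x \<notin> V" and "a \<noteq> 0"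
  shows "vunit V (rat_of_poly a / rat_x ^ degree a)"
  using \<open>a \<noteq> 0\<close>
proof (induction a)
  case (pCons c a)
  note S = subringD[OF valring_subring[OF V]]
  have c: "rat_of_poly [:c:] \<in> V" for c using K by (auto simp: rat_consts_def)
  have x0: "rat_x \<noteq> (0 :: 'k poly fract)" using x S(2) by metis
  have u: "inverse rat_x \<in> maxideal V" "inverse rat_x \<in> V" using V x valring_total by (auto simp: maxideal_iff)
  show ?case
  proof (cases "a = 0")
    case True
    have "rat_of_poly [:c:] * rat_of_poly [:inverse c:] = 1"
      using pCons True by (simp flip: rat_of_poly_embedding(2,3,4) add: one_pCons)
    then have "inverse (rat_of_poly [:c:]) = rat_of_poly [:inverse c:]" by (rule inverse_unique)
    then show ?thesis using True c pCons by (simp add: vunit_def rat_of_poly_embedding)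
  next
    case False
    let ?w = "rat_of_poly a / rat_x ^ degree a"
    have w: "vunit V ?w" using pCons False by blast
    let ?e = "inverse rat_x * (inverse rat_x ^ degree a * rat_of_poly [:c:])"
    have e: "?e \<in> maxideal V" using u c S by (intro maxideal_mult[OF V]) auto
    have "pCons c a = [:c:] + [:0,1:] * a" by simp
    then have "rat_of_poly (pCons c a) = rat_of_poly [:c:] + rat_x * rat_of_poly a"
      by (metis rat_of_poly_embedding(1,2) rat_x_def)
    then have eq: "rat_of_poly (pCons c a) / rat_x ^ degree (pCons c a) = ?w * (1 + ?e * inverse ?w)"
      using False x0 by (simp add: field_simps rat_of_poly_embedding)
    have "inverse ?w \<in> V" using w unfolding vunit_def by blast
    then have "vunit V (1 + ?e * inverse ?w)"
      by (rule vunit_1_plus_maxideal[OF V maxideal_mult[OF V e]])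
    then show ?thesis unfolding eq using w vunit_mult[OF V] by blast
  qed
qed simp

lemma rat_place_infinite:
  fixes V :: "'k::field poly fract set"
  assumes V: "valring V" and K: "rat_consts \<subseteq> V" and x: "rat_x \<notin> V"
  shows "V = nonneg_ring vinf"
proof (rule valring_eqI[OF V])
  note v = vinf_valuation and S = subringD[OF valring_subring[OF V]] 
  note D = valuation_ofD[OF v(2)]
  show "valring (nonneg_ring vinf)" by (rule v)
  have x0: "rat_x \<noteq> (0 :: 'k poly fract)" using x S(2) by metis
  have u: "inverse rat_x \<in> maxideal V" "inverse rat_x \<in> V" using V x valring_total by (auto simp: maxideal_iff)
  have key: "\<exists>n w. g = inverse rat_x ^ n * w \<and> w \<in> V \<and> (0 < vinf g \<longrightarrow> n > 0)" 
    if g: "g \<noteq> 0" "0 \<le> vinf g" for g :: "'k poly fract"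
  proof -
    obtain a b where ab: "g = Fract a b" "a \<noteq> 0" "b \<noteq> 0" using g(1) by (metis Fract_cases_nonzero)
    have vg: "vinf g = int (degree b) - int (degree a)" using ab by (simp add: vinf_Fract)
    then obtain n where n: "degree b = degree a + n" using g by (metis le_Suc_ex of_nat_le_iff diff_ge_0_iff_ge)
    let ?A = "rat_of_poly a / rat_x ^ degree a" and ?B = "rat_of_poly b / rat_x ^ degree b"
    have "vunit V (?A * inverse ?B)" using poly_over_lead_power[OF assms] ab vunit_mult[OF V] vunit_inverse by blast
    moreover have "g = rat_of_poly a / rat_of_poly b" using ab by (simp add: rat_of_poly_def)
    then have "g = inverse rat_x ^ n * (?A * inverse ?B)" 
      using x0 ab n by (simp add: field_simps power_add rat_of_poly_embedding)
    ultimately show ?thesis using vg n by (intro exI[of _ n] exI[of _ "?A * inverse ?B"]) (auto simp: vunit_def)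
  qed
  show "nonneg_ring vinf \<subseteq> V" 
  proof
    fix g :: "'k poly fract" assume g: "g \<in> nonneg_ring vinf"
    show "g \<in> V"
    proof (cases "g = 0")
      case False
      then show ?thesis using key[of g] g u S by (auto simp: nonneg_ring_def)
    qed (use S in auto)
  qed
  show "maxideal (nonneg_ring vinf) \<subseteq> maxideal V"
  proof
    fix g :: "'k poly fract" assume g: "g \<in> maxideal (nonneg_ring vinf)"
    show "g \<in> maxideal V"
    proof (cases "g = 0")
      case False
      then have "inverse g \<notin> nonneg_ring vinf" using g by (simp add: maxideal_iff[OF v(1)])
      then have "0 < vinf g" using D(4)[OF False] by (simp add: nonneg_ring_def)
      then obtain n w where *: "g = inverse rat_x ^ n * w" "w \<in> V" "n > 0" 
        using key[OF False] by auto
      obtain k where k: "n = Suc k" using *(3) by (cases n) auto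
      have "g = inverse rat_x * (inverse rat_x ^ k * w)" unfolding *(1) k power_Suc by (rule mult.assoc)
      moreover have "inverse rat_x ^ k * w \<in> V" by (rule S(4)[OF S(7)[OF u(2)] *(2)])
      then have "inverse rat_x * (inverse rat_x ^ k * w) \<in> maxideal V" by (rule maxideal_mult[OF V u(1)])
      ultimately show ?thesis by (rule ssubst)
    qed (use V in \<open>simp add: maxideal_iff\<close>)
  qed
qed

text \<open>A polynomial of positive degree has a pole at infinity, so \<open>V\<close> is a finite
  place; the irreducible generator belonging to it divides \<open>p\<close> and is therefore
  associated to \<open>p\<close>.\<close>

lemma rat_place_of_prime:
  assumes V: "valring V" and K: "rat_consts \<subseteq> V" and p: "irreducible p" and m: "rat_of_poly p \<in> maxideal V"
  shows "V = nonneg_ring (vp p)"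
proof -
  note S = subringD[OF valring_subring[OF V]] 
  have p0: "p \<noteq> 0" using p by auto
  have x: "rat_x \<in> V"
  proof (rule ccontr)
    assume x: "rat_x \<notin> V"
    then have e: "V = nonneg_ring vinf" using rat_place_infinite V K by blast
    have "rat_of_poly p \<in> V" using m by (simp add: maxideal_def)
    then have "0 \<le> vinf (rat_of_poly p)" using e p0 by (auto simp: nonneg_ring_def rat_of_poly_embedding)
    then show False using p0 irreducible_degree_pos[OF p] by (simp add: vinf_rat)
  qed
  note R = rat_polys_subset[OF V K x]
  obtain p' where p': "irreducible p'" "\<And>a. rat_of_poly a \<in> maxideal V \<longleftrightarrow> p' dvd a"
    using rat_place_prime[OF V K R] by blast
  have "p' dvd p" using p' m by blast
  then obtain c where c: "p = p' * c" by blast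
  then have "is_unit c" using p p'(1) by (metis irreducible_def)
  then have "p dvd a \<longleftrightarrow> p' dvd a" for a using c by (simp add: mult_unit_dvd_iff)
  then show ?thesis using rat_place_finite_eq[OF V R p] p'(2) by blast
qed

lemma rat_place_cases:
  assumes V: "valring V" and K: "rat_consts \<subseteq> V"
  shows "V = nonneg_ring vinf \<or> (\<exists>p. irreducible p \<and> lead_coeff p = 1 \<and> V = nonneg_ring (vp p))"
proof (cases "rat_x \<in> V")
  case True
  note R = rat_polys_subset[OF V K True]
  obtain p where p: "irreducible p" "\<And>a. rat_of_poly a \<in> maxideal V \<longleftrightarrow> p dvd a"
    using rat_place_prime[OF V K R] by blast
  obtain q where q: "irreducible q" "p dvd q" "lead_coeff q = 1"
    using irreducible_monic_associate[OF p(1)] by blast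
  then show ?thesis using rat_place_of_prime[OF V K q(1)] p(2) by blast
next
  case False
  then show ?thesis using rat_place_infinite V K by blast
qed

section \<open>Simple radical extensions\<close>

text \<open>Coefficients live in the base field and values in \<open>F\<close>, which are different
  types, so evaluation passes through the embedding.\<close>

definition ev :: "('e::field \<Rightarrow> 'f::field) \<Rightarrow> 'e poly \<Rightarrow> 'f \<Rightarrow> 'f" where
  "ev h G a = poly (map_poly h G) a"

lemma ev_simps:
  assumes h: "field_embedding h"
  shows "ev h (G + H) a = ev h G a + ev h H a" "ev h (G * H) a = ev h G a * ev h H a"
    "ev h (pCons c G) a = h c + a * ev h G a" "ev h 0 a = 0" "ev h (monom c n) a = h c * a ^ n"
    "ev h 1 a = 1"
proof -
  note H = field_embeddingD[OF h]
  have "map_poly h (G + H) = map_poly h G + map_poly h H"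
    by (rule poly_eqI) (simp add: coeff_map_poly H)
  then show "ev h (G + H) a = ev h G a + ev h H a" by (simp add: ev_def)
  have "map_poly h (G * H) = map_poly h G * map_poly h H"
    by (rule poly_eqI) (simp add: coeff_map_poly H coeff_mult field_embedding_sum[OF h])
  then show "ev h (G * H) a = ev h G a * ev h H a" by (simp add: ev_def)
  show "ev h (pCons c G) a = h c + a * ev h G a" by (simp add: ev_def map_poly_pCons H)
  show "ev h 0 a = 0" by (simp add: ev_def)
  show "ev h (monom c n) a = h c * a ^ n" by (simp add: ev_def map_poly_monom H poly_monom)
  show "ev h 1 a = 1" by (simp add: ev_def H map_poly_1')
qed

lemma ev_altdef:
  assumes h: "field_embedding h" and d: "degree G < n"
  shows "ev h G a = (\<Sum>i<n. h (coeff G i) * a ^ i)"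
proof -
  note H = field_embeddingD[OF h]
  have "ev h G a = (\<Sum>i\<le>degree (map_poly h G). h (coeff G i) * a ^ i)"
    by (simp add: ev_def poly_altdef coeff_map_poly H)
  also have "degree (map_poly h G) = degree G" by (rule degree_map_poly) (simp add: H)
  also have "(\<Sum>i\<le>degree G. h (coeff G i) * a ^ i) = (\<Sum>i<n. h (coeff G i) * a ^ i)"
    by (rule sum.mono_neutral_left) (use d in \<open>auto simp: coeff_eq_0 H not_le\<close>)
  finally show ?thesis .
qed

text \<open>As m is nonzero in the field, X^m - 1 and its derivative have no common root, so there
  are exactly m roots of unity. Multiplying all of them by one \<open>z\<close> with
  \<open>z ^ n\<close> different from 1 permutes them and scales the sum, which must vanish.\<close>

lemma roots_of_unity_sum:
  fixes dummy :: "'l::alg_closed_field"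
  assumes m: "m > 0" "of_nat m \<noteq> (0 :: 'l)"
  shows "finite {\<zeta>::'l. \<zeta> ^ m = 1}"
    "(\<Sum>\<zeta> | \<zeta> ^ m = 1. (\<zeta>::'l) ^ n) = (if m dvd n then of_nat m else 0)"
proof -
  let ?R = "{\<zeta>::'l. \<zeta> ^ m = 1}"
  let ?p = "\<lambda>n. monom (1::'l) n - 1"
  have deg: "degree (?p n) = n" "?p n \<noteq> 0" if "n > 0" for n
  proof -
    have c: "coeff (?p n) n = 1" using that by simp
    then show "?p n \<noteq> 0" by (metis coeff_0 zero_neq_one)
    have "degree (?p n) \<le> n" by (rule degree_diff_le) (auto simp: degree_monom_le)
    then show "degree (?p n) = n" using le_degree[of "?p n" n] c by simp
  qed
  have roots: "poly (?p n) \<zeta> = 0 \<longleftrightarrow> \<zeta> ^ n = 1" for n \<zeta> by (simp add: poly_monom)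
  have fin: "finite {\<zeta>::'l. \<zeta> ^ n = 1}" "card {\<zeta>::'l. \<zeta> ^ n = 1} \<le> n" if "n > 0" for n
    using poly_roots_finite[OF deg(2)[OF that]] card_poly_roots_bound[OF deg(2)[OF that]] deg(1)[OF that] roots[of n] by simp_all
  show finR: "finite ?R" by (rule fin[OF m(1)])
  obtain A where A: "size A = m" "?p m = smult (lead_coeff (?p m)) (\<Prod>x\<in>#A. [:-x, 1:])"
    using alg_closed_imp_factorization[OF deg(2)[OF m(1)]] deg(1)[OF m(1)] by metis
  have cnt: "count A x \<le> 1" for x
  proof (rule ccontr)
    assume "\<not> ?thesis"
    then have "{#x, x#} \<subseteq># A" by (simp add: subseteq_mset_def)
    then obtain B where "A = {#x, x#} + B" by (metis subset_mset.le_iff_add)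
    then obtain g where g: "?p m = [:-x,1:] * ([:-x,1:] * g)" using A(2) by (metis (no_types, lifting) image_mset_add_mset prod_mset.add_mset add_mset_add_single union_mset_add_mset_left mult_smult_right add.left_neutral)
    have "x ^ m = 1" using roots[of m x] g by simp
    then have x0: "x \<noteq> 0" using m by (auto simp: power_0_left)
    have "poly (pderiv (?p m)) x = of_nat m * x ^ (m - 1)"
      by (simp add: pderiv_diff pderiv_monom poly_monom)
    moreover have "poly (pderiv (?p m)) x = 0" unfolding g pderiv_mult by simp
    ultimately show False using m x0 by simp
  qed
  have "set_mset A \<subseteq> ?R"
  proof
    fix x assume "x \<in># A"
    then obtain B where "A = add_mset x B" by (metis mset_add)
    then have "poly (?p m) x = 0" by (subst A(2)) simp
    then show "x \<in> ?R" using roots by simp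
  qed
  moreover have "card (set_mset A) = m"
    using A(1) cnt by (metis count_greater_eq_one_iff le_antisym size_multiset_overloaded_eq sum.cong card_eq_sum)
  ultimately have card: "card ?R = m" using fin[OF m(1)] card_mono[OF finR, of "set_mset A"] by simp
  show "(\<Sum>\<zeta> | \<zeta> ^ m = 1. (\<zeta>::'l) ^ n) = (if m dvd n then of_nat m else 0)"
  proof (cases "m dvd n")
    case True
    then have "(\<zeta>::'l) ^ n = 1" if "\<zeta> ^ m = 1" for \<zeta> using that by (metis dvdE power_mult power_one)
    then have "(\<Sum>\<zeta> | \<zeta> ^ m = 1. (\<zeta>::'l) ^ n) = of_nat (card ?R)" by simp
    then show ?thesis using True card by simp
  next
    case False
    define r where "r = n mod m"
    have r: "0 < r" "r < m" using False m by (auto simp: r_def dvd_eq_mod_eq_0)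
    have pr: "(\<zeta>::'l) ^ n = \<zeta> ^ r" if "\<zeta> ^ m = 1" for \<zeta>
    proof -
      have "\<zeta> ^ n = (\<zeta> ^ m) ^ (n div m) * \<zeta> ^ r" unfolding r_def by (simp flip: power_mult power_add)
      then show ?thesis using that by simp
    qed
    \<comment> \<open>At most \<open>r < m\<close> elements satisfy \<open>z ^ r = 1\<close>, while
      there are m roots of unity.\<close>
    have "\<exists>z::'l. z ^ m = 1 \<and> z ^ r \<noteq> 1"
    proof (rule ccontr)
      assume "\<not> ?thesis"
      then have "?R \<subseteq> {\<zeta>::'l. \<zeta> ^ r = 1}" by auto
      then have "card ?R \<le> card {\<zeta>::'l. \<zeta> ^ r = 1}" by (rule card_mono[OF fin(1)[OF r(1)]])
      then have "m \<le> r" using fin(2)[OF r(1)] card by linarith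
      then show False using r by simp
    qed
    then obtain z :: 'l where z: "z ^ m = 1" "z ^ n \<noteq> 1" using pr by metis
    then have z0: "z \<noteq> 0" using m by (auto simp: power_0_left)
    have "(\<Sum>\<zeta> | \<zeta> ^ m = 1. (\<zeta>::'l) ^ n) = (\<Sum>\<zeta> | \<zeta> ^ m = 1. (z * \<zeta>) ^ n)"
      by (rule sum.reindex_bij_witness[of _ "\<lambda>\<zeta>. z * \<zeta>" "\<lambda>\<zeta>. \<zeta> / z"])
        (use z z0 in \<open>auto simp: power_mult_distrib power_divide\<close>)
    also have "\<dots> = z ^ n * (\<Sum>\<zeta> | \<zeta> ^ m = 1. (\<zeta>::'l) ^ n)"
      by (simp add: power_mult_distrib sum_distrib_left)
    finally have "(1 - z ^ n) * (\<Sum>\<zeta> | \<zeta> ^ m = 1. (\<zeta>::'l) ^ n) = 0" by (simp add: algebra_simps)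
    then show ?thesis using z False by simp
  qed
qed

section \<open>Algebraic elements and lifting of valuation rings\<close>

lemma extension_vector_space:
  assumes h: "field_embedding h" shows "vector_space (\<lambda>c v. h c * v)"
  by unfold_locales (simp_all add: field_embeddingD[OF h] algebra_simps)

lemma powers_dependent:
  fixes h :: "'e::field \<Rightarrow> 'f::field"
  assumes h: "field_embedding h"
    and sp0: "\<And>j. j \<le> n \<Longrightarrow> \<exists>c. a ^ j = (\<Sum>i<n. h (c i) * b i)"
  shows "\<exists>G. G \<noteq> 0 \<and> degree G \<le> n \<and> ev h G a = 0"
proof -
  note H = field_embeddingD[OF h]
  interpret vector_space "\<lambda>c v. h c * v" by (rule extension_vector_space[OF h])
  have sp: "a ^ j \<in> span (b ` {..<n})" if jn: "j \<le> n" for j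
  proof -
    obtain c where "a ^ j = (\<Sum>i<n. h (c i) * b i)" using sp0[OF jn] by blast
    moreover have "b i \<in> span (b ` {..<n})" if "i < n" for i using that by (auto intro: span_base)
    ultimately show ?thesis by (auto intro!: span_sum span_scale)
  qed
  \<comment> \<open>The dimension bound concerns the set of powers, so coinciding powers need a
    relation of their own, a difference of two monomials.\<close>
  show ?thesis
  proof (cases "inj_on (\<lambda>j. a ^ j) {..n}")
    case False
    then obtain i j where ij: "i < j" "j \<le> n" "a ^ i = a ^ j"
      by (auto simp: inj_on_def) (metis linorder_neqE_nat)
    let ?G = "monom (1 :: 'e) j + monom (-1) i"
    have "coeff ?G j = 1" using ij by simp
    then have "?G \<noteq> 0" by (metis coeff_0 zero_neq_one)
    moreover have "degree ?G \<le> n" using ij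
      by (intro degree_add_le) (auto intro: order.trans[OF degree_monom_le])
    ultimately show ?thesis using ij by (intro exI[of _ ?G]) (simp add: ev_simps[OF h] H)
  next
    case True
    let ?B = "(\<lambda>j. a ^ j) ` {..n}"
    have "card ?B = Suc n" using True by (simp add: card_image)
    moreover have "card (b ` {..<n}) \<le> n" using card_image_le[of "{..<n}" b] by simp
    ultimately have "dependent ?B"
      using independent_span_bound[of "b ` {..<n}" ?B] sp by fastforce
    then obtain u v where u: "v \<in> ?B" "u v \<noteq> 0" "(\<Sum>v\<in>?B. h (u v) * v) = 0"
      using dependent_finite[of ?B] by auto
    define G where "G = (\<Sum>j\<le>n. monom (u (a ^ j)) j)"
    have cG: "coeff G j = (if j \<le> n then u (a ^ j) else 0)" for j
      unfolding G_def by (simp add: coeff_sum)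
    obtain j where "j \<le> n" "v = a ^ j" using u(1) by auto
    then have "coeff G j \<noteq> 0" using u(2) cG by simp
    then have "G \<noteq> 0" by auto
    have d: "degree G \<le> n" by (rule degree_le) (simp add: cG)
    have "ev h G a = (\<Sum>j<Suc n. h (coeff G j) * a ^ j)" using d by (intro ev_altdef[OF h]) simp
    then have "ev h G a = (\<Sum>j\<le>n. h (u (a ^ j)) * a ^ j)" by (simp add: cG lessThan_Suc_atMost)
    also have "\<dots> = (\<Sum>v\<in>?B. h (u v) * v)" by (subst sum.reindex[OF True]) simp
    finally have "ev h G a = 0" using u(3) by simp
    then show ?thesis using \<open>G \<noteq> 0\<close> d by blast
  qed
qed

text \<open>The minimal polynomial of \<open>a\<close> has a nonzero constant term, which expresses the inverse of \<open>a\<close>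
  as a polynomial in \<open>a\<close>.\<close>

lemma algebraic_inverse:
  assumes h: "field_embedding h" and G: "G \<noteq> 0" "ev h G a = 0" and a: "a \<noteq> 0"
  shows "\<exists>H. inverse a = ev h H a"
proof -
  note H = field_embeddingD[OF h]
  show ?thesis using G
  proof (induction G)
    case (pCons c G)
    show ?case
    proof (cases "c = 0")
      case True
      then show ?thesis using pCons a by (auto simp: ev_simps[OF h] H)
    next
      case False
      have "a * ev h G a = - h c" using pCons(4) by (simp add: ev_simps[OF h] add_eq_0_iff)
      then have "a * (ev h G a * h (- inverse c)) = 1" using False by (simp add: H field_simps)
      then have "inverse a = ev h G a * h (- inverse c)" by (rule inverse_unique)
      also have "\<dots> = ev h (G * [:- inverse c:]) a" by (simp only: ev_simps[OF h]) simp
      finally show ?thesis by blast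
    qed
  qed simp
qed

text \<open>Two terms of a relation \<open>G(a) = 0\<close> must have equal value, so some power of \<open>a\<close> has the value of
  an element of the base field.\<close>

lemma algebraic_power_unit:
  assumes h: "field_embedding h" and V: "valring V" and G: "G \<noteq> 0" "ev h G a = 0" and a: "a \<noteq> 0"
  shows "\<exists>n c. 0 < n \<and> n \<le> degree G \<and> c \<noteq> 0 \<and> vunit V (a ^ n / h c)"
proof (rule ccontr)
  assume no: "\<not> ?thesis"
  note H = field_embeddingD[OF h]
  define I where "I = {i. i \<le> degree G \<and> coeff G i \<noteq> 0}"
  define b where "b i = h (coeff G i) * a ^ i" for i
  have I: "finite I" "I \<noteq> {}" using G by (auto simp: I_def)
  have nz: "b i \<noteq> 0" if "i \<in> I" for i using that a by (auto simp: b_def I_def H)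
  have na: "\<not> vunit V (b i / b j)" if ij: "i \<in> I" "j \<in> I" "i \<noteq> j" for i j
  proof
    assume "vunit V (b i / b j)"
    moreover have "vunit V (b j / b i)" if "vunit V (b i / b j)" using vunit_inverse[OF that] by simp
    ultimately obtain k l where kl: "k \<in> I" "l \<in> I" "k < l" "vunit V (b l / b k)" using ij by (metis linorder_neqE_nat)
    let ?c = "coeff G k / coeff G l"
    have "b l / b k = (h (coeff G l) * (a ^ (l - k) * a ^ k)) / (h (coeff G k) * a ^ k)"
      using kl(3) by (simp add: b_def flip: power_add)
    also have "\<dots> = a ^ (l - k) / h ?c" using kl(1,2) a by (simp add: I_def H)
    finally have "b l / b k = a ^ (l - k) / h ?c" .
    then have "vunit V (a ^ (l - k) / h ?c)" using kl by simp
    moreover have "?c \<noteq> 0" "0 < l - k" "l - k \<le> degree G" using kl by (auto simp: I_def)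
    ultimately show False using no by blast
  qed
  have "\<exists>i\<in>I. vunit V (sum b I / b i) \<and> (\<forall>j\<in>I. b j / b i \<in> V)"
    by (rule dominant_term[OF V I]) (use nz na in auto)
  then obtain i where "i \<in> I" "vunit V (sum b I / b i)" by blast
  then have "sum b I \<noteq> 0" by (auto simp: vunit_def)
  moreover have "ev h G a = (\<Sum>i<Suc (degree G). b i)" unfolding b_def by (rule ev_altdef[OF h]) simp
  moreover have "(\<Sum>i<Suc (degree G). b i) = sum b I"
    by (rule sum.mono_neutral_right) (auto simp: I_def b_def H)
  ultimately show False using G by simp
qed

text \<open>Chevalley's theorem keeps \<open>inverse (h t)\<close> out of \<open>V\<close>, and for
  a uniformizer \<open>t\<close> this determines the trace on the base field: if \<open>c\<close> is
  outside \<open>W\<close>, then \<open>inverse (t * c)\<close> is in \<open>W\<close>, so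
  \<open>h c\<close> in \<open>V\<close> would bring in \<open>inverse (h t)\<close>.\<close>

lemma lift_valring:
  assumes h: "field_embedding h" and W: "valring W" and v: "valuation_of W v" and t: "t \<noteq> 0" "v t = 1"
  shows "\<exists>V. valring V \<and> (\<forall>c. h c \<in> V \<longleftrightarrow> c \<in> W)"
proof -
  note H = field_embeddingD[OF h] and D = valuation_ofD[OF v] and S = subringD[OF valring_subring[OF W]]
  have tW: "t \<in> W" "inverse t \<notin> W" using t by (auto simp: D)
  have "is_subring (h ` W)" unfolding is_subring_def
  proof (intro conjI ballI)
    show "1 \<in> h ` W" using S(1) H(2) by force
    fix a b assume "a \<in> h ` W" "b \<in> h ` W"
    then obtain c d where "c \<in> W" "d \<in> W" "a = h c" "b = h d" by auto
    then show "a - b \<in> h ` W" "a * b \<in> h ` W"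
      using S(3)[of c d] S(4)[of c d] by (auto simp flip: H(4,6))
  qed
  moreover have "h t \<in> h ` W" using tW by auto
  moreover have "inverse (h t) \<notin> h ` W" unfolding H(7)[symmetric] using tW(2) H(12) by auto
  ultimately obtain V where V: "valring V" "h ` W \<subseteq> V" "inverse (h t) \<notin> V" using chevalley by blast
  have "c \<in> W" if hc: "h c \<in> V" for c
  proof (rule ccontr)
    assume c: "c \<notin> W"
    then have c0: "c \<noteq> 0" using S by auto
    have "0 \<le> v (inverse (t * c))" using c c0 t by (simp add: D del: inverse_mult_distrib)
    then have "inverse (t * c) \<in> W" using c0 t D(2)[of "inverse (t * c)"] by simp
    then have "h c * h (inverse (t * c)) \<in> V" using V(2) hc subringD(4)[OF valring_subring[OF V(1)]] by blast
    moreover have "h c * h (inverse (t * c)) = inverse (h t)" using c0 by (simp add: H)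
    ultimately show False using V(3) by simp
  qed
  then show ?thesis using V by blast
qed

section \<open>The field generated by an m-th root of \<open>f\<close>\<close>

locale radical_extension =
  fixes h :: "'e::field \<Rightarrow> 'f::field" and y :: 'f and f :: 'e and m :: nat
  assumes h: "field_embedding h" and m: "m > 0" and y: "y ^ m = h f" and f0: "f \<noteq> 0"
begin

lemmas H = field_embeddingD[OF h]

lemma y0: "y \<noteq> 0"
  using y f0 m by (auto simp: H power_0_left)

lemma term_power: "(h c * y ^ i) ^ m = h (c ^ m * f ^ i)"
  by (simp add: H power_mult_distrib y[symmetric] mult.commute flip: power_mult)

lemma reduce_mod: "\<exists>Q R. degree R < m \<and> G = (monom 1 m + [:- f:]) * Q + R"
proof -
  define M where "M = monom 1 m + [:- f:]"
  have cM: "coeff M m = 1" using m by (simp add: M_def coeff_pCons split: nat.split)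
  have "degree M \<le> m" unfolding M_def by (intro degree_add_le) (auto simp: degree_monom_le)
  then have dM: "degree M = m" "M \<noteq> 0" using le_degree[of M m] cM by auto
  have "degree (G mod M) < m" using degree_mod_less'[of M G] dM m by (cases "G mod M = 0") auto
  moreover have "G = M * (G div M) + G mod M" by simp
  ultimately show ?thesis unfolding M_def by blast
qed

lemma ev_modulus:
  assumes "field_embedding g" "z ^ m = g f" shows "ev g ((monom 1 m + [:- f:]) * Q + R) z = ev g R z"
  using assms by (simp only: ev_simps[OF assms(1)]) (simp add: field_embeddingD[OF assms(1)])

lemma ev_y_span: "\<exists>R. degree R < m \<and> ev h G y = ev h R y"
  using reduce_mod[of G] ev_modulus[OF h y] by metis

text \<open>Inverses come from algebraicity: all powers of an element of K(x)[y] lie in the span of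
  m powers of \<open>y\<close>, hence satisfy a relation, and \<open>algebraic_inverse\<close> turns
  the relation into a polynomial for the inverse.\<close>

lemma inverse_ev_y: "\<exists>G'. inverse (ev h G y) = ev h G' y"
proof (cases "ev h G y = 0")
  case True
  then show ?thesis using ev_simps(4)[OF h] by (metis inverse_zero)
next
  case False
  let ?a = "ev h G y"
  have "\<exists>c. ?a ^ j = (\<Sum>i<m. h (c i) * y ^ i)" for j
  proof -
    have "?a ^ j = ev h (G ^ j) y" by (induction j) (simp_all add: ev_simps[OF h])
    then obtain R where "degree R < m" "?a ^ j = ev h R y" using ev_y_span by metis
    then show ?thesis using ev_altdef[OF h] by (intro exI[of _ "coeff R"]) simp
  qed
  then obtain K where K: "K \<noteq> 0" "ev h K ?a = 0"
    using powers_dependent[OF h, of m ?a "\<lambda>i. y ^ i"] by blast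
  obtain L where L: "inverse ?a = ev h L ?a" using algebraic_inverse[OF h K False] by blast
  have "\<exists>G'. ev h L ?a = ev h G' y"
  proof (induction L)
    case (pCons c L)
    then obtain G' where "ev h L ?a = ev h G' y" by auto
    then have "ev h (pCons c L) ?a = ev h ([:c:] + G * G') y" by (simp add: ev_simps[OF h])
    then show ?case by blast
  qed (use ev_simps(4)[OF h] in metis)
  then show ?thesis using L by auto
qed

lemma ev_y_subfield: "is_subfield {ev h G y | G. True}"
proof -
  have "\<exists>H. ev h G y - ev h G' y = ev h H y" for G G'
    by (intro exI[of _ "G + G' * [:-1:]"]) (simp only: ev_simps[OF h], simp add: H)
  then show ?thesis unfolding is_subfield_def
    using ev_simps(2,4,6)[OF h] inverse_ev_y by (auto; metis)
qed

end

locale generated_radical_extension = radical_extension h y f m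
  for h :: "'e::field \<Rightarrow> 'f::field" and y f m +
  assumes gen: "\<And>a. \<exists>G. a = ev h G y"
begin

lemma expansion: "\<exists>c. a = (\<Sum>i<m. h (c i) * y ^ i)"
proof -
  obtain R where "degree R < m" "a = ev h R y" using gen[of a] ev_y_span by metis
  then show ?thesis using ev_altdef[OF h] by (intro exI[of _ "coeff R"]) simp
qed

lemma algebraic: "\<exists>G. G \<noteq> 0 \<and> degree G \<le> m \<and> ev h G a = 0"
  by (rule powers_dependent[OF h]) (rule expansion)

text \<open>Needed at places of unknown ramification: the base field has discrete values, and every
  nonzero \<open>a\<close> has a power whose value comes from there.\<close>

lemma discrete:
  assumes V: "valring V" and v0: "valuation_of W v0" and over: "\<And>c. h c \<in> V \<longleftrightarrow> c \<in> W"
    and t: "t \<noteq> 0" "v0 t = 1"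
  shows "\<exists>v s. valuation_of V v \<and> s \<noteq> 0 \<and> v s = 1"
proof -
  \<comment> \<open>The exponent \<open>n\<close> with \<open>a ^ n\<close> of base value depends on
    \<open>a\<close> but is at most m, so the factorial is a common multiple for all
    \<open>a\<close>.\<close>
  let ?N = "fact m :: nat"
  note D = valuation_ofD[OF v0]
  have "\<exists>c. c \<noteq> 0 \<and> vunit V (a ^ ?N / h c)" if a: "a \<noteq> 0" for a
  proof -
    obtain G where G: "G \<noteq> 0" "degree G \<le> m" "ev h G a = 0" using algebraic by blast
    obtain n c where n: "0 < n" "n \<le> m" "c \<noteq> 0" "vunit V (a ^ n / h c)"
      using algebraic_power_unit[OF h V G(1,3) a] G(2) by (meson order.trans)
    then obtain k where k: "?N = n * k" by (metis dvdE dvd_fact Suc_leI One_nat_def)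
    have "vunit V ((a ^ n / h c) ^ k)" by (rule vunit_power[OF V n(4)])
    then show ?thesis using n(3) k
      by (intro exI[of _ "c ^ k"]) (simp add: H power_divide power_mult)
  qed
  then obtain w where w: "valuation_of V w"
    "\<And>a c. a \<noteq> 0 \<Longrightarrow> c \<noteq> 0 \<Longrightarrow> vunit V (a ^ ?N / h c) \<Longrightarrow> w a = v0 c"
    using extend_valuation[OF h V v0 over, of ?N] by (metis fact_gt_zero)
  have "w (h t) = v0 (t ^ ?N)"
    using t subringD(1)[OF valring_subring[OF V]] by (intro w(2)) (auto simp: H vunit_def)
  then have "w (h t) \<noteq> 0" using t by (simp add: D)
  then show ?thesis using normalize_valuation[OF w(1), of "h t"] t by (simp add: H)
qed

text \<open>Over a totally ramified place distinct terms have distinct values, so the value of a sum is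
  the least value of a nonzero term.\<close>

definition ramified_valuation :: "'f set \<Rightarrow> ('e \<Rightarrow> int) \<Rightarrow> ('f \<Rightarrow> int) \<Rightarrow> bool" where
  "ramified_valuation V v0 w \<longleftrightarrow> valuation_of V w \<and> (\<forall>c i. c \<noteq> 0 \<longrightarrow> w (h c * y ^ i) = int m * v0 c + int i * v0 f) \<and>
     (\<forall>c. (\<exists>i<m. c i \<noteq> 0) \<longrightarrow> (\<Sum>i<m. h (c i) * y ^ i) \<noteq> 0 \<and>
       (\<exists>i<m. c i \<noteq> 0 \<and> w (\<Sum>i<m. h (c i) * y ^ i) = w (h (c i) * y ^ i)) \<and>
       (\<forall>i<m. c i \<noteq> 0 \<longrightarrow> w (\<Sum>i<m. h (c i) * y ^ i) \<le> w (h (c i) * y ^ i)))"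

text \<open>The m-th power of the term \<open>h c * y ^ i\<close> lies in the base field with value
  \<open>m * v0 c + i * v0 f\<close>. These values differ modulo m because \<open>v0 f\<close> is
  prime to m, so one term dominates. Hence \<open>a ^ m\<close> is a base element times a unit, and
  here the exponent m serves all \<open>a\<close>.\<close>

lemma ramified_valuation_exists:
  assumes W: "valring W" and v0: "valuation_of W v0" and cop: "coprime (int m) (v0 f)"
    and V: "valring V" and over: "\<And>c. h c \<in> V \<longleftrightarrow> c \<in> W" and t: "t \<noteq> 0" "v0 t = 1"
  shows "\<exists>w. ramified_valuation V v0 w"
proof -
  note D = valuation_ofD[OF v0]
  have oneV: "vunit V 1" using subringD(1)[OF valring_subring[OF V]] by (simp add: vunit_def)
  have dom: "\<exists>i<m. c i \<noteq> 0 \<and> vunit V ((\<Sum>i<m. h (c i) * y ^ i) / (h (c i) * y ^ i)) \<and>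
     (\<forall>j<m. (h (c j) * y ^ j) / (h (c i) * y ^ i) \<in> V)" if ex: "\<exists>i<m. c i \<noteq> 0" for c
  proof -
    define I where "I = {i. i < m \<and> c i \<noteq> 0}"
    define b where "b i = h (c i) * y ^ i" for i
    have I: "finite I" "I \<noteq> {}" using ex by (auto simp: I_def)
    have nz: "b i \<noteq> 0" if "i \<in> I" for i using that y0 by (auto simp: b_def I_def H)
    have na: "\<not> vunit V (b i / b j)" if ij: "i \<in> I" "j \<in> I" "i \<noteq> j" for i j
    proof
      assume "vunit V (b i / b j)"
      then have "vunit V ((b i / b j) ^ m)" by (rule vunit_power[OF V])
      moreover let ?c = "(c i ^ m * f ^ i) / (c j ^ m * f ^ j)"
      have "(b i / b j) ^ m = h ?c" unfolding b_def power_divide term_power by (simp add: H)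
      ultimately have "vunit W ?c" using over[of ?c] over[of "inverse ?c"] by (auto simp: vunit_def H)
      moreover have "v0 ?c = (int m * v0 (c i) + int i * v0 f) - (int m * v0 (c j) + int j * v0 f)"
        using ij f0 by (simp add: D I_def)
      ultimately have "int m * (v0 (c j) - v0 (c i)) = (int i - int j) * v0 f" by (simp add: D algebra_simps)
      then have "int m dvd (int i - int j) * v0 f" by (metis dvd_triv_left)
      then have "int m dvd int i - int j" using cop coprime_dvd_mult_left_iff by blast
      then have "int i mod int m = int j mod int m" by (simp add: mod_eq_dvd_iff)
      then show False using ij by (simp add: I_def)
    qed
    have "\<exists>i\<in>I. vunit V (sum b I / b i) \<and> (\<forall>j\<in>I. b j / b i \<in> V)"
      by (rule dominant_term[OF V I]) (use nz na in auto)
    then obtain i where i: "i \<in> I" "vunit V (sum b I / b i)" "\<forall>j\<in>I. b j / b i \<in> V" by blast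
    have "(\<Sum>i<m. b i) = sum b I"
      by (rule sum.mono_neutral_right) (auto simp: I_def b_def H)
    moreover have "b j / b i \<in> V" if "j < m" for j
      using i(3) that subringD(2)[OF valring_subring[OF V]] by (cases "c j = 0") (auto simp: b_def I_def H)
    ultimately show ?thesis using i unfolding I_def b_def by auto
  qed
  have ex: "\<exists>c. c \<noteq> 0 \<and> vunit V (a ^ m / h c)" if a: "a \<noteq> 0" for a
  proof -
    obtain c where c: "a = (\<Sum>i<m. h (c i) * y ^ i)" using expansion by blast
    have "\<exists>i<m. c i \<noteq> 0"
    proof (rule ccontr)
      assume "\<not> ?thesis"
      then have "a = 0" unfolding c by (intro sum.neutral) (auto simp: H)
      then show False using a by simp
    qed
    then obtain i where i: "i < m" "c i \<noteq> 0" "vunit V (a / (h (c i) * y ^ i))" using dom[of c] c by blast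
    have "vunit V ((a / (h (c i) * y ^ i)) ^ m)" using vunit_power[OF V i(3)] .
    then have "vunit V (a ^ m / h (c i ^ m * f ^ i))" unfolding power_divide term_power .
    then show ?thesis using i f0 by (intro exI[of _ "c i ^ m * f ^ i"]) simp
  qed
  obtain w where w: "valuation_of V w"
    "\<And>a c. a \<noteq> 0 \<Longrightarrow> c \<noteq> 0 \<Longrightarrow> vunit V (a ^ m / h c) \<Longrightarrow> w a = v0 c"
    using extend_valuation[OF h V v0 over m ex] by blast
  note E = valuation_ofD[OF w(1)]
  have wt: "w (h c * y ^ i) = int m * v0 c + int i * v0 f" if "c \<noteq> 0" for c i
  proof -
    have "w (h c * y ^ i) = v0 (c ^ m * f ^ i)"
      using that f0 y0 oneV by (intro w(2)) (auto simp: term_power H)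
    then show ?thesis using that f0 by (simp add: D)
  qed
  have "(\<Sum>i<m. h (c i) * y ^ i) \<noteq> 0 \<and>
       (\<exists>i<m. c i \<noteq> 0 \<and> w (\<Sum>i<m. h (c i) * y ^ i) = w (h (c i) * y ^ i)) \<and>
       (\<forall>i<m. c i \<noteq> 0 \<longrightarrow> w (\<Sum>i<m. h (c i) * y ^ i) \<le> w (h (c i) * y ^ i))"
    if ex: "\<exists>i<m. c i \<noteq> 0" for c
  proof -
    let ?a = "\<Sum>i<m. h (c i) * y ^ i"
    obtain i where i: "i < m" "c i \<noteq> 0" "vunit V (?a / (h (c i) * y ^ i))"
      "\<And>j. j < m \<Longrightarrow> (h (c j) * y ^ j) / (h (c i) * y ^ i) \<in> V" using dom[OF ex] by blast
    have a0: "?a \<noteq> 0" using i(3) by (auto simp: vunit_def)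
    have b0: "h (c j) * y ^ j \<noteq> 0" if "c j \<noteq> 0" for j using that y0 by (simp add: H)
    have "w (?a / (h (c i) * y ^ i)) = 0" using i(3) E(8) by blast
    then have wi: "w ?a = w (h (c i) * y ^ i)" using a0 b0[OF i(2)] by (simp add: E(5))
    have "w ?a \<le> w (h (c j) * y ^ j)" if "j < m" "c j \<noteq> 0" for j
    proof -
      have "0 \<le> w ((h (c j) * y ^ j) / (h (c i) * y ^ i))"
        using i(4)[OF that(1)] E(2) b0[OF i(2)] b0[OF that(2)] by (metis divide_eq_0_iff)
      then show ?thesis using wi b0[OF i(2)] b0[OF that(2)] by (simp add: E(5))
    qed
    then show ?thesis using a0 wi i by blast
  qed
  then show ?thesis unfolding ramified_valuation_def using w(1) wt by blast
qed

end

section \<open>Conjugate embeddings and integrality of single terms\<close>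

context generated_radical_extension
begin

text \<open>\<open>\<zeta> * e y\<close> satisfies the same equation as \<open>y\<close>. Evaluation
  there is well defined: a polynomial vanishing at \<open>y\<close> has remainder 0 modulo X^m - f,
  since the powers of \<open>y\<close> are independent.\<close>

lemma conjugate_embedding:
  fixes e :: "'f \<Rightarrow> 'l::field"
  assumes indep: "\<And>c. (\<Sum>i<m. h (c i) * y ^ i) = 0 \<Longrightarrow> \<forall>i<m. c i = 0"
    and e: "field_embedding e" and \<zeta>: "\<zeta> ^ m = 1"
  shows "\<exists>\<sigma>. field_embedding \<sigma> \<and> (\<forall>c. \<sigma> (h c) = e (h c)) \<and> \<sigma> y = \<zeta> * e y"
proof -
  note E = field_embeddingD[OF e]
  define g where "g c = e (h c)" for c
  define z where "z = \<zeta> * e y"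
  have g: "field_embedding g" by (simp add: field_embedding_def g_def H E)
  have z: "z ^ m = g f" by (simp add: z_def g_def power_mult_distrib \<zeta> y flip: E)
  have ker: "ev g G z = 0" if G: "ev h G y = 0" for G
  proof -
    obtain Q R where R: "degree R < m" "G = (monom 1 m + [:- f:]) * Q + R" using reduce_mod by blast
    then have "ev h R y = 0" using G ev_modulus[OF h y] by simp
    then have "\<forall>i<m. coeff R i = 0" using indep[of "coeff R"] ev_altdef[OF h R(1)] by simp
    then have "R = 0" using R(1) by (metis leading_coeff_0_iff)
    then show ?thesis using R(2) ev_modulus[OF g z, of Q R] ev_simps(4)[OF g] by simp
  qed
  define rep where "rep a = (SOME G. a = ev h G y)" for a
  have rep: "ev h (rep a) y = a" for a using someI_ex[OF gen[of a]] by (simp add: rep_def)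
  define \<sigma> where "\<sigma> a = ev g (rep a) z" for a
  have \<sigma>: "\<sigma> (ev h G y) = ev g G z" for G
  proof -
    let ?a = "ev h G y"
    have "ev h (G + rep ?a * [:-1:]) y = 0" by (simp only: ev_simps[OF h] rep) (simp add: H)
    then have "ev g (G + rep ?a * [:-1:]) z = 0" by (rule ker)
    then have "ev g G z + \<sigma> ?a * g (- 1) = 0"
      by (simp only: ev_simps[OF g] \<sigma>_def) simp
    then show ?thesis by (simp add: field_embeddingD[OF g])
  qed
  have "field_embedding \<sigma>" unfolding field_embedding_def
  proof (intro conjI allI)
    show "\<sigma> 1 = 1" using \<sigma>[of 1] by (simp add: ev_simps[OF h] ev_simps[OF g])
    fix a b
    show "\<sigma> (a + b) = \<sigma> a + \<sigma> b" using \<sigma>[of "rep a + rep b"]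
      by (simp add: ev_simps[OF h] ev_simps[OF g] rep \<sigma>_def)
    show "\<sigma> (a * b) = \<sigma> a * \<sigma> b" using \<sigma>[of "rep a * rep b"]
      by (simp add: ev_simps[OF h] ev_simps[OF g] rep \<sigma>_def)
  qed
  moreover have "\<sigma> (h c) = g c" for c using \<sigma>[of "[:c:]"] by (simp add: ev_simps[OF h] ev_simps[OF g])
  moreover have "\<sigma> y = z" using \<sigma>[of "[:0, 1:]"]
    by (simp add: ev_simps[OF h] ev_simps[OF g] H field_embeddingD[OF g])
  ultimately show ?thesis unfolding g_def z_def by blast
qed

text \<open>A valuation ring of an algebraically closed extension pulls back along every conjugate
  embedding \<open>y \<mapsto> \<zeta> y\<close>, so it contains all conjugates of \<open>a\<close>; averaging them against
  \<open>\<zeta>\<^sup>-\<^sup>k\<close> isolates the \<open>k\<close>-th term. No root of unity is needed in the field itself.\<close>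

lemma term_integral:
  fixes e :: "'f \<Rightarrow> 'l::alg_closed_field"
  assumes indep: "\<And>c. (\<Sum>i<m. h (c i) * y ^ i) = 0 \<Longrightarrow> \<forall>i<m. c i = 0"
    and e: "field_embedding e"
    and W: "valring W" and v0: "valuation_of W v0" and t: "t \<noteq> 0" "v0 t = 1"
    and mW: "vunit W (of_nat m)"
    and int: "\<And>V. valring V \<Longrightarrow> (\<And>c. h c \<in> V \<longleftrightarrow> c \<in> W) \<Longrightarrow> a \<in> V"
    and a: "a = (\<Sum>i<m. h (c i) * y ^ i)" and k: "k < m" "c k \<noteq> 0"
  shows "0 \<le> int m * v0 (c k) + int k * v0 f"
proof -
  note E = field_embeddingD[OF e] and D = valuation_ofD[OF v0]
  define g where "g c = e (h c)" for c
  have g: "field_embedding g" by (simp add: field_embedding_def g_def H E)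
  note Gr = field_embeddingD[OF g]
  obtain V where V: "valring V" "\<And>c. g c \<in> V \<longleftrightarrow> c \<in> W" using lift_valring[OF g W v0 t] by blast
  note S = subringD[OF valring_subring[OF V(1)]]
  have conj: "(\<Sum>i<m. g (c i) * (\<zeta> * e y) ^ i) \<in> V" if z: "\<zeta> ^ m = 1" for \<zeta>
  proof -
    obtain \<sigma> where \<sigma>: "field_embedding \<sigma>" "\<And>c. \<sigma> (h c) = e (h c)" "\<sigma> y = \<zeta> * e y"
      using conjugate_embedding[OF indep e z] by blast
    note Sg = field_embeddingD[OF \<sigma>(1)]
    have 1: "valring (\<sigma> -` V)" unfolding valring_def
    proof (intro conjI allI)
      show "is_subring (\<sigma> -` V)" using S by (simp add: is_subring_def Sg)
      show "b \<in> \<sigma> -` V \<or> inverse b \<in> \<sigma> -` V" for b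
        using valring_total[OF V(1), of "\<sigma> b"] by (simp add: Sg)
      have "inverse t \<notin> W" using t by (simp add: D)
      then have "\<sigma> (h (inverse t)) \<notin> V" using V(2) \<sigma>(2) by (simp add: g_def)
      then show "\<sigma> -` V \<noteq> UNIV" by blast
    qed
    have "h c \<in> \<sigma> -` V \<longleftrightarrow> c \<in> W" for c using V(2) \<sigma>(2) by (simp add: g_def)
    then have "\<sigma> a \<in> V" using int[OF 1] by simp
    then show ?thesis by (simp add: a field_embedding_sum[OF \<sigma>(1)] Sg \<sigma> g_def)
  qed
  have mg: "of_nat m = g (of_nat m)" by (simp add: field_embedding_of_nat[OF g])
  then have m0: "of_nat m \<noteq> (0 :: 'l)" using mW by (simp add: vunit_def Gr)
  note R = roots_of_unity_sum[where 'l = 'l, OF m m0]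
  let ?R = "{\<zeta>::'l. \<zeta> ^ m = 1}"
  \<comment> \<open>The exponent \<open>m - k\<close> stands for \<open>- k\<close>. Since
    \<open>m - k + i\<close> lies strictly between 0 and \<open>2 * m\<close>, the only multiple of
    m it can be is m itself.\<close>
  have dv: "m dvd m - k + i \<longleftrightarrow> i = k" if "i < m" for i
  proof
    assume "m dvd m - k + i"
    then obtain q where q: "m - k + i = m * q" by blast
    have "0 < m - k + i" "m - k + i < m * 2" using k that by linarith+
    then have "q = 1" unfolding q by (auto simp: less_Suc_eq)
    then show "i = k" using q k by simp
  next
    assume "i = k" then show "m dvd m - k + i" using k by simp
  qed
  have "(\<Sum>\<zeta>\<in>?R. \<zeta> ^ (m - k) * (\<Sum>i<m. g (c i) * (\<zeta> * e y) ^ i)) \<in> V"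
  proof (rule subring_sum[OF valring_subring[OF V(1)]], rule S(4))
    fix \<zeta> assume z: "\<zeta> \<in> ?R"
    then have "\<zeta> ^ m \<in> V" using S(1) by simp
    then have "\<zeta> \<in> V" using valring_power_mem[OF V(1) m] by blast
    then show "\<zeta> ^ (m - k) \<in> V" by (rule S(7))
    show "(\<Sum>i<m. g (c i) * (\<zeta> * e y) ^ i) \<in> V" using conj z by blast
  qed
  also have "(\<Sum>\<zeta>\<in>?R. \<zeta> ^ (m - k) * (\<Sum>i<m. g (c i) * (\<zeta> * e y) ^ i))
    = (\<Sum>i<m. \<Sum>\<zeta>\<in>?R. g (c i) * e y ^ i * \<zeta> ^ (m - k + i))"
  proof -
    have "\<zeta> ^ (m - k) * (g (c i) * (\<zeta> * e y) ^ i) = g (c i) * e y ^ i * \<zeta> ^ (m - k + i)" for \<zeta> i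
      by (simp add: power_mult_distrib power_add)
    then show ?thesis by (subst sum.swap) (simp only: sum_distrib_left)
  qed
  also have "\<dots> = (\<Sum>i<m. g (c i) * e y ^ i * (if m dvd m - k + i then of_nat m else 0))"
    by (simp only: R(2) flip: sum_distrib_left)
  also have "\<dots> = (\<Sum>i<m. if i = k then g (c k) * e y ^ k * of_nat m else 0)"
    by (rule sum.cong) (use dv in auto)
  also have "\<dots> = g (c k) * e y ^ k * of_nat m" using k by simp
  finally have tm: "g (c k) * e y ^ k * of_nat m \<in> V" .
  have "g (inverse (of_nat m)) \<in> V" using mW V(2) by (simp add: vunit_def del: Gr)
  then have "g (c k) * e y ^ k * of_nat m * g (inverse (of_nat m)) \<in> V" by (rule S(4)[OF tm])
  then have "g (c k) * e y ^ k \<in> V" using m0 mg by (simp add: Gr mult.assoc)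
  \<comment> \<open>The m-th power returns to the image of the base field, where \<open>V\<close>
    restricts to \<open>W\<close>.\<close>
  then have "(g (c k) * e y ^ k) ^ m \<in> V" by (rule S(7))
  also have "(g (c k) * e y ^ k) ^ m = g (c k ^ m * f ^ k)"
    unfolding g_def term_power[symmetric] by (simp add: E)
  finally have "c k ^ m * f ^ k \<in> W" using V(2) by simp
  then show ?thesis using k f0 by (simp add: D)
qed

end

section \<open>Kummer extensions of the rational function field\<close>

text \<open>By \<open>rat_place_cases\<close> the rings of these functions are the valuation rings
  of K(x) over the constants. Being normalized, the functions can enter a degree count.\<close>

definition ratval :: "('k::field poly fract \<Rightarrow> int) \<Rightarrow> bool" where
  "ratval v \<longleftrightarrow> v = vinf \<or> (\<exists>q. irreducible q \<and> lead_coeff q = 1 \<and> v = vp q)"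

lemma ratval_valuation:
  assumes "ratval v"
  shows "valring (nonneg_ring v)" "valuation_of (nonneg_ring v) v"
  using assms vp_valuation vinf_valuation by (auto simp: ratval_def)

lemma ratval_uniformizer:
  fixes v :: "'k::field poly fract \<Rightarrow> int"
  assumes "ratval v"
  obtains t where "t \<noteq> 0" "v t = 1"
proof (cases "v = vinf")
  case True
  have "v (inverse (rat_of_poly [:0, 1:])) = 1"
    using valuation_ofD(4)[OF ratval_valuation(2)[OF assms], of "rat_of_poly [:0, 1:]"]
    by (simp add: True vinf_rat rat_of_poly_embedding)
  then show ?thesis using that[of "inverse (rat_of_poly [:0, 1:])"] by (simp add: rat_of_poly_embedding)
next
  case False
  then obtain q where q: "irreducible q" "v = vp q" using assms by (auto simp: ratval_def)
  then have "q \<noteq> 0" by auto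
  then show ?thesis using that[of "rat_of_poly q"] q by (simp add: vp_self rat_of_poly_embedding)
qed

lemma ratval_const: "ratval v \<Longrightarrow> c \<noteq> 0 \<Longrightarrow> v (rat_of_poly [:c:]) = 0"
  by (auto simp: ratval_def vp_const vinf_const)

lemma rat_consts_subset_ratval: "ratval v \<Longrightarrow> rat_consts \<subseteq> nonneg_ring v"
  using ratval_const[of v] by (force simp: rat_consts_def nonneg_ring_def rat_of_poly_embedding)

lemma place_is_ratval:
  assumes "valring V" "rat_consts \<subseteq> V"
  obtains v where "ratval v" "V = nonneg_ring v"
  using rat_place_cases[OF assms] by (auto simp: ratval_def)

text \<open>The polynomial \<open>q\<close> separates \<open>vp q\<close> from all others: its
  inverse has a pole at \<open>vp q\<close>, while every other normalized valuation gives
  \<open>q\<close> a value of at most 0.\<close>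

lemma ratval_eqI:
  assumes v: "ratval v" "ratval v'" and e: "nonneg_ring v = nonneg_ring v'"
  shows "v = v'"
proof -
  have *: "u = u'" if u: "u = vp q" "irreducible q" "lead_coeff q = 1" and u': "ratval u'" "nonneg_ring u = nonneg_ring u'"
    for u u' :: "'a poly fract \<Rightarrow> int" and q
  proof (rule ccontr)
    assume ne: "u \<noteq> u'"
    have ur: "ratval u" using u by (auto simp: ratval_def)
    have q0: "rat_of_poly q \<noteq> 0" "q \<noteq> 0" using u by (auto simp: rat_of_poly_embedding)
    have "u (inverse (rat_of_poly q)) = - 1"
      using valuation_ofD(4)[OF ratval_valuation(2)[OF ur] q0(1)] u by (simp add: vp_self)
    then have "inverse (rat_of_poly q) \<notin> nonneg_ring u" using q0 by (simp add: nonneg_ring_def)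
    then have "inverse (rat_of_poly q) \<notin> nonneg_ring u'" using u'(2) by simp
    then have "u' (rat_of_poly q) > 0"
      using valuation_ofD(4)[OF ratval_valuation(2)[OF u'(1)] q0(1)] by (auto simp: nonneg_ring_def)
    moreover have "u' (rat_of_poly q) \<le> 0"
      using u'(1) ne u q0 vp_other[of _ q] by (fastforce simp: ratval_def vinf_rat)
    ultimately show False by simp
  qed
  consider "v = vinf" "v' = vinf" | q where "v = vp q" "irreducible q" "lead_coeff q = 1"
    | q where "v' = vp q" "irreducible q" "lead_coeff q = 1"
    using v by (auto simp: ratval_def)
  then show ?thesis
  proof cases
    case 2 then show ?thesis using *[OF 2 v(2) e] by simp
  next
    case 3 then show ?thesis using *[OF 3 v(1) e[symmetric]] by simp
  qed simp
qed

locale kummer =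
  fixes m r :: nat and \<alpha> :: "'k::field" and p :: "nat \<Rightarrow> 'k poly" and lam :: "nat \<Rightarrow> int"
    and f :: "'k poly fract" and emb :: "'k poly fract \<Rightarrow> 'f::field" and y :: 'f and C :: "'f set"
    and d :: "nat \<Rightarrow> nat"
  assumes m: "m \<ge> 2" and m_char: "of_nat m \<noteq> (0 :: 'k)"
    and \<alpha>: "\<alpha> \<noteq> 0"
    and p_monic: "\<And>i. i \<in> {1..r} \<Longrightarrow> lead_coeff (p i) = 1"
    and p_irreducible: "\<And>i. i \<in> {1..r} \<Longrightarrow> irreducible (p i)"
    and p_distinct: "inj_on p {1..r}"
    and f: "f = rat_of_poly [:\<alpha>:] * (\<Prod>i=1..r. rat_of_poly (p i) powi lam i)"
    and emb: "field_embedding emb"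
    and C: "C = emb ` rat_consts"
    and y: "y ^ m = emb f"
    and F_gen: "is_subfield hull (C \<union> {emb rat_x, y}) = UNIV"
    and d: "d 0 = 1" "\<And>i. i \<in> {1..r} \<Longrightarrow> d i = degree (p i)"
    and lam0: "lam 0 = - (\<Sum>i=1..r. lam i * int (d i))"
begin

text \<open>Index 0 is the pole of x, which makes the orders of \<open>f\<close> and the degree
  formula uniform in the index.\<close>

definition pv :: "nat \<Rightarrow> 'k poly fract \<Rightarrow> int" where
  "pv i = (if i = 0 then vinf else vp (p i))"

lemma p_nz: "i \<in> {1..r} \<Longrightarrow> rat_of_poly (p i) \<noteq> 0" and p_nz': "i \<in> {1..r} \<Longrightarrow> p i \<noteq> 0"
  using p_irreducible[of i] by (auto simp: rat_of_poly_embedding)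

lemma ratval_pv: "i \<le> r \<Longrightarrow> ratval (pv i)"
  using p_irreducible[of i] p_monic[of i] by (auto simp: pv_def ratval_def)

lemma vp_prod:
  assumes q: "irreducible q" "lead_coeff q = 1"
  shows "vp q (\<Prod>i=1..r. rat_of_poly (p i) powi e i) = (\<Sum>i=1..r. if p i = q then e i else 0)"
proof -
  have rq: "ratval (vp q)" using q by (auto simp: ratval_def)
  note D = valuation_ofD[OF ratval_valuation(2)[OF rq]]
  have "vp q (rat_of_poly (p i) powi e i) = (if p i = q then e i else 0)" if i: "i \<in> {1..r}" for i
    using D(7)[OF p_nz[OF i], of "e i"] vp_self[OF q(1)] vp_other[OF q(1) p_irreducible[OF i] q(2) p_monic[OF i]]
    by auto
  then show ?thesis
    by (subst valuation_of_prod[OF ratval_valuation(2)[OF rq]]) (use p_nz in auto)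
qed

lemma pv_prod_pos:
  assumes "i \<in> {1..r}" shows "pv i (\<Prod>k=1..r. rat_of_poly (p k) powi e k) = e i"
proof -
  have "pv i (\<Prod>k=1..r. rat_of_poly (p k) powi e k) = (\<Sum>k=1..r. if p k = p i then e k else 0)"
    using assms vp_prod[OF p_irreducible[OF assms] p_monic[OF assms]] by (simp add: pv_def)
  also have "\<dots> = (\<Sum>k=1..r. if k = i then e k else 0)"
    using inj_on_eq_iff[OF p_distinct] assms by (intro sum.cong) auto
  also have "\<dots> = e i" using assms by simp
  finally show ?thesis .
qed

lemma pv_prod_0: "pv 0 (\<Prod>k=1..r. rat_of_poly (p k) powi e k) = - (\<Sum>k=1..r. e k * int (d k))"
proof -
  have rq: "ratval (pv 0)" using ratval_pv by simp
  note D = valuation_ofD[OF ratval_valuation(2)[OF rq]]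
  have "pv 0 (rat_of_poly (p k) powi e k) = - (e k * int (d k))" if i: "k \<in> {1..r}" for k
    using D(7)[OF p_nz[OF i], of "e k"] vinf_rat[OF p_nz'[OF i]] d(2)[OF i]
    by (simp add: pv_def)
  then show ?thesis
    by (subst valuation_of_prod[OF ratval_valuation(2)[OF rq]]) (use p_nz in \<open>auto simp: sum_negf\<close>)
qed

lemma vp_prod_other:
  assumes q: "irreducible q" "lead_coeff q = 1" "q \<notin> p ` {1..r}"
  shows "vp q (\<Prod>i=1..r. rat_of_poly (p i) powi e i) = 0"
proof -
  have "vp q (\<Prod>i=1..r. rat_of_poly (p i) powi e i) = (\<Sum>i=1..r. if p i = q then e i else 0)"
    by (rule vp_prod[OF q(1,2)])
  also have "\<dots> = 0" using q(3) by (intro sum.neutral) auto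
  finally show ?thesis .
qed

lemma f0: "f \<noteq> 0"
  using \<alpha> p_nz by (simp add: f rat_of_poly_embedding)

text \<open>At index 0 this is the reason for the definition of \<open>lam 0\<close>: the order at
  infinity is minus the degree.\<close>

lemma pv_f: "i \<le> r \<Longrightarrow> pv i f = lam i"
proof -
  assume i: "i \<le> r"
  let ?g = "\<Prod>k=1..r. rat_of_poly (p k) powi lam k"
  have "?g \<noteq> 0" using p_nz by simp
  then have "pv i f = pv i ?g" unfolding f
    using valuation_ofD(1)[OF ratval_valuation(2)[OF ratval_pv[OF i]], of "rat_of_poly [:\<alpha>:]" ?g]
      ratval_const[OF ratval_pv[OF i] \<alpha>] \<alpha> by (simp add: rat_of_poly_embedding)
  also have "\<dots> = lam i" using i pv_prod_pos[of i lam] pv_prod_0[of lam] lam0 by (cases "i = 0") auto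
  finally show ?thesis .
qed

lemma vp_f_other:
  assumes q: "irreducible q" "lead_coeff q = 1" "q \<notin> p ` {1..r}"
  shows "vp q f = 0"
proof -
  let ?g = "\<Prod>k=1..r. rat_of_poly (p k) powi lam k"
  have rq: "ratval (vp q)" using q by (auto simp: ratval_def)
  have "?g \<noteq> 0" using p_nz by simp
  then have "vp q f = vp q ?g" unfolding f
    using valuation_ofD(1)[OF ratval_valuation(2)[OF rq], of "rat_of_poly [:\<alpha>:]" ?g]
      ratval_const[OF rq \<alpha>] \<alpha> by (simp add: rat_of_poly_embedding)
  then show ?thesis using vp_prod_other[OF q] by simp
qed

sublocale radical_extension emb y f m
  by unfold_locales (use m emb y f0 in auto)

sublocale generated_radical_extension emb y f m
proof
  fix a
  have "is_subfield hull (C \<union> {emb rat_x, y}) \<subseteq> {ev emb G y | G. True}"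
  proof (rule hull_minimal)
    have "emb c = ev emb [:c:] y" for c by (simp add: ev_simps[OF emb])
    moreover have "y = ev emb [:0, 1:] y" by (simp add: ev_simps[OF emb] H)
    ultimately show "C \<union> {emb rat_x, y} \<subseteq> {ev emb G y | G. True}" using C by blast
  qed (rule ev_y_subfield)
  then show "\<exists>G. a = ev emb G y" using F_gen by blast
qed

section \<open>Places of F above those of K(x)\<close>

lemma C_subset: 
  assumes "\<And>c. emb c \<in> V \<longleftrightarrow> c \<in> nonneg_ring v" "ratval v" 
  shows "C \<subset> V"
proof -
  have "C \<subseteq> V" using assms rat_consts_subset_ratval C by blast
  moreover obtain t where t: "t \<noteq> 0" "v t = 1" using ratval_uniformizer[OF assms(2)] .
  then have "emb t \<in> V" using assms(1) by (simp add: nonneg_ring_def)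
  moreover have "t \<notin> rat_consts" 
  proof
    assume "t \<in> rat_consts"
    then obtain c where "t = rat_of_poly [:c:]" by (auto simp: rat_consts_def)
    then show False using t ratval_const[OF assms(2), of c] by (auto simp: rat_of_poly_embedding)
  qed
  then have "emb t \<notin> C" unfolding C using H(12) by (metis imageE)
  ultimately show ?thesis by blast
qed

text \<open>The restriction of \<open>V\<close> to K(x) is again a proper subring: otherwise
  \<open>V\<close> would contain \<open>y ^ m\<close>, hence \<open>y\<close>, hence all expansions
  in powers of \<open>y\<close>.\<close>

lemma place_lies_over:
  assumes V: "valring V" and CV: "C \<subseteq> V"
  obtains v where "ratval v" "\<And>c. emb c \<in> V \<longleftrightarrow> c \<in> nonneg_ring v"
proof -
  note S = subringD[OF valring_subring[OF V]]
  have "valring (emb -` V)" unfolding valring_def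
  proof (intro conjI allI)
    show "is_subring (emb -` V)" using S by (simp add: is_subring_def H)
    show "a \<in> emb -` V \<or> inverse a \<in> emb -` V" for a
      using valring_total[OF V, of "emb a"] by (simp add: H)
    show "emb -` V \<noteq> UNIV"
    proof
      assume u: "emb -` V = UNIV"
      have e: "emb c \<in> V" for c using u by auto
      then have "y ^ m \<in> V" using y by simp
      then have "y \<in> V" using valring_power_mem[OF V, of m] m by simp
      have "a \<in> V" for a
      proof -
        obtain c where "a = (\<Sum>i<m. emb (c i) * y ^ i)" using expansion by blast
        moreover have "emb (c i) * y ^ i \<in> V" for i by (rule S(4)[OF e S(7)[OF \<open>y \<in> V\<close>]])
        then have "(\<Sum>i<m. emb (c i) * y ^ i) \<in> V" by (intro subring_sum[OF valring_subring[OF V]])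
        ultimately show ?thesis by simp
      qed
      then show False using V by (auto simp: valring_def)
    qed
  qed
  moreover have "rat_consts \<subseteq> emb -` V" using CV C by auto
  ultimately obtain v where "ratval v" "emb -` V = nonneg_ring v" using place_is_ratval by blast
  then show ?thesis using that by blast
qed

text \<open>Here discreteness at an arbitrary place pays off: the sign test inside
  \<open>pole_divisor\<close> becomes membership in the ring.\<close>

lemma place_val_neg_iff:
  assumes V: "valring V" and CV: "C \<subseteq> V" and a: "a \<noteq> 0"
  shows "place_val (maxideal V) a < 0 \<longleftrightarrow> a \<notin> V"
proof -
  obtain v where v: "ratval v" "\<And>c. emb c \<in> V \<longleftrightarrow> c \<in> nonneg_ring v"
    using place_lies_over[OF V CV] by blast
  obtain t where t: "t \<noteq> 0" "v t = 1" using ratval_uniformizer[OF v(1)] .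
  obtain w s where w: "valuation_of V w" "s \<noteq> 0" "w s = 1"
    using discrete[OF V ratval_valuation(2)[OF v(1)] v(2) t] by blast
  then show ?thesis using place_val_eq[OF V w a] valuation_ofD(2)[OF w(1) a] by auto
qed

text \<open>An arbitrary choice of a ring above the place \<open>i\<close>; at totally ramified
  indices \<open>Vr_unique\<close> shows that there is only one.\<close>

definition Vr :: "nat \<Rightarrow> 'f set" where
  "Vr i = (SOME V. valring V \<and> (\<forall>c. emb c \<in> V \<longleftrightarrow> c \<in> nonneg_ring (pv i)))"

lemma Vr:
  assumes i: "i \<le> r"
  shows "valring (Vr i)" "emb c \<in> Vr i \<longleftrightarrow> c \<in> nonneg_ring (pv i)" "C \<subset> Vr i"
proof -
  note v = ratval_valuation[OF ratval_pv[OF i]]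
  obtain t where t: "t \<noteq> 0" "pv i t = 1" using ratval_uniformizer[OF ratval_pv[OF i]] .
  have "\<exists>V. valring V \<and> (\<forall>c. emb c \<in> V \<longleftrightarrow> c \<in> nonneg_ring (pv i))"
    using lift_valring[OF emb v t] by blast
  then have *: "valring (Vr i) \<and> (\<forall>c. emb c \<in> Vr i \<longleftrightarrow> c \<in> nonneg_ring (pv i))"
    unfolding Vr_def by (rule someI_ex)
  then show "valring (Vr i)" "emb c \<in> Vr i \<longleftrightarrow> c \<in> nonneg_ring (pv i)" by auto
  show "C \<subset> Vr i" using C_subset[OF _ ratval_pv[OF i]] * by blast
qed

definition qv :: "nat \<Rightarrow> 'f \<Rightarrow> int" where
  "qv i = (SOME w. ramified_valuation (Vr i) (pv i) w)"

lemma ramified_valuation_pv: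
  assumes i: "i \<le> r" "coprime (int m) (lam i)" and V: "valring V" "\<And>c. emb c \<in> V \<longleftrightarrow> c \<in> nonneg_ring (pv i)"
  shows "\<exists>w. ramified_valuation V (pv i) w"
proof -
  note v = ratval_valuation[OF ratval_pv[OF i(1)]]
  obtain t where t: "t \<noteq> 0" "pv i t = 1" using ratval_uniformizer[OF ratval_pv[OF i(1)]] .
  show ?thesis using ramified_valuation_exists[OF v _ V t] i by (simp add: pv_f)
qed

lemma qv:
  assumes i: "i \<le> r" "coprime (int m) (lam i)"
  shows "valuation_of (Vr i) (qv i)" "c \<noteq> 0 \<Longrightarrow> qv i (emb c * y ^ j) = int m * pv i c + int j * lam i"
    "\<exists>k<m. c' k \<noteq> 0 \<Longrightarrow> (\<Sum>k<m. emb (c' k) * y ^ k) \<noteq> 0 \<and>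
       (\<exists>k<m. c' k \<noteq> 0 \<and> qv i (\<Sum>k<m. emb (c' k) * y ^ k) = qv i (emb (c' k) * y ^ k)) \<and>
       (\<forall>k<m. c' k \<noteq> 0 \<longrightarrow> qv i (\<Sum>k<m. emb (c' k) * y ^ k) \<le> qv i (emb (c' k) * y ^ k))"
proof -
  note * = someI_ex[OF ramified_valuation_pv[OF i Vr(1,2)[OF i(1)]], folded qv_def,
    unfolded ramified_valuation_def pv_f[OF i(1)]]
  show "valuation_of (Vr i) (qv i)" using * by blast
  show "c \<noteq> 0 \<Longrightarrow> qv i (emb c * y ^ j) = int m * pv i c + int j * lam i" using * by blast
  show "\<exists>k<m. c' k \<noteq> 0 \<Longrightarrow> (\<Sum>k<m. emb (c' k) * y ^ k) \<noteq> 0 \<and>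
       (\<exists>k<m. c' k \<noteq> 0 \<and> qv i (\<Sum>k<m. emb (c' k) * y ^ k) = qv i (emb (c' k) * y ^ k)) \<and>
       (\<forall>k<m. c' k \<noteq> 0 \<longrightarrow> qv i (\<Sum>k<m. emb (c' k) * y ^ k) \<le> qv i (emb (c' k) * y ^ k))"
    using * by blast
qed

lemma qv_term:
  assumes i: "i \<le> r" "coprime (int m) (lam i)" and c: "c \<noteq> 0"
  shows "qv i (emb c * y powi n) = int m * pv i c + n * lam i"
proof -
  note D = valuation_ofD[OF qv(1)[OF i]]
  have "pv i 1 = 0" using valuation_ofD(3)[OF ratval_valuation(2)[OF ratval_pv[OF i(1)]]] .
  then have "qv i y = lam i" using qv(2)[OF i, of 1 1] by (simp add: H)
  moreover have "qv i (emb c) = int m * pv i c" using qv(2)[OF i c, of 0] by simp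
  moreover have "qv i (emb c * y powi n) = qv i (emb c) + n * qv i y" using c y0 by (simp add: D H)
  ultimately show ?thesis by simp
qed

text \<open>Any ring above a totally ramified place has a valuation that is the minimum over the
  terms of an expansion, with term values fixed by the base field. Two such valuations agree, and so
  do their rings.\<close>

lemma Vr_unique:
  assumes i: "i \<le> r" "coprime (int m) (lam i)" and V: "valring V" "\<And>c. emb c \<in> V \<longleftrightarrow> c \<in> nonneg_ring (pv i)"
  shows "V = Vr i"
proof -
  obtain w where w: "valuation_of V w" "\<And>c j. c \<noteq> 0 \<Longrightarrow> w (emb c * y ^ j) = int m * pv i c + int j * lam i"
    "\<And>c. \<exists>i<m. c i \<noteq> 0 \<Longrightarrow>
       (\<exists>i<m. c i \<noteq> 0 \<and> w (\<Sum>i<m. emb (c i) * y ^ i) = w (emb (c i) * y ^ i)) \<and>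
       (\<forall>i<m. c i \<noteq> 0 \<longrightarrow> w (\<Sum>i<m. emb (c i) * y ^ i) \<le> w (emb (c i) * y ^ i))"
    using ramified_valuation_pv[OF i V] unfolding ramified_valuation_def pv_f[OF i(1)] by blast
  have "w a = qv i a" if a: "a \<noteq> 0" for a
  proof -
    obtain c where c: "a = (\<Sum>i<m. emb (c i) * y ^ i)" using expansion by blast
    have ex: "\<exists>i<m. c i \<noteq> 0"
    proof (rule ccontr)
      assume "\<not> ?thesis"
      then have "a = 0" unfolding c by (intro sum.neutral) (auto simp: H)
      then show False using a by simp
    qed
    obtain k where k: "k < m" "c k \<noteq> 0" "w a = w (emb (c k) * y ^ k)" using w(3)[OF ex] c by blast
    obtain j where j: "j < m" "c j \<noteq> 0" "qv i a = qv i (emb (c j) * y ^ j)" using qv(3)[OF i, of c] ex c by blast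
    have "qv i a \<le> w a" using k qv(3)[OF i, of c] ex c by (auto simp: w(2) qv(2)[OF i])
    moreover have "w a \<le> qv i a" using j w(3)[OF ex] c by (auto simp: w(2) qv(2)[OF i])
    ultimately show ?thesis by simp
  qed
  then have "a \<in> V \<longleftrightarrow> a \<in> Vr i" if "a \<noteq> 0" for a
    using that valuation_ofD(2)[OF w(1) that] valuation_ofD(2)[OF qv(1)[OF i] that] by simp
  then show ?thesis using subringD(2)[OF valring_subring[OF V(1)]] subringD(2)[OF valring_subring[OF Vr(1)[OF i(1)]]]
    by (metis subsetI subset_antisym)
qed

lemma qv_uniformizer:
  assumes i: "i \<le> r" "coprime (int m) (lam i)"
  obtains s where "s \<noteq> 0" "qv i s = 1"
proof -
  note D = valuation_ofD[OF qv(1)[OF i]]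
  obtain t where t: "t \<noteq> 0" "pv i t = 1" using ratval_uniformizer[OF ratval_pv[OF i(1)]] .
  \<comment> \<open>The Bezout coefficients become exponents:
    \<open>emb (t powi u) * y powi n\<close> has value \<open>u * m + n * lam i = 1\<close>.\<close>
  obtain u n where un: "u * int m + n * lam i = 1" using i(2) by (metis bezout_int coprime_imp_gcd_eq_1)
  have "qv i (emb (t powi u) * y powi n) = int m * pv i (t powi u) + n * lam i"
    using t by (intro qv_term[OF i]) simp
  also have "pv i (t powi u) = u" using t valuation_ofD(7)[OF ratval_valuation(2)[OF ratval_pv[OF i(1)]] t(1)] by simp
  finally show ?thesis using that[of "emb (t powi u) * y powi n"] un t y0 by (simp add: H mult.commute)
qed

lemma place_val_qv:
  assumes i: "i \<le> r" "coprime (int m) (lam i)" and a: "a \<noteq> 0"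
  shows "place_val (maxideal (Vr i)) a = qv i a"
proof -
  obtain s where s: "s \<noteq> 0" "qv i s = 1" using qv_uniformizer[OF i] .
  show ?thesis by (rule place_val_eq[OF Vr(1)[OF i(1)] qv(1)[OF i] s a])
qed

lemma pv_inj: "i \<le> r \<Longrightarrow> j \<le> r \<Longrightarrow> pv i = pv j \<Longrightarrow> i = j"
proof -
  have *: "a = b" if "a \<in> {1..r}" "b \<le> r" "pv a = pv b" for a b
  proof (rule ccontr)
    assume "a \<noteq> b"
    have "pv a (rat_of_poly (p a)) = 1" using vp_self[OF p_irreducible[OF that(1)]] that(1) by (simp add: pv_def)
    moreover have "pv b (rat_of_poly (p a)) \<le> 0"
    proof (cases "b = 0")
      case True then show ?thesis using p_nz'[OF that(1)] by (simp add: pv_def vinf_rat)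
    next
      case False
      then have b: "b \<in> {1..r}" using that by auto
      then have "p b \<noteq> p a" using inj_on_eq_iff[OF p_distinct b that(1)] \<open>a \<noteq> b\<close> by simp
      then show ?thesis using vp_other[of "p b" "p a"] p_irreducible p_monic b that(1) False by (simp add: pv_def)
    qed
    ultimately show False using that(3) by simp
  qed
  assume "i \<le> r" "j \<le> r" "pv i = pv j"
  then show ?thesis using *[of i j] *[of j i] by (cases "i = 0"; cases "j = 0") auto
qed

lemma Vr_inj:
  assumes "i \<le> r" "j \<le> r" "maxideal (Vr i) = maxideal (Vr j)"
  shows "i = j"
proof -
  have "Vr i = Vr j" using assms place_ring_maxideal[OF Vr(1)] by metis
  then have "nonneg_ring (pv i) = nonneg_ring (pv j)" using Vr(2)[OF assms(1)] Vr(2)[OF assms(2)] by blast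
  then show ?thesis using ratval_eqI ratval_pv pv_inj assms by blast
qed

section \<open>Identification of the places given by definite descriptions\<close>

lemma rat_places:
  assumes P0: "P 0 = (THE P'. is_place rat_consts P' \<and> place_val P' rat_x < 0)"
    and P: "\<And>i. i \<in> {1..r} \<Longrightarrow>
              P i = (THE P'. is_place rat_consts P' \<and> place_val P' (rat_of_poly (p i)) > 0)"
    and i: "i \<le> r"
  shows "P i = maxideal (nonneg_ring (pv i))"
proof -
  have pl: "is_place rat_consts P' \<longleftrightarrow> (\<exists>v. ratval v \<and> P' = maxideal (nonneg_ring v))" for P' :: "'k poly fract set"
  proof
    assume "is_place rat_consts P'"
    then show "\<exists>v. ratval v \<and> P' = maxideal (nonneg_ring v)"
      unfolding is_place_iff using place_is_ratval by (metis psubset_imp_subset)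
  next
    assume "\<exists>v. ratval v \<and> P' = maxideal (nonneg_ring v)"
    then obtain v where v: "ratval v" "P' = maxideal (nonneg_ring v)" by blast
    obtain t where t: "t \<noteq> 0" "v t = 1" using ratval_uniformizer[OF v(1)] .
    have "t \<in> nonneg_ring v" using t by (simp add: nonneg_ring_def)
    moreover have "t \<notin> rat_consts"
    proof
      assume "t \<in> rat_consts"
      then obtain c where "t = rat_of_poly [:c:]" by (auto simp: rat_consts_def)
      then show False using t ratval_const[OF v(1), of c] by (auto simp: rat_of_poly_embedding)
    qed
    ultimately have "rat_consts \<subset> nonneg_ring v" using rat_consts_subset_ratval[OF v(1)] by blast
    then show "is_place rat_consts P'" unfolding is_place_iff using v ratval_valuation(1) by blast
  qed
  have pval: "place_val (maxideal (nonneg_ring v)) g = v g" if v: "ratval v" and "g \<noteq> 0" for v and g :: "'k poly fract"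
  proof -
    obtain t where t: "t \<noteq> 0" "v t = 1" using ratval_uniformizer[OF v(1)] .
    then show ?thesis using place_val_eq[OF ratval_valuation[OF v] t that(2)] by simp
  qed
  show ?thesis
  proof (cases "i = 0")
    case True
    have x0: "(rat_x :: 'k poly fract) \<noteq> 0" by (simp add: rat_x_def rat_of_poly_embedding)
    have "P 0 = maxideal (nonneg_ring (pv 0))" unfolding P0
    proof (rule the_equality)
      show "is_place rat_consts (maxideal (nonneg_ring (pv 0))) \<and> place_val (maxideal (nonneg_ring (pv 0))) rat_x < 0"
        using pl ratval_pv[of 0] pval[OF ratval_pv[of 0] x0] by (auto simp: pv_def rat_x_def vinf_rat)
    next
      fix P' assume *: "is_place rat_consts P' \<and> place_val P' (rat_x :: 'k poly fract) < 0"
      then obtain v where v: "ratval v" "P' = maxideal (nonneg_ring v)" using pl by blast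
      then have "v rat_x < 0" using * pval[OF v(1) x0] by simp
      then have "rat_x \<notin> nonneg_ring v" using x0 by (simp add: nonneg_ring_def)
      then show "P' = maxideal (nonneg_ring (pv 0))"
        using rat_place_infinite[OF ratval_valuation(1)[OF v(1)] rat_consts_subset_ratval[OF v(1)]] v(2) by (simp add: pv_def)
    qed
    then show ?thesis using True by simp
  next
    case False
    then have i: "i \<in> {1..r}" using i by auto
    note ri = ratval_pv[of i]
    show ?thesis unfolding P[OF i]
    proof (rule the_equality)
      have "pv i (rat_of_poly (p i)) = 1" using vp_self[OF p_irreducible[OF i]] i by (simp add: pv_def)
      then show "is_place rat_consts (maxideal (nonneg_ring (pv i))) \<and> place_val (maxideal (nonneg_ring (pv i))) (rat_of_poly (p i)) > 0"
        using pl ri pval[OF ri p_nz[OF i]] i by auto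
    next
      fix P' assume *: "is_place rat_consts P' \<and> place_val P' (rat_of_poly (p i)) > 0"
      then obtain v where v: "ratval v" "P' = maxideal (nonneg_ring v)" using pl by blast
      then have "v (rat_of_poly (p i)) > 0" using * pval[OF v(1) p_nz[OF i]] by simp
      then have "inverse (rat_of_poly (p i)) \<notin> nonneg_ring v"
        using p_nz[OF i] valuation_ofD(4)[OF ratval_valuation(2)[OF v(1)] p_nz[OF i]] by (simp add: nonneg_ring_def)
      then have "rat_of_poly (p i) \<in> maxideal (nonneg_ring v)" by (simp add: maxideal_iff[OF ratval_valuation(1)[OF v(1)]])
      then have "nonneg_ring v = nonneg_ring (vp (p i))"
        using rat_place_of_prime[OF ratval_valuation(1)[OF v(1)] rat_consts_subset_ratval[OF v(1)] p_irreducible[OF i]] by blast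
      then show "P' = maxideal (nonneg_ring (pv i))" using v(2) i by (simp add: pv_def)
    qed
  qed
qed

text \<open>Lying over only says that non-units go to non-units. Applied to
  \<open>inverse rat_x\<close> or to the polynomial \<open>p i\<close>, this already determines the
  place below by the classification, and \<open>Vr_unique\<close> does the rest.\<close>

lemma ramified_place:
  assumes i: "i \<le> r" "coprime (int m) (lam i)" and Pi: "P = maxideal (nonneg_ring (pv i))"
  shows "(THE Q'. is_place C Q' \<and> lies_over emb Q' P) = maxideal (Vr i)"
proof (rule the_equality)
  have "is_place C (maxideal (Vr i))" using Vr[OF i(1)] by (auto simp: is_place_iff)
  moreover have "emb c \<in> maxideal (Vr i)" if "c \<in> P" for c
    using that Vr(2)[OF i(1), of "inverse c"] unfolding Pi maxideal_iff[OF Vr(1)[OF i(1)]]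
      maxideal_iff[OF ratval_valuation(1)[OF ratval_pv[OF i(1)]]] by (auto simp: H)
  ultimately show "is_place C (maxideal (Vr i)) \<and> lies_over emb (maxideal (Vr i)) P"
    by (auto simp: lies_over_def)
next
  fix Q' assume Q': "is_place C Q' \<and> lies_over emb Q' P"
  then obtain V where V: "C \<subset> V" "valring V" "Q' = maxideal V" by (auto simp: is_place_iff)
  then obtain v where v: "ratval v" "\<And>c. emb c \<in> V \<longleftrightarrow> c \<in> nonneg_ring v" using place_lies_over[of V] by blast
  note nv = ratval_valuation(1)[OF v(1)] ratval_valuation(1)[OF ratval_pv[OF i(1)]]
  have sub: "c \<in> maxideal (nonneg_ring v)" if "c \<in> P" for c
  proof -
    have "emb c \<in> maxideal V" using Q' V(3) that by (auto simp: lies_over_def)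
    then show ?thesis using v(2)[of "inverse c"] by (simp add: maxideal_iff[OF V(2)] maxideal_iff[OF nv(1)] H)
  qed
  have "nonneg_ring v = nonneg_ring (pv i)"
  proof (rule valring_eqI[OF nv(1) nv(2)])
    show "maxideal (nonneg_ring (pv i)) \<subseteq> maxideal (nonneg_ring v)" using sub Pi by blast
    show "nonneg_ring (pv i) \<subseteq> nonneg_ring v"
    proof (cases "i = 0")
      case True
      have "pv i (inverse rat_x) = 1" using True valuation_ofD(4)[OF vinf_valuation(2), of rat_x]
        by (simp add: pv_def rat_x_def vinf_rat rat_of_poly_embedding)
      then have "inverse rat_x \<in> P" unfolding Pi maxideal_iff[OF nv(2)]
        using valuation_ofD(4)[OF ratval_valuation(2)[OF ratval_pv[OF i(1)]], of "inverse rat_x"]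
        by (cases "(rat_x :: 'k poly fract) = 0") (auto simp: nonneg_ring_def)
      then have "rat_x \<notin> nonneg_ring v" using sub[of "inverse rat_x"] 
        by (simp add: maxideal_iff[OF nv(1)] rat_x_def rat_of_poly_embedding)
      then show ?thesis
        using rat_place_infinite[OF nv(1) rat_consts_subset_ratval[OF v(1)]] True by (simp add: pv_def)
    next
      case False
      then have i': "i \<in> {1..r}" using i by auto
      have "pv i (rat_of_poly (p i)) = 1" using vp_self[OF p_irreducible[OF i']] i' by (simp add: pv_def)
      then have "rat_of_poly (p i) \<in> P" unfolding Pi maxideal_iff[OF nv(2)]
        using valuation_ofD(4)[OF ratval_valuation(2)[OF ratval_pv[OF i(1)]] p_nz[OF i']] p_nz[OF i']
        by (auto simp: nonneg_ring_def)
      then show ?thesis using sub rat_place_of_prime[OF nv(1) rat_consts_subset_ratval[OF v(1)] p_irreducible[OF i']] False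
        by (simp add: pv_def)
    qed
  qed
  then have "V = Vr i" using Vr_unique[OF i V(2)] v(2) by simp
  then show "Q' = maxideal (Vr i)" using V(3) by simp
qed

text \<open>Multiplying \<open>c\<close> by powers of the \<open>p i\<close> cancels its orders
  there and leaves no finite poles, so \<open>vinf_nonpos\<close> applies. It is an inequality
  because \<open>c\<close> may have zeros at further places.\<close>

lemma degree_formula:
  assumes c: "c \<noteq> 0" and pos: "\<And>q. irreducible q \<Longrightarrow> lead_coeff q = 1 \<Longrightarrow> q \<notin> p ` {1..r} \<Longrightarrow> 0 \<le> vp q c"
  shows "(\<Sum>k=0..r. pv k c * int (d k)) \<le> 0"
proof -
  let ?g = "\<Prod>k=1..r. rat_of_poly (p k) powi (- pv k c)"
  have g0: "?g \<noteq> 0" using p_nz by simp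
  have "0 \<le> vp q (c * ?g)" if q: "irreducible q" "lead_coeff q = 1" for q
  proof -
    have rq: "ratval (vp q)" using q by (auto simp: ratval_def)
    have e: "vp q (c * ?g) = vp q c + vp q ?g"
      by (rule valuation_ofD(1)[OF ratval_valuation(2)[OF rq] c g0])
    show ?thesis
    proof (cases "q \<in> p ` {1..r}")
      case True
      then obtain i where i: "i \<in> {1..r}" "q = p i" by blast
      then have "vp q = pv i" by (simp add: pv_def)
      then show ?thesis using e pv_prod_pos[OF i(1), of "\<lambda>k. - pv k c"] by simp
    next
      case False
      then show ?thesis using e pos[OF q] vp_prod_other[OF q False, of "\<lambda>k. - pv k c"] by simp
    qed
  qed
  then have "vinf (c * ?g) \<le> 0" using c g0 by (intro vinf_nonpos) auto
  moreover have "vinf (c * ?g) = vinf c + vinf ?g"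
    by (rule valuation_ofD(1)[OF vinf_valuation(2) c g0])
  moreover have "vinf ?g = (\<Sum>k=1..r. pv k c * int (d k))"
    using pv_prod_0[of "\<lambda>k. - pv k c"] by (simp add: pv_def sum_negf)
  moreover have "(\<Sum>k=0..r. pv k c * int (d k)) = vinf c + (\<Sum>k=1..r. pv k c * int (d k))"
    by (simp add: sum.atLeast_Suc_atMost d pv_def)
  ultimately show ?thesis by simp
qed

end

section \<open>Minimal generating sets\<close>

lemma field_embedding_to_ac: "field_embedding to_ac"
  by (simp add: field_embedding_def)

text \<open>\<open>- (- x div m)\<close> is the ceiling of x/m by floor division; this is its
  defining adjunction.\<close>

lemma ceiling_le_iff_mult:
  fixes x n :: int
  assumes "m > 0" shows "- (- x div int m) \<le> n \<longleftrightarrow> x \<le> int m * n"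
proof -
  have "- n \<le> - x div int m \<longleftrightarrow> - n * int m \<le> - x"
  proof
    assume "- n \<le> - x div int m"
    then have "- n * int m \<le> (- x div int m) * int m" by (intro mult_right_mono) auto
    also have "\<dots> \<le> - x" using pos_mod_sign[of "int m" "- x"] div_mult_mod_eq[of "- x" "int m"] assms by linarith
    finally show "- n * int m \<le> - x" .
  next
    assume "- n * int m \<le> - x"
    then have "(- n * int m) div int m \<le> - x div int m" using assms by (intro zdiv_mono1) auto
    moreover have "(- n * int m) div int m = - n" using assms by (intro nonzero_mult_div_cancel_right) simp
    ultimately show "- n \<le> - x div int m" by simp
  qed
  then show ?thesis by (auto simp: mult.commute)
qed

locale kummer_gamma = kummer m r \<alpha> p lam f emb y C d
  for m r \<alpha> p lam f and emb :: "'k::field poly fract \<Rightarrow> 'f::field" and y C d +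
  fixes z :: "nat \<Rightarrow> 'f" and l :: "nat \<Rightarrow> nat" and s :: nat and mu :: int
  assumes z: "z 0 = 1" "\<And>i. i \<in> {1..r} \<Longrightarrow> z i = emb (rat_of_poly (p i))"
    and l: "bij_betw l {0..r} {0..r}"
    and s: "1 \<le> s" "s \<le> r"
    and mu: "coprime (int m) mu"
    and deg_one: "\<And>k. k \<le> s \<Longrightarrow> d (l k) = 1"
    and gcd_one: "\<And>k. k \<le> s \<Longrightarrow> coprime (int m) (lam (l k))"
begin

lemma m0: "m > 0" using m by simp

lemma l_le: "k \<le> r \<Longrightarrow> l k \<le> r" "k \<le> s \<Longrightarrow> l k \<le> r"
  using l s by (auto simp: bij_betw_def)

lemma l_inj: "j \<le> r \<Longrightarrow> k \<le> r \<Longrightarrow> l j = l k \<Longrightarrow> j = k"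
  using l by (auto simp: bij_betw_def inj_on_def)

lemma l_surj: "i \<le> r \<Longrightarrow> \<exists>k\<le>r. i = l k"
  using l unfolding bij_betw_def by (metis atLeastAtMost_iff imageE le0)

definition Rs :: "'f set list" where
  "Rs = map (\<lambda>k. maxideal (Vr (l k))) [0..<s + 1]"

lemma Rs_nth: "k \<le> s \<Longrightarrow> Rs ! k = maxideal (Vr (l k))" and length_Rs: "length Rs = s + 1"
  by (simp_all add: Rs_def del: upt_Suc)

lemma Rs_inj: "j \<le> s \<Longrightarrow> k \<le> s \<Longrightarrow> maxideal (Vr (l j)) = maxideal (Vr (l k)) \<longleftrightarrow> j = k"
  using Vr_inj[of "l j" "l k"] l_le l_inj[of j k] s by auto

lemma divisor_sum_Rs: "k \<le> s \<Longrightarrow> divisor_sum ns Rs (maxideal (Vr (l k))) = ns ! k"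
proof -
  assume k: "k \<le> s"
  have "divisor_sum ns Rs (maxideal (Vr (l k))) = (\<Sum>j<s + 1. if j = k then ns ! j else 0)"
    unfolding divisor_sum_def length_Rs
  proof (rule sum.cong[OF refl])
    fix j assume "j \<in> {..<s + 1}"
    then have "j \<le> s" by simp
    then show "(if maxideal (Vr (l k)) = Rs ! j then ns ! j else 0) = (if j = k then ns ! j else 0)"
      using Rs_inj[OF k \<open>j \<le> s\<close>] Rs_nth by auto
  qed
  also have "\<dots> = ns ! k" using k by simp
  finally show ?thesis .
qed

lemma divisor_sum_other: "(\<And>k. k \<le> s \<Longrightarrow> R \<noteq> maxideal (Vr (l k))) \<Longrightarrow> divisor_sum ns Rs R = 0"
  unfolding divisor_sum_def length_Rs by (rule sum.neutral) (auto simp: Rs_nth)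

section \<open>Pole divisors supported on the chosen places\<close>

definition reg :: "'f \<Rightarrow> bool" where
  "reg a \<longleftrightarrow> (\<forall>V. valring V \<and> C \<subset> V \<and> (\<forall>k\<le>s. V \<noteq> Vr (l k)) \<longrightarrow> a \<in> V)"

text \<open>At a chosen place a zero contributes nothing, hence \<open>max 0\<close>; at any other
  place a vanishing coefficient means membership in the valuation ring.\<close>

lemma pole_divisor_iff:
  assumes a: "a \<noteq> 0"
  shows "pole_divisor C a = divisor_sum ns Rs \<longleftrightarrow> reg a \<and> (\<forall>k\<le>s. ns ! k = max 0 (- qv (l k) a))"
proof -
  have at: "pole_divisor C a (maxideal (Vr (l k))) = max 0 (- qv (l k) a)" if k: "k \<le> s" for k
  proof -
    have "is_place C (maxideal (Vr (l k)))" using Vr[OF l_le(2)[OF k]] by (auto simp: is_place_iff)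
    then show ?thesis using a place_val_qv[OF l_le(2)[OF k] gcd_one[OF k] a] by (auto simp: pole_divisor_def)
  qed
  have other: "pole_divisor C a (maxideal V) = 0 \<longleftrightarrow> a \<in> V" if V: "valring V" "C \<subset> V" for V
  proof -
    have "is_place C (maxideal V)" using V by (auto simp: is_place_iff)
    then show ?thesis using a place_val_neg_iff[OF V(1) _ a] V(2) by (auto simp: pole_divisor_def)
  qed
  show ?thesis
  proof
    assume e: "pole_divisor C a = divisor_sum ns Rs"
    have "reg a" unfolding reg_def
    proof (intro allI impI)
      fix V assume V: "valring V \<and> C \<subset> V \<and> (\<forall>k\<le>s. V \<noteq> Vr (l k))"
      have "maxideal V \<noteq> maxideal (Vr (l k))" if "k \<le> s" for k
        using V that place_ring_maxideal[of V] place_ring_maxideal[OF Vr(1)[OF l_le(2)[OF that]]] by metis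
      then have "divisor_sum ns Rs (maxideal V) = 0" by (rule divisor_sum_other)
      then show "a \<in> V" using other[of V] V e by simp
    qed
    then show "reg a \<and> (\<forall>k\<le>s. ns ! k = max 0 (- qv (l k) a))"
      using at divisor_sum_Rs e by metis
  next
    assume *: "reg a \<and> (\<forall>k\<le>s. ns ! k = max 0 (- qv (l k) a))"
    show "pole_divisor C a = divisor_sum ns Rs"
    proof
      fix R
      show "pole_divisor C a R = divisor_sum ns Rs R"
      proof (cases "\<exists>k\<le>s. R = maxideal (Vr (l k))")
        case True
        then show ?thesis using at divisor_sum_Rs * by auto
      next
        case False
        then have ds: "divisor_sum ns Rs R = 0" by (intro divisor_sum_other) auto
        show ?thesis
        proof (cases "is_place C R")
          case True
          then obtain V where V: "C \<subset> V" "valring V" "R = maxideal V" by (auto simp: is_place_iff)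
          then have "a \<in> V" using * False by (auto simp: reg_def)
          then show ?thesis using other V ds by auto
        qed (use ds in \<open>simp add: pole_divisor_def\<close>)
      qed
    qed
  qed
qed

lemma semigroup_iff:
  "ns \<in> weierstrass_semigroup C Rs \<longleftrightarrow> length ns = s + 1 \<and>
     (\<exists>a. a \<noteq> 0 \<and> reg a \<and> (\<forall>k\<le>s. int (ns ! k) = max 0 (- qv (l k) a)))"
proof -
  \<comment> \<open>The zero function has pole divisor 0 by convention. The constant 1 realizes the
    same divisor, so only nonzero functions need to be considered.\<close>
  have z1: "pole_divisor C 0 = pole_divisor C 1"
  proof -
    have "reg 1" unfolding reg_def using subringD(1)[OF valring_subring] by blast
    moreover have "qv (l k) 1 = 0" if "k \<le> s" for k using valuation_ofD(3)[OF qv(1)[OF l_le(2) gcd_one]] that by blast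
    ultimately have "pole_divisor C 1 = divisor_sum (replicate (s + 1) 0) Rs"
      using pole_divisor_iff[of 1 "replicate (s + 1) 0"] by (simp add: nth_replicate del: replicate_Suc)
    moreover have "divisor_sum (replicate (s + 1) 0) Rs = (\<lambda>R. 0)"
      unfolding divisor_sum_def length_Rs by (intro ext sum.neutral) (auto simp del: replicate_Suc)
    ultimately show ?thesis by (simp add: pole_divisor_def)
  qed
  have "(\<exists>a. pole_divisor C a = D) \<longleftrightarrow> (\<exists>a. a \<noteq> 0 \<and> pole_divisor C a = D)" for D
    using z1 by (metis zero_neq_one)
  then show ?thesis
    unfolding weierstrass_semigroup_def mem_Collect_eq length_Rs using pole_divisor_iff[of _ "map int ns"]
    by auto
qed

section \<open>Single terms with prescribed orders\<close>

text \<open>The ceiling of \<open>i * mu * lam k / m\<close>: the least order at the place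
  \<open>k\<close> of a coefficient \<open>g\<close> for which g times
  \<open>y powi (- (i * mu))\<close> has no pole above it.\<close>

definition N :: "int \<Rightarrow> nat \<Rightarrow> int" where "N i k = - ((- (i * mu * lam k)) div int m)"

text \<open>The degree taken up by the least admissible orders at the remaining indices; by
  \<open>sum_N_eq\<close> it is the right side of the sum condition in the theorem.\<close>

definition T :: "int \<Rightarrow> int" where "T i = (\<Sum>k=s+1..r. N i (l k) * int (d (l k)))"

definition elt :: "int \<Rightarrow> (nat \<Rightarrow> int) \<Rightarrow> 'f" where
  "elt i j = (\<Prod>k=s+1..r. z (l k) powi N i (l k)) / (y powi (i * mu) * (\<Prod>k=0..s. z (l k) powi j k))"

lemma N_le_iff: "N i k \<le> n \<longleftrightarrow> 0 \<le> int m * n - i * mu * lam k"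
  using ceiling_le_iff_mult[OF m0, of "i * mu * lam k" n] by (simp add: N_def)

lemma split_sum: "(\<Sum>k=0..r. g k) = (\<Sum>k=0..s. g k) + (\<Sum>k=s+1..r. g k)" for g :: "nat \<Rightarrow> 'x::comm_monoid_add"
proof -
  have "{0..r} = {0..s} \<union> {s+1..r}" using s by auto
  then show ?thesis by (simp add: sum.union_disjoint)
qed

lemma split_prod: "(\<Prod>k=0..r. g k) = (\<Prod>k=0..s. g k) * (\<Prod>k=s+1..r. g k)" for g :: "nat \<Rightarrow> 'x::comm_monoid_mult"
proof -
  have "{0..r} = {0..s} \<union> {s+1..r}" using s by auto
  then show ?thesis by (simp add: prod.union_disjoint)
qed

lemma ratval_cases:
  assumes "ratval v"
  shows "(\<exists>k\<le>r. v = pv (l k)) \<or> (\<exists>q. irreducible q \<and> lead_coeff q = 1 \<and> q \<notin> p ` {1..r} \<and> v = vp q)"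
proof -
  have "(\<exists>i\<le>r. v = pv i) \<or> (\<exists>q. irreducible q \<and> lead_coeff q = 1 \<and> q \<notin> p ` {1..r} \<and> v = vp q)"
  proof (cases "v = vinf")
    case True
    then show ?thesis by (intro disjI1 exI[of _ 0]) (simp add: pv_def)
  next
    case False
    then obtain q where q: "irreducible q" "lead_coeff q = 1" "v = vp q" using assms by (auto simp: ratval_def)
    show ?thesis
    proof (cases "q \<in> p ` {1..r}")
      case True
      then obtain i where "i \<in> {1..r}" "q = p i" by blast
      then show ?thesis using q by (intro disjI1 exI[of _ i]) (simp add: pv_def)
    qed (use q in blast)
  qed
  then show ?thesis using l_surj by metis
qed

text \<open>The sum condition says that the prescribed orders have total degree 0. The place at
  infinity contributes no factor, as \<open>z 0 = 1\<close>, and its order comes out as prescribed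
  exactly because of this.\<close>

lemma elt_repr:
  assumes j: "(\<Sum>k=0..s. j k) = T i"
  shows "\<exists>c. c \<noteq> 0 \<and> elt i j = emb c * y powi (- (i * mu)) \<and> (\<forall>k\<le>s. pv (l k) c = - j k) \<and>
    (\<forall>k\<in>{s+1..r}. pv (l k) c = N i (l k)) \<and>
    (\<forall>q. irreducible q \<and> lead_coeff q = 1 \<and> q \<notin> p ` {1..r} \<longrightarrow> vp q c = 0)"
proof -
  define e' where "e' k = (if k \<le> s then - j k else N i (l k))" for k
  define e where "e x = e' (inv_into {0..r} l x)" for x
  have el: "e (l k) = e' k" if "k \<le> r" for k
    using that l by (simp add: e_def bij_betw_def inv_into_f_f)
  define c where "c = (\<Prod>k=1..r. rat_of_poly (p k) powi e k)"
  have c0: "c \<noteq> 0" unfolding c_def using p_nz by simp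
  have "(\<Sum>k=0..r. e k * int (d k)) = (\<Sum>k=0..r. e (l k) * int (d (l k)))"
    by (rule sum.reindex_bij_betw[OF l, symmetric])
  also have "\<dots> = (\<Sum>k=0..s. e (l k) * int (d (l k))) + (\<Sum>k=s+1..r. e (l k) * int (d (l k)))"
    by (rule split_sum)
  also have "(\<Sum>k=0..s. e (l k) * int (d (l k))) = (\<Sum>k=0..s. - j k)"
    using s by (intro sum.cong) (auto simp: el e'_def deg_one)
  also have "(\<Sum>k=s+1..r. e (l k) * int (d (l k))) = T i"
    unfolding T_def by (intro sum.cong) (auto simp: el e'_def)
  finally have "(\<Sum>k=0..r. e k * int (d k)) = 0" using j by (simp add: sum_negf)
  then have e0: "e 0 = - (\<Sum>k=1..r. e k * int (d k))" by (simp add: sum.atLeast_Suc_atMost d)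
  have pvc: "pv x c = e x" if "x \<le> r" for x
    using that pv_prod_pos[of x e] pv_prod_0[of e] e0 by (cases "x = 0") (auto simp: c_def)
  have zn: "z x \<noteq> 0" if "x \<le> r" for x using that z p_nz by (cases "x = 0") (auto simp: H)
  have "emb c = (\<Prod>k=1..r. z k powi e k)"
    unfolding c_def field_embedding_prod[OF emb] by (intro prod.cong) (auto simp: H z)
  also have "\<dots> = (\<Prod>k=0..r. z k powi e k)" by (simp add: prod.atLeast_Suc_atMost z)
  also have "\<dots> = (\<Prod>k=0..r. z (l k) powi e (l k))"
    by (rule prod.reindex_bij_betw[OF l, symmetric])
  also have "\<dots> = (\<Prod>k=0..s. z (l k) powi e (l k)) * (\<Prod>k=s+1..r. z (l k) powi e (l k))"
    by (rule split_prod)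
  also have "(\<Prod>k=0..s. z (l k) powi e (l k)) = (\<Prod>k=0..s. inverse (z (l k) powi j k))"
    using s by (intro prod.cong) (auto simp: el e'_def power_int_minus)
  also have "(\<Prod>k=s+1..r. z (l k) powi e (l k)) = (\<Prod>k=s+1..r. z (l k) powi N i (l k))"
    by (intro prod.cong) (auto simp: el e'_def)
  finally have "elt i j = emb c * y powi (- (i * mu))"
    using prod_inversef[of "\<lambda>k. z (l k) powi j k" "{0..s}"]
    by (simp add: elt_def comp_def power_int_minus divide_inverse)
  moreover have "\<forall>q. irreducible q \<and> lead_coeff q = 1 \<and> q \<notin> p ` {1..r} \<longrightarrow> vp q c = 0"
    unfolding c_def using vp_prod_other by blast
  moreover have "\<forall>k\<le>s. pv (l k) c = - j k" using pvc l_le s by (auto simp: el e'_def)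
  moreover have "\<forall>k\<in>{s+1..r}. pv (l k) c = N i (l k)" using pvc l_le by (auto simp: el e'_def)
  ultimately show ?thesis using c0 by blast
qed

text \<open>The m-th power of a term lies in K(x), so regularity is tested on orders there. A ring
  other than the chosen ones cannot lie above a chosen place, since these are totally
  ramified.\<close>

lemma term_reg:
  assumes c: "c \<noteq> 0"
    and pos: "\<And>v. ratval v \<Longrightarrow> (\<And>k. k \<le> s \<Longrightarrow> v \<noteq> pv (l k)) \<Longrightarrow> 0 \<le> int m * v c + n * v f"
  shows "reg (emb c * y powi n)"
  unfolding reg_def
proof (intro allI impI)
  fix V assume V: "valring V \<and> C \<subset> V \<and> (\<forall>k\<le>s. V \<noteq> Vr (l k))"
  then obtain v where v: "ratval v" "\<And>c. emb c \<in> V \<longleftrightarrow> c \<in> nonneg_ring v" using place_lies_over[of V] by blast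
  note D = valuation_ofD[OF ratval_valuation(2)[OF v(1)]]
  have "v \<noteq> pv (l k)" if k: "k \<le> s" for k
    using Vr_unique[OF l_le(2)[OF k] gcd_one[OF k], of V] V v k by metis
  then have "0 \<le> v (c ^ m * f powi n)" using pos[OF v(1)] c f0 by (simp add: D)
  then have "emb (c ^ m * f powi n) \<in> V" using v(2) by (simp add: nonneg_ring_def)
  moreover have "emb (c ^ m * f powi n) = (emb c * y powi n) ^ m"
    by (simp add: H power_mult_distrib y[symmetric] power_int_power power_int_power' mult.commute)
  ultimately show "emb c * y powi n \<in> V" using V valring_power_mem[of V m] m0 by metis
qed

lemma elt_props:
  assumes j: "(\<Sum>k=0..s. j k) = T i"
  shows "elt i j \<noteq> 0" "reg (elt i j)" "k \<le> s \<Longrightarrow> qv (l k) (elt i j) = - (int m * j k + i * mu * lam (l k))"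
proof -
  obtain c where c: "c \<noteq> 0" "elt i j = emb c * y powi (- (i * mu))" "\<And>k. k \<le> s \<Longrightarrow> pv (l k) c = - j k"
    "\<And>k. k \<in> {s+1..r} \<Longrightarrow> pv (l k) c = N i (l k)"
    "\<And>q. irreducible q \<Longrightarrow> lead_coeff q = 1 \<Longrightarrow> q \<notin> p ` {1..r} \<Longrightarrow> vp q c = 0" using elt_repr[OF j] by blast
  show "elt i j \<noteq> 0" using c y0 by (simp add: H)
  show "qv (l k) (elt i j) = - (int m * j k + i * mu * lam (l k))" if k: "k \<le> s"
    unfolding c(2) using qv_term[OF l_le(2)[OF k] gcd_one[OF k] c(1), of "- (i * mu)"] c(3)[OF k] by simp
  show "reg (elt i j)" unfolding c(2)
  proof (rule term_reg[OF c(1)])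
    fix v assume v: "ratval v" "\<And>k. k \<le> s \<Longrightarrow> v \<noteq> pv (l k)"
    from ratval_cases[OF v(1)] show "0 \<le> int m * v c + - (i * mu) * v f"
    proof
      assume "\<exists>k\<le>r. v = pv (l k)"
      then obtain k where k: "k \<le> r" "v = pv (l k)" by blast
      then have "k \<in> {s+1..r}" using v(2)[of k] by (cases "k \<le> s") auto
      then have "v c = N i (l k)" "v f = lam (l k)" using c(4) k pv_f[OF l_le(1)[OF k(1)]] by auto
      then show ?thesis using N_le_iff[of i "l k" "v c"] by simp
    next
      assume "\<exists>q. irreducible q \<and> lead_coeff q = 1 \<and> q \<notin> p ` {1..r} \<and> v = vp q"
      then show ?thesis using c(5) vp_f_other by auto
    qed
  qed
qed

lemma of_nat_vunit: 
  fixes v :: "'k poly fract \<Rightarrow> int"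
  assumes "ratval v" shows "vunit (nonneg_ring v) (of_nat m)"
proof -
  have "(of_nat m :: 'k poly fract) = rat_of_poly [:of_nat m:]"
    by (simp add: of_nat_fract rat_of_poly_def of_nat_poly)
  then show ?thesis using ratval_const[OF assms m_char] valuation_ofD(8)[OF ratval_valuation(2)[OF assms]] m_char
    by (simp add: rat_of_poly_embedding)
qed

text \<open>The term that dominates at \<open>k0\<close> bounds \<open>qv\<close> from above at all
  chosen places at once, and its coefficient inherits the order bounds elsewhere from
  \<open>term_integral\<close>. So one coefficient \<open>c\<close> controls the whole
  tuple.\<close>

lemma reg_dominant_term:
  assumes a: "a \<noteq> 0" "reg a" and k0: "k0 \<le> s"
  shows "\<exists>i c. 0 \<le> i \<and> i < int m \<and> c \<noteq> 0 \<and> (\<forall>k\<in>{s+1..r}. N i (l k) \<le> pv (l k) c) \<and>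
    (\<forall>q. irreducible q \<and> lead_coeff q = 1 \<and> q \<notin> p ` {1..r} \<longrightarrow> 0 \<le> vp q c) \<and>
    qv (l k0) a = int m * pv (l k0) c - i * mu * lam (l k0) \<and>
    (\<forall>k\<le>s. qv (l k) a \<le> int m * pv (l k) c - i * mu * lam (l k))"
proof -
  obtain b where b: "a = (\<Sum>i<m. emb (b i) * y ^ i)" using expansion by blast
  have ex: "\<exists>i<m. b i \<noteq> 0"
  proof (rule ccontr)
    assume "\<not> ?thesis"
    then have "a = 0" unfolding b by (intro sum.neutral) (auto simp: H)
    then show False using a by simp
  qed
  \<comment> \<open>A single totally ramified place gives independence: a sum with some nonzero
    coefficient is nonzero.\<close>
  have indep: "\<forall>i<m. c i = 0" if "(\<Sum>i<m. emb (c i) * y ^ i) = 0" for c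
    using qv(3)[OF l_le(2)[OF k0] gcd_one[OF k0], of c] that by blast
  obtain n where n: "n < m" "b n \<noteq> 0" "qv (l k0) a = qv (l k0) (emb (b n) * y ^ n)"
    using qv(3)[OF l_le(2)[OF k0] gcd_one[OF k0] ex] b by metis
  have le: "qv (l k) a \<le> int m * pv (l k) (b n) + int n * lam (l k)" if k: "k \<le> s" for k
    using qv(3)[OF l_le(2)[OF k] gcd_one[OF k] ex] b n qv(2)[OF l_le(2)[OF k] gcd_one[OF k] n(2), of n] by metis
  have eq: "qv (l k0) a = int m * pv (l k0) (b n) + int n * lam (l k0)"
    using n qv(2)[OF l_le(2)[OF k0] gcd_one[OF k0] n(2), of n] by simp
  have int: "0 \<le> int m * v (b n) + int n * v f" if v: "ratval v" "\<And>k. k \<le> s \<Longrightarrow> v \<noteq> pv (l k)" for v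
  proof -
    obtain t where t: "t \<noteq> 0" "v t = 1" using ratval_uniformizer[OF v(1)] by blast
    show ?thesis
    proof (rule term_integral[OF indep field_embedding_to_ac ratval_valuation[OF v(1)] t of_nat_vunit[OF v(1)] _ b n(1,2)])
      fix V assume V: "valring V" "\<And>c. emb c \<in> V \<longleftrightarrow> c \<in> nonneg_ring v"
      have "V \<noteq> Vr (l k)" if k: "k \<le> s" for k
      proof
        assume "V = Vr (l k)"
        then have "nonneg_ring v = nonneg_ring (pv (l k))" using V(2) Vr(2)[OF l_le(2)[OF k]] by blast
        then show False using ratval_eqI[OF v(1) ratval_pv[OF l_le(2)[OF k]]] v(2)[OF k] by blast
      qed
      then show "a \<in> V" using a(2) V C_subset[OF V(2) v(1)] unfolding reg_def by blast
    qed auto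
  qed
  \<comment> \<open>The terms carry \<open>y ^ n\<close>, the tuples
    \<open>y powi (- (i * mu))\<close>. With \<open>u\<close> inverse to \<open>mu\<close> modulo m,
    the residue \<open>i\<close> of \<open>- n * u\<close> makes \<open>i * mu + n\<close> a
    multiple \<open>m * w\<close>, and the coefficient absorbs \<open>f powi w\<close>.\<close>
  obtain u w0 where uw: "w0 * int m + u * mu = 1" using mu by (metis bezout_int coprime_imp_gcd_eq_1)
  define i where "i = (- int n * u) mod int m"
  have i: "0 \<le> i" "i < int m" using m0 by (auto simp: i_def)
  have "[i * mu = - int n * u * mu] (mod (int m))" unfolding i_def by (simp add: cong_def mod_mult_left_eq)
  then have "int m dvd i * mu - - int n * u * mu" by (simp only: cong_iff_dvd_diff)
  then have "int m dvd (i * mu - - int n * u * mu) + int m * (int n * w0)" by (rule dvd_add) simp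
  also have "(i * mu - - int n * u * mu) + int m * (int n * w0) = i * mu + int n * (w0 * int m + u * mu)"
    by (simp add: algebra_simps)
  finally have "int m dvd i * mu + int n" by (simp add: uw)
  then obtain w where w: "i * mu + int n = int m * w" by blast
  define c where "c = b n * f powi w"
  have c0: "c \<noteq> 0" using n f0 by (simp add: c_def)
  have vc: "int m * v c - i * mu * v f = int m * v (b n) + int n * v f" if v: "ratval v" for v
  proof -
    note D = valuation_ofD[OF ratval_valuation(2)[OF v]]
    have "int m * v c = int m * v (b n) + (int m * w) * v f" using n(2) f0 by (simp add: c_def D algebra_simps)
    then show ?thesis unfolding w[symmetric] by (simp add: algebra_simps)
  qed
  have vs: "int m * pv (l k) c - i * mu * lam (l k) = int m * pv (l k) (b n) + int n * lam (l k)" if "k \<le> r" for k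
    using vc[OF ratval_pv[OF l_le(1)[OF that]]] pv_f[OF l_le(1)[OF that]] by simp
  have "N i (l k) \<le> pv (l k) c" if k: "k \<in> {s+1..r}" for k
  proof -
    have "pv (l k) \<noteq> pv (l k')" if "k' \<le> s" for k'
      using pv_inj[of "l k" "l k'"] l_le l_inj[of k k'] k that s by auto
    then have "0 \<le> int m * pv (l k) (b n) + int n * pv (l k) f" using k by (intro int ratval_pv l_le) auto
    then show ?thesis unfolding N_le_iff using vs[of k] k pv_f[OF l_le(1), of k] by simp
  qed
  moreover have "0 \<le> vp q c" if q: "irreducible q" "lead_coeff q = 1" "q \<notin> p ` {1..r}" for q
  proof -
    have rq: "ratval (vp q)" using q by (auto simp: ratval_def)
    have "vp q \<noteq> pv (l k)" if k: "k \<le> s" for k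
    proof
      assume "vp q = pv (l k)"
      moreover have "vp q (rat_of_poly q) = 1" by (rule vp_self[OF q(1)])
      moreover have "pv (l k) (rat_of_poly q) \<le> 0"
      proof (cases "l k = 0")
        case True
        have "q \<noteq> 0" using q by auto
        then show ?thesis using True by (simp add: pv_def vinf_rat)
      next
        case False
        then have lk: "l k \<in> {1..r}" using l_le(2)[OF k] by simp
        then have "p (l k) \<noteq> q" using q(3) by blast
        then show ?thesis using vp_other[OF p_irreducible[OF lk] q(1) p_monic[OF lk] q(2)] False by (simp add: pv_def)
      qed
      ultimately show False by simp
    qed
    then have "0 \<le> int m * vp q (b n) + int n * vp q f" by (intro int rq) auto
    moreover have "int m * vp q c = int m * vp q (b n)" using vc[OF rq] vp_f_other[OF q] by simp
    ultimately have "0 \<le> int m * vp q c" using vp_f_other[OF q] by (simp only: mult_zero_right add_0_right)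
    then show ?thesis using m0 by (simp add: zero_le_mult_iff)
  qed
  ultimately show ?thesis using i c0 eq le vs s k0 by (intro exI[of _ i] exI[of _ c]) auto
qed

text \<open>Chosen places have degree 1 and all other orders are bounded below, so the degree
  formula allows the orders at the chosen places a sum of at most \<open>- T i\<close>.\<close>

lemma degree_bound:
  assumes c: "c \<noteq> 0" and N: "\<forall>k\<in>{s+1..r}. N i (l k) \<le> pv (l k) c"
    and pos: "\<forall>q. irreducible q \<and> lead_coeff q = 1 \<and> q \<notin> p ` {1..r} \<longrightarrow> 0 \<le> vp q c"
  shows "T i \<le> (\<Sum>k=0..s. - pv (l k) c)"
proof -
  have "(\<Sum>k=0..r. pv k c * int (d k)) \<le> 0" using pos by (intro degree_formula[OF c]) blast
  also have "(\<Sum>k=0..r. pv k c * int (d k)) = (\<Sum>k=0..r. pv (l k) c * int (d (l k)))"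
    by (rule sum.reindex_bij_betw[OF l, symmetric])
  also have "\<dots> = (\<Sum>k=0..s. pv (l k) c * int (d (l k))) + (\<Sum>k=s+1..r. pv (l k) c * int (d (l k)))"
    by (rule split_sum)
  also have "(\<Sum>k=0..s. pv (l k) c * int (d (l k))) = (\<Sum>k=0..s. pv (l k) c)"
    by (intro sum.cong) (auto simp: deg_one)
  finally have "(\<Sum>k=0..s. pv (l k) c) + (\<Sum>k=s+1..r. pv (l k) c * int (d (l k))) \<le> 0" .
  moreover have "T i \<le> (\<Sum>k=s+1..r. pv (l k) c * int (d (l k)))"
    unfolding T_def using N by (intro sum_mono mult_right_mono) auto
  ultimately show ?thesis by (simp add: sum_negf)
qed

section \<open>The minimal generating set\<close>

text \<open>A tuple on the right is already minimal for coordinate 0: a competitor has the same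
  \<open>i\<close>, and then the attained degree bound leaves no room. Conversely, a minimal tuple
  lies above the tuple of a single term and shares with it the coordinate that is held
  fixed.\<close>

theorem min_gen_set_eq:
  "min_gen_set C Rs = {a. length a = s + 1 \<and> (\<forall>n\<in>set a. 1 \<le> n) \<and>
     (\<exists>i j. (\<forall>k\<le>s. int (a ! k) = int m * j k + i * mu * lam (l k)) \<and>
        1 \<le> i \<and> i \<le> int m - 1 \<and> (\<Sum>k=0..s. j k) = T i)}" (is "_ = ?G")
proof (intro equalityI subsetI)
  fix a assume "a \<in> ?G"
  then obtain i j where len: "length a = s + 1" and pos: "\<forall>n\<in>set a. 1 \<le> n"
    and aj: "\<And>k. k \<le> s \<Longrightarrow> int (a ! k) = int m * j k + i * mu * lam (l k)"
    and i: "1 \<le> i" "i \<le> int m - 1" and j: "(\<Sum>k=0..s. j k) = T i" by blast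
  have pos': "1 \<le> a ! k" if "k \<le> s" for k using pos len that by simp
  have "int (a ! k) = max 0 (- qv (l k) (elt i j))" if "k \<le> s" for k
    using elt_props(3)[OF j that] aj[OF that] of_nat_0_le_iff[of "a ! k"] by simp
  then have aH: "a \<in> weierstrass_semigroup C Rs" unfolding semigroup_iff
    using len elt_props(1,2)[OF j] by blast
  have "minimal_tuple {ns \<in> weierstrass_semigroup C Rs. ns ! 0 = a ! 0} a" unfolding minimal_tuple_def
  proof (intro conjI ballI notI)
    show "a \<in> {ns \<in> weierstrass_semigroup C Rs. ns ! 0 = a ! 0}" using aH by simp
    fix n assume n: "n \<in> {ns \<in> weierstrass_semigroup C Rs. ns ! 0 = a ! 0} - {a}" and le: "list_all2 (\<le>) n a"
    then obtain g where g: "g \<noteq> 0" "reg g" "\<And>k. k \<le> s \<Longrightarrow> int (n ! k) = max 0 (- qv (l k) g)"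
      and n0: "n ! 0 = a ! 0" "length n = s + 1" unfolding semigroup_iff by blast
    have nle: "n ! k \<le> a ! k" if "k \<le> s" for k using le that n0(2) by (auto simp: list_all2_conv_all_nth)
    obtain i' c where c: "0 \<le> i'" "i' < int m" "c \<noteq> 0" "\<forall>k\<in>{s+1..r}. N i' (l k) \<le> pv (l k) c"
      "\<forall>q. irreducible q \<and> lead_coeff q = 1 \<and> q \<notin> p ` {1..r} \<longrightarrow> 0 \<le> vp q c"
      "qv (l 0) g = int m * pv (l 0) c - i' * mu * lam (l 0)"
      "\<And>k. k \<le> s \<Longrightarrow> qv (l k) g \<le> int m * pv (l k) c - i' * mu * lam (l k)"
      using reg_dominant_term[OF g(1,2), of 0] by auto
    have "int (a ! 0) = - qv (l 0) g" using g(3)[of 0] n0 pos'[of 0] by simp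
    \<comment> \<open>Equal entries at coordinate 0 determine \<open>i\<close> modulo m, because
      \<open>mu * lam (l 0)\<close> is prime to m.\<close>
    then have "int m * (j 0 + pv (l 0) c) = (i' - i) * (mu * lam (l 0))" using aj[of 0] c(6) by (simp add: algebra_simps)
    then have "int m dvd (i' - i) * (mu * lam (l 0))" by (metis dvd_triv_left)
    moreover have "coprime (int m) (mu * lam (l 0))" using mu gcd_one[of 0] by simp
    ultimately have "int m dvd i' - i" using coprime_dvd_mult_left_iff by blast
    then have "i' mod int m = i mod int m" by (simp add: mod_eq_dvd_iff)
    then have ii: "i' = i" using c(1,2) i by simp
    have jle: "- pv (l k) c \<le> j k" if k: "k \<le> s" for k
    proof -
      have "- qv (l k) g \<le> int (a ! k)" using g(3)[OF k] nle[OF k] by simp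
      then have "int m * (- pv (l k) c) \<le> int m * j k" using aj[OF k] c(7)[OF k] ii by (simp add: algebra_simps)
      then show ?thesis using m0 by (simp only: mult_le_cancel_left_pos of_nat_0_less_iff)
    qed
    \<comment> \<open>The sum of the \<open>j k\<close> is the least possible one, while each
      \<open>- pv (l k) c\<close> is at most \<open>j k\<close>; so all of them agree.\<close>
    have "(\<Sum>k=0..s. j k) \<le> (\<Sum>k=0..s. - pv (l k) c)" using degree_bound[OF c(3,4,5)] j ii by simp
    then have "(\<Sum>k=0..s. j k - - pv (l k) c) \<le> 0" by (simp only: sum_subtractf)
    moreover have "(\<Sum>k=0..s. j k - - pv (l k) c) \<ge> 0" by (rule sum_nonneg) (simp only: diff_ge_0_iff_ge jle atLeastAtMost_iff)
    ultimately have "(\<Sum>k=0..s. j k - - pv (l k) c) = 0" by simp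
    then have je: "j k = - pv (l k) c" if "k \<le> s" for k
    proof -
      have "\<forall>k\<in>{0..s}. j k - - pv (l k) c = 0"
        by (subst sum_nonneg_eq_0_iff[symmetric])
          (simp_all only: diff_ge_0_iff_ge jle atLeastAtMost_iff finite_atLeastAtMost \<open>(\<Sum>k=0..s. j k - - pv (l k) c) = 0\<close>)
      then show ?thesis using that by (auto simp: eq_neg_iff_add_eq_0)
    qed
    have "n ! k = a ! k" if k: "k \<le> s" for k
    proof -
      have "qv (l k) g \<le> - int (a ! k)" using c(7)[OF k] aj[OF k] je[OF k] ii by simp
      then show ?thesis using g(3)[OF k] nle[OF k] by simp
    qed
    then have "n = a" using n0 len by (intro nth_equalityI) auto
    then show False using n by blast
  qed
  then show "a \<in> min_gen_set C Rs" unfolding min_gen_set_def length_Rs using len pos s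
    by (intro CollectI conjI exI[of _ 0]) auto
next
  fix a assume "a \<in> min_gen_set C Rs"
  then obtain k0 where len: "length a = s + 1" and pos: "\<forall>n\<in>set a. 1 \<le> n" and k0: "k0 \<le> s"
    and aH: "a \<in> weierstrass_semigroup C Rs"
    and min': "\<forall>b \<in> {ns \<in> weierstrass_semigroup C Rs. ns ! k0 = a ! k0} - {a}. \<not> list_all2 (\<le>) b a"
    unfolding min_gen_set_def minimal_tuple_def length_Rs by (auto simp: less_Suc_eq_le)
  have min: "n = a" if "n \<in> weierstrass_semigroup C Rs" "n ! k0 = a ! k0" "list_all2 (\<le>) n a" for n
    using min' that by blast
  have pos': "1 \<le> a ! k" if "k \<le> s" for k using pos len that by simp
  obtain g where g: "g \<noteq> 0" "reg g" "\<And>k. k \<le> s \<Longrightarrow> int (a ! k) = max 0 (- qv (l k) g)"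
    using aH unfolding semigroup_iff by blast
  have gq: "int (a ! k) = - qv (l k) g" if "k \<le> s" for k using g(3)[OF that] pos'[OF that] by simp
  obtain i c where c: "0 \<le> i" "i < int m" "c \<noteq> 0" "\<forall>k\<in>{s+1..r}. N i (l k) \<le> pv (l k) c"
      "\<forall>q. irreducible q \<and> lead_coeff q = 1 \<and> q \<notin> p ` {1..r} \<longrightarrow> 0 \<le> vp q c"
      "qv (l k0) g = int m * pv (l k0) c - i * mu * lam (l k0)"
      "\<And>k. k \<le> s \<Longrightarrow> qv (l k) g \<le> int m * pv (l k) c - i * mu * lam (l k)"
    using reg_dominant_term[OF g(1,2) k0] by auto
  \<comment> \<open>A coordinate different from \<open>k0\<close> exists because
    \<open>1 \<le> s\<close>. There the excess of the sum over \<open>T i\<close> is removed without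
    changing the entry at \<open>k0\<close>.\<close>
  obtain k1 where k1: "k1 \<le> s" "k1 \<noteq> k0" using s by (cases "k0 = 0") auto
  define j where "j k = - pv (l k) c" for k
  define j' where "j' = j(k1 := T i - (\<Sum>k\<in>{0..s} - {k1}. j k))"
  have sj': "(\<Sum>k=0..s. j' k) = T i"
  proof -
    have "(\<Sum>k=0..s. j' k) = j' k1 + (\<Sum>k\<in>{0..s} - {k1}. j' k)" using k1 by (intro sum.remove) auto
    also have "(\<Sum>k\<in>{0..s} - {k1}. j' k) = (\<Sum>k\<in>{0..s} - {k1}. j k)" by (intro sum.cong) (auto simp: j'_def)
    finally show ?thesis by (simp add: j'_def)
  qed
  have sj: "(\<Sum>k=0..s. j k) = j k1 + (\<Sum>k\<in>{0..s} - {k1}. j k)" using k1 by (intro sum.remove) auto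
  have Tj: "T i \<le> (\<Sum>k=0..s. j k)" unfolding j_def by (rule degree_bound[OF c(3,4,5)])
  have j'le: "j' k \<le> j k" for k using Tj sj by (simp add: j'_def)
  have jle: "int m * j k + i * mu * lam (l k) \<le> int (a ! k)" if "k \<le> s" for k
    using c(7)[OF that] gq[OF that] by (simp add: j_def)
  have j'a: "int m * j' k + i * mu * lam (l k) \<le> int (a ! k)" if "k \<le> s" for k
    using jle[OF that] mult_left_mono[OF j'le[of k], of "int m"] by simp
  have jk0: "int m * j' k0 + i * mu * lam (l k0) = int (a ! k0)"
    using c(6) gq[OF k0] k1(2) by (simp add: j'_def j_def)
  \<comment> \<open>The lowered entry at \<open>k1\<close> may be negative, meaning a zero of the
    term; \<open>nat\<close> then records 0, as \<open>max 0\<close> does in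
    \<open>semigroup_iff\<close>. Minimality will identify \<open>n\<close> with \<open>a\<close>
    and rule this out.\<close>
  define n where "n = map (\<lambda>k. nat (int m * j' k + i * mu * lam (l k))) [0..<s + 1]"
  have nk: "n ! k = nat (int m * j' k + i * mu * lam (l k))" if "k \<le> s" for k
    using that by (simp add: n_def del: upt_Suc)
  have ln: "length n = s + 1" by (simp add: n_def)
  have "n \<in> weierstrass_semigroup C Rs" unfolding semigroup_iff
    using ln elt_props[OF sj'] nk by (intro conjI exI[of _ "elt i j'"]) auto
  moreover have "n ! k0 = a ! k0" using nk[OF k0] jk0 by simp
  moreover have "list_all2 (\<le>) n a" using j'a nk ln len by (auto simp: list_all2_conv_all_nth nat_le_iff)
  ultimately have na: "n = a" by (rule min)
  have aj': "int (a ! k) = int m * j' k + i * mu * lam (l k)" if k: "k \<le> s" for k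
    using nk[OF k] pos'[OF k] by (simp add: na)
  \<comment> \<open>For \<open>i = 0\<close> the entries are \<open>m * j' k\<close>, so positivity
    makes every \<open>j' k\<close> positive, against their sum \<open>T 0 = 0\<close>.\<close>
  have "1 \<le> i"
  proof (rule ccontr)
    assume "\<not> 1 \<le> i"
    then have i0: "i = 0" using c(1) by simp
    have "0 < j' k" if "k \<le> s" for k
    proof -
      have "0 < int m * j' k" using aj'[OF that] pos'[OF that] by (simp add: i0)
      then show ?thesis using m0 by (simp add: zero_less_mult_iff)
    qed
    then have "0 < (\<Sum>k=0..s. j' k)" by (intro sum_pos) auto
    moreover have "T i = 0" by (simp add: i0 T_def N_def)
    ultimately show False using sj' by simp
  qed
  then show "a \<in> ?G" using len pos aj' c(2) sj' by (intro CollectI conjI exI[of _ i] exI[of _ j']) auto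
qed

lemma elt_pole_divisor:
  assumes j: "(\<Sum>k=0..s. j k) = T i" and pos: "\<And>k. k \<le> s \<Longrightarrow> 1 \<le> int m * j k + i * mu * lam (l k)"
  shows "pole_divisor C (elt i j) = divisor_sum (map (\<lambda>k. int m * j k + i * mu * lam (l k)) [0..<s + 1]) Rs"
  unfolding pole_divisor_iff[OF elt_props(1)[OF j]]
  using elt_props(2,3)[OF j] pos by (auto simp del: upt_Suc) force+

section \<open>Emptiness of the generating set\<close>

text \<open>Adding \<open>m * w\<close> to \<open>i\<close> raises each ceiling by
  \<open>w * lam k\<close>, and the weighted sum of the \<open>lam k\<close> is the degree of the
  divisor of \<open>f\<close>, which is 0.\<close>

lemma N_cong:
  assumes "[i = i'] (mod (int m))"
  shows "(\<Sum>k=0..r. - ((- (i * lam k)) div int m) * int (d k)) = (\<Sum>k=0..r. - ((- (i' * lam k)) div int m) * int (d k))"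
proof -
  obtain w where w: "i = i' + int m * w" using assms by (metis cong_iff_lin cong_sym)
  have "- ((- (i * lam k)) div int m) = - ((- (i' * lam k)) div int m) + w * lam k" for k
  proof -
    have "- (i * lam k) = - (i' * lam k) + int m * (- (w * lam k))" by (simp add: w algebra_simps)
    moreover have "(- (i' * lam k) + int m * (- (w * lam k))) div int m = - (w * lam k) + - (i' * lam k) div int m"
      using m0 by (intro div_mult_self2) simp
    ultimately show ?thesis by simp
  qed
  then have "(\<Sum>k=0..r. - ((- (i * lam k)) div int m) * int (d k)) =
    (\<Sum>k=0..r. - ((- (i' * lam k)) div int m) * int (d k)) + w * (\<Sum>k=0..r. lam k * int (d k))"
    by (simp only: distrib_right sum.distrib sum_distrib_left mult.assoc)
  moreover have "(\<Sum>k=0..r. lam k * int (d k)) = 0"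
    by (simp add: sum.atLeast_Suc_atMost d lam0)
  ultimately show ?thesis by simp
qed

lemma sum_N_eq: "(\<Sum>k=0..r. N i k * int (d k)) - (\<Sum>k=0..s. N i (l k)) = T i"
proof -
  have "(\<Sum>k=0..r. N i k * int (d k)) = (\<Sum>k=0..r. N i (l k) * int (d (l k)))"
    by (rule sum.reindex_bij_betw[OF l, symmetric])
  also have "\<dots> = (\<Sum>k=0..s. N i (l k) * int (d (l k))) + T i" unfolding T_def by (rule split_sum)
  also have "(\<Sum>k=0..s. N i (l k) * int (d (l k))) = (\<Sum>k=0..s. N i (l k))"
    by (intro sum.cong) (auto simp: deg_one)
  finally show ?thesis by simp
qed

text \<open>For fixed \<open>i\<close> the entries are positive exactly when \<open>j k\<close> is
  at least \<open>1 - N i (l k)\<close>. Such \<open>j\<close> with sum \<open>T i\<close> exist if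
  and only if these s + 1 lower bounds sum to at most \<open>T i\<close>, that is, the full weighted
  sum of ceilings exceeds s. The factor \<open>mu\<close> permutes the nonzero residues, and
  \<open>i = m\<close> contributes 0.\<close>

lemma min_gen_set_empty_iff:
  "min_gen_set C Rs = {} \<longleftrightarrow>
    (\<forall>i. 1 \<le> i \<and> i \<le> int m \<longrightarrow> (\<Sum>k=0..r. - ((- (i * lam k)) div int m) * int (d k)) \<le> int s)"
proof -
  define S where "S i = (\<Sum>k=0..r. - ((- (i * lam k)) div int m) * int (d k))" for i
  have SN: "S (i * mu) = (\<Sum>k=0..r. N i k * int (d k))" for i by (simp add: S_def N_def)
  have S0: "S i = 0" if "int m dvd i" for i
  proof -
    have "S i = S 0" unfolding S_def using that by (intro N_cong) (simp add: cong_0_iff)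
    then show ?thesis by (simp add: S_def)
  qed
  have pos_iff: "1 \<le> int m * n + i * mu * lam (l k) \<longleftrightarrow> 1 - N i (l k) \<le> n"
    if i: "1 \<le> i" "i \<le> int m - 1" "k \<le> s" for i n k
  proof -
    have "\<not> N i (l k) \<le> - n \<longleftrightarrow> \<not> 0 \<le> int m * (- n) - i * mu * lam (l k)" unfolding N_le_iff ..
    then show ?thesis by auto
  qed
  have 1: "min_gen_set C Rs \<noteq> {} \<longleftrightarrow> (\<exists>i. 1 \<le> i \<and> i \<le> int m - 1 \<and> int s < S (i * mu))"
  proof
    assume "min_gen_set C Rs \<noteq> {}"
    then obtain a i j where a: "length a = s + 1" "\<forall>n\<in>set a. 1 \<le> n"
      "\<And>k. k \<le> s \<Longrightarrow> int (a ! k) = int m * j k + i * mu * lam (l k)"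
      and i: "1 \<le> i" "i \<le> int m - 1" and j: "(\<Sum>k=0..s. j k) = T i" unfolding min_gen_set_eq by blast
    have "1 - N i (l k) \<le> j k" if k: "k \<le> s" for k
    proof -
      have "1 \<le> a ! k" using a(1,2) k by simp
      then have "1 \<le> int m * j k + i * mu * lam (l k)" using a(3)[OF k] by simp
      then show ?thesis using pos_iff[OF i k] by simp
    qed
    then have "(\<Sum>k=0..s. 1 - N i (l k)) \<le> T i" unfolding j[symmetric] by (intro sum_mono) auto
    then have "int s < S (i * mu)" using sum_N_eq[of i] by (simp add: sum_subtractf SN)
    then show "\<exists>i. 1 \<le> i \<and> i \<le> int m - 1 \<and> int s < S (i * mu)" using i by blast
  next
    assume "\<exists>i. 1 \<le> i \<and> i \<le> int m - 1 \<and> int s < S (i * mu)"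
    then obtain i where i: "1 \<le> i" "i \<le> int m - 1" and S: "int s < S (i * mu)" by blast
    \<comment> \<open>All entries take their least admissible value except at index 0, which
      receives whatever is left of \<open>T i\<close>.\<close>
    define j where "j k = (if k = 0 then T i - (\<Sum>k=1..s. 1 - N i (l k)) else 1 - N i (l k))" for k
    have "(\<Sum>k=0..s. j k) = j 0 + (\<Sum>k=1..s. j k)" by (simp add: sum.atLeast_Suc_atMost)
    also have "(\<Sum>k=1..s. j k) = (\<Sum>k=1..s. 1 - N i (l k))" by (intro sum.cong) (auto simp: j_def)
    finally have j: "(\<Sum>k=0..s. j k) = T i" by (simp add: j_def)
    have "(\<Sum>k=0..s. 1 - N i (l k)) \<le> T i" using S sum_N_eq[of i] by (simp add: sum_subtractf SN)
    moreover have "(\<Sum>k=0..s. 1 - N i (l k)) = 1 - N i (l 0) + (\<Sum>k=1..s. 1 - N i (l k))"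
      by (simp add: sum.atLeast_Suc_atMost)
    ultimately have jge: "1 - N i (l k) \<le> j k" for k by (simp add: j_def)
    then have p1: "1 \<le> int m * j k + i * mu * lam (l k)" if "k \<le> s" for k using pos_iff[OF i that] by simp
    define a where "a = map (\<lambda>k. nat (int m * j k + i * mu * lam (l k))) [0..<s + 1]"
    have la: "length a = s + 1" by (simp add: a_def)
    have ak: "int (a ! k) = int m * j k + i * mu * lam (l k)" if "k \<le> s" for k
      using that p1[OF that] by (simp add: a_def del: upt_Suc)
    have "\<forall>n\<in>set a. 1 \<le> n"
    proof
      fix n assume "n \<in> set a"
      then obtain k where "k \<le> s" "n = a ! k" using la by (metis in_set_conv_nth less_Suc_eq_le Suc_eq_plus1)
      then show "1 \<le> n" using ak[of k] p1[of k] by simp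
    qed
    then have "a \<in> min_gen_set C Rs" unfolding min_gen_set_eq using la ak i j by blast
    then show "min_gen_set C Rs \<noteq> {}" by blast
  qed
  \<comment> \<open>Division by \<open>b\<close> modulo m permutes the residues. The residue 0
    cannot arise, since \<open>S\<close> vanishes on multiples of m whereas \<open>S i\<close>
    exceeds s.\<close>
  have inv: "\<exists>i'. 1 \<le> i' \<and> i' \<le> int m - 1 \<and> S i = S (i' * b)" if i: "int s < S i" and b: "coprime (int m) b" for i b
  proof -
    obtain u w where uw: "w * int m + u * b = 1" using b by (metis bezout_int coprime_imp_gcd_eq_1)
    define i' where "i' = (i * u) mod int m"
    have "[i' * b = i * u * b] (mod (int m))" unfolding i'_def by (simp add: cong_def mod_mult_left_eq)
    moreover have "i * u * b - i = int m * (- i * w)"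
    proof -
      have "i * (w * int m + u * b) = i" by (simp add: uw)
      then show ?thesis by (simp add: algebra_simps)
    qed
    then have "[i * u * b = i] (mod (int m))" by (simp add: cong_iff_dvd_diff)
    ultimately have "[i = i' * b] (mod (int m))" using cong_trans cong_sym by blast
    then have SS: "S i = S (i' * b)" unfolding S_def by (rule N_cong)
    have "0 \<le> i'" "i' < int m" using m0 by (auto simp: i'_def)
    moreover have "i' \<noteq> 0" using SS S0[of "i' * b"] i by auto
    ultimately show ?thesis using SS by (intro exI[of _ i']) auto
  qed
  have "(\<exists>i. 1 \<le> i \<and> i \<le> int m - 1 \<and> int s < S (i * mu)) \<longleftrightarrow> (\<exists>i. 1 \<le> i \<and> i \<le> int m \<and> int s < S i)"
  proof
    assume "\<exists>i. 1 \<le> i \<and> i \<le> int m - 1 \<and> int s < S (i * mu)"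
    then obtain i where i: "int s < S (i * mu)" by blast
    obtain i' where "1 \<le> i'" "i' \<le> int m - 1" "S (i * mu) = S (i' * 1)" using inv[OF i, of 1] by auto
    then show "\<exists>i. 1 \<le> i \<and> i \<le> int m \<and> int s < S i" using i by (intro exI[of _ i']) auto
  next
    assume "\<exists>i. 1 \<le> i \<and> i \<le> int m \<and> int s < S i"
    then show "\<exists>i. 1 \<le> i \<and> i \<le> int m - 1 \<and> int s < S (i * mu)" using inv[OF _ mu] by metis
  qed
  then show ?thesis using 1 unfolding S_def by (auto simp: not_le) 
qed

end

section \<open>The characteristic and the final statement\<close>

text \<open>Translation by 1 permutes \<open>S\<close>; comparing the sums of all elements before
  and after gives the claim.\<close>

lemma of_nat_card_subfield:
  fixes S :: "'a::field set"
  assumes S: "is_subfield S" and fin: "finite S" shows "of_nat (card S) = (0 :: 'a)"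
proof -
  have add: "a + b \<in> S" if "a \<in> S" "b \<in> S" for a b
  proof -
    have "a - (0 - b) \<in> S" using S that unfolding is_subfield_def by blast
    then show ?thesis by simp
  qed
  have "(\<Sum>a\<in>S. a) = (\<Sum>a\<in>S. a + 1)"
    by (rule sum.reindex_bij_witness[of _ "\<lambda>a. a + 1" "\<lambda>a. a - 1"])
      (use S add in \<open>auto simp: is_subfield_def\<close>)
  then show ?thesis by (simp add: sum.distrib)
qed

text \<open>In the field q is 0, so if m were 0 as well, a Bezout identity for m and q would read 0
  = 1.\<close>

lemma of_nat_coprime_card_nonzero:
  fixes S :: "'a::field set"
  assumes S: "is_subfield S" and q: "card S = q" and m: "gcd m q = 1" and pq: "primepow q"
  shows "of_nat m \<noteq> (0 :: 'a)"
proof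
  assume m0: "of_nat m = (0 :: 'a)"
  have "q > 0" using pq by (rule primepow_gt_0_nat)
  then have "finite S" using q card_ge_0_finite by metis
  then have q0: "of_nat q = (0 :: 'a)" using of_nat_card_subfield[OF S] q by simp
  have "m \<noteq> 0" using m primepow_gt_Suc_0[OF pq] by (cases "m = 0") auto
  then obtain u v where "m * u = q * v + 1" using bezout_nat[of m q] m by auto
  then have "of_nat m * of_nat u = (of_nat q * of_nat v + 1 :: 'a)" by (metis of_nat_1 of_nat_add of_nat_mult)
  then show False using m0 q0 by simp
qed

theorem theorem4p1:
  fixes Fq :: "'k::field set" and q m r s :: nat
    and \<alpha> :: 'k and p :: "nat \<Rightarrow> 'k poly" and lam :: "nat \<Rightarrow> int"
    and f :: "'k poly fract"
    and emb :: "'k poly fract \<Rightarrow> 'f::field" and y :: 'f and C :: "'f set"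
    and d :: "nat \<Rightarrow> nat" and z :: "nat \<Rightarrow> 'f"
    and P :: "nat \<Rightarrow> 'k poly fract set" and Q :: "nat \<Rightarrow> 'f set"
    and rbar :: nat and l :: "nat \<Rightarrow> nat" and mu :: int
  assumes q: "primepow q"
    and Fq: "is_subfield Fq" "card Fq = q"
    and K_algebraic: "\<And>a::'k. algebraic_over Fq a"
    and m: "m \<ge> 2" "gcd m q = 1"
    and r: "r \<ge> 2"
    and \<alpha>: "\<alpha> \<noteq> 0"
    and lam_nz: "\<And>i. i \<in> {1..r} \<Longrightarrow> lam i \<noteq> 0"
    and p_monic: "\<And>i. i \<in> {1..r} \<Longrightarrow> lead_coeff (p i) = 1"
    and p_irreducible: "\<And>i. i \<in> {1..r} \<Longrightarrow> irreducible (p i)"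
    and p_distinct: "inj_on p {1..r}"
    and f: "f = rat_of_poly [:\<alpha>:] * (\<Prod>i=1..r. rat_of_poly (p i) powi lam i)"
    and f_no_power: "\<And>e. e dvd m \<Longrightarrow> e \<ge> 2 \<Longrightarrow> \<nexists>g. f = g ^ e"
    and emb: "field_embedding emb"
    and C: "C = emb ` rat_consts"
    and y: "y ^ m = emb f"
    and F_gen: "is_subfield hull (C \<union> {emb rat_x, y}) = UNIV"
    and full_const: "\<And>a. algebraic_over C a \<Longrightarrow> a \<in> C"
    and d: "d 0 = 1" "\<And>i. i \<in> {1..r} \<Longrightarrow> d i = degree (p i)"
    and lam0: "lam 0 = - (\<Sum>i=1..r. lam i * int (d i))"
    and z: "z 0 = 1" "\<And>i. i \<in> {1..r} \<Longrightarrow> z i = emb (rat_of_poly (p i))"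
    and P0: "P 0 = (THE P'. is_place rat_consts P' \<and> place_val P' rat_x < 0)"
    and P: "\<And>i. i \<in> {1..r} \<Longrightarrow>
              P i = (THE P'. is_place rat_consts P' \<and> place_val P' (rat_of_poly (p i)) > 0)"
    and Q: "\<And>i. i \<in> {0..r} \<Longrightarrow> gcd (int m) (lam i) = 1 \<Longrightarrow>
              Q i = (THE Q'. is_place C Q' \<and> lies_over emb Q' (P i))"
    and rbar: "rbar = (if finite (UNIV :: 'k set) then min (r + 1) (card (UNIV :: 'k set)) - 1 else r)"
    and l: "bij_betw l {0..r} {0..r}"
    and s: "1 \<le> s" "s \<le> rbar"
    and mu: "gcd (int m) mu = 1"
    and deg_one: "\<And>k. k \<in> {0..s} \<Longrightarrow> d (l k) = 1"
    and gcd_one: "\<And>k. k \<in> {0..s} \<Longrightarrow> gcd (int m) (lam (l k)) = 1"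
  shows
    "min_gen_set C (map (\<lambda>k. Q (l k)) [0..<s + 1]) =
       {a. length a = s + 1 \<and> (\<forall>n\<in>set a. 1 \<le> n) \<and>
          (\<exists>(i::int) (j :: nat \<Rightarrow> int).
             map int a = map (\<lambda>k. int m * j k + i * mu * lam (l k)) [0..<s + 1] \<and>
             1 \<le> i \<and> i \<le> int m - 1 \<and>
             (\<forall>k\<in>{0..s}. j k \<ge> \<lceil>real_of_int (- i * mu * lam (l k)) / real m\<rceil>) \<and>
             (\<Sum>k=0..s. j k) =
               (\<Sum>k=0..r. \<lceil>real_of_int (i * mu * lam k) / real m\<rceil> * int (d k)) -
               (\<Sum>k=0..s. \<lceil>real_of_int (i * mu * lam (l k)) / real m\<rceil>))}
     \<and>
     (\<forall>(i::int) (j :: nat \<Rightarrow> int).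
        1 \<le> i \<and> i \<le> int m - 1 \<and>
        (\<forall>k\<in>{0..s}. 1 \<le> int m * j k + i * mu * lam (l k)) \<and>
        (\<forall>k\<in>{0..s}. j k \<ge> \<lceil>real_of_int (- i * mu * lam (l k)) / real m\<rceil>) \<and>
        (\<Sum>k=0..s. j k) =
          (\<Sum>k=0..r. \<lceil>real_of_int (i * mu * lam k) / real m\<rceil> * int (d k)) -
          (\<Sum>k=0..s. \<lceil>real_of_int (i * mu * lam (l k)) / real m\<rceil>)
        \<longrightarrow>
        pole_divisor C
          ((\<Prod>k=s+1..r. z (l k) powi \<lceil>real_of_int (i * mu * lam (l k)) / real m\<rceil>) /
           (y powi (i * mu) * (\<Prod>k=0..s. z (l k) powi j k)))
        = divisor_sum (map (\<lambda>k. int m * j k + i * mu * lam (l k)) [0..<s + 1])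
                      (map (\<lambda>k. Q (l k)) [0..<s + 1]))
     \<and>
     (min_gen_set C (map (\<lambda>k. Q (l k)) [0..<s + 1]) = {} \<longleftrightarrow>
        Max ((\<lambda>i::int. \<Sum>k=0..r. \<lceil>real_of_int (i * lam k) / real m\<rceil> * int (d k)) ` {1..int m}) \<le> int s)"
proof -
  note E = field_embeddingD[OF emb]
  have m0: "m > 0" using m by simp
  have sr: "s \<le> r" using s(2) rbar by (auto split: if_splits)
  have lr: "l k \<in> {0..r}" if "k \<le> s" for k using l sr that by (auto simp: bij_betw_def)
  have m_char: "of_nat m \<noteq> (0 :: 'k)" by (rule of_nat_coprime_card_nonzero[OF Fq(1) _ m(2) q]) (rule Fq(2))
  interpret kummer_gamma m r \<alpha> p lam f emb y C d z l s mu
  proof unfold_locales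
    show "coprime (int m) mu" using mu by (simp add: coprime_iff_gcd_eq_1)
    show "coprime (int m) (lam (l k))" if "k \<le> s" for k
      using gcd_one[of k] that by (simp add: coprime_iff_gcd_eq_1)
  qed (use m m_char \<alpha> p_monic p_irreducible p_distinct f emb C y F_gen d lam0 z l s(1) sr deg_one in auto)
  have QR: "map (\<lambda>k. Q (l k)) [0..<s + 1] = Rs" unfolding Rs_def
  proof (rule map_cong[OF refl])
    fix k assume "k \<in> set [0..<s + 1]"
    then have k: "k \<le> s" by auto
    then have lk: "l k \<le> r" using lr by simp
    have "Q (l k) = (THE Q'. is_place C Q' \<and> lies_over emb Q' (P (l k)))"
      using lr gcd_one k by (intro Q) auto
    also have "\<dots> = maxideal (Vr (l k))"
      by (rule ramified_place[OF lk gcd_one[OF k] rat_places[OF P0 P lk]])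
    finally show "Q (l k) = maxideal (Vr (l k))" .
  qed
  have ceil: "\<lceil>real_of_int x / real m\<rceil> = - ((- x) div int m)" for x
    using ceiling_divide_eq_div[of x "int m", where 'a = real] by simp
  have NC: "\<lceil>real_of_int (i * mu * lam k) / real m\<rceil> = N i k" for i k unfolding ceil N_def ..
  show ?thesis unfolding QR NC sum_N_eq
  proof (intro conjI allI impI)
    show "min_gen_set C Rs = {a. length a = s + 1 \<and> (\<forall>n\<in>set a. 1 \<le> n) \<and>
          (\<exists>(i::int) (j :: nat \<Rightarrow> int).
             map int a = map (\<lambda>k. int m * j k + i * mu * lam (l k)) [0..<s + 1] \<and>
             1 \<le> i \<and> i \<le> int m - 1 \<and>
             (\<forall>k\<in>{0..s}. j k \<ge> N (- i) (l k)) \<and>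
             (\<Sum>k=0..s. j k) = T i)}"
      unfolding min_gen_set_eq
    proof (rule Collect_cong, rule conj_cong[OF refl], rule conj_cong[OF refl], rule ex_cong1, rule ex_cong1)
      fix a :: "nat list" and i :: int and j :: "nat \<Rightarrow> int"
      assume len: "length a = s + 1" and pos: "\<forall>n\<in>set a. 1 \<le> n"
      have eq: "map int a = map (\<lambda>k. int m * j k + i * mu * lam (l k)) [0..<s + 1] \<longleftrightarrow>
        (\<forall>k\<le>s. int (a ! k) = int m * j k + i * mu * lam (l k))"
        using len by (auto simp: list_eq_iff_nth_eq less_Suc_eq_le simp del: upt_Suc)
      \<comment> \<open>By \<open>N_le_iff\<close> the bound on \<open>j k\<close> expresses that
        the entry is nonnegative, which holds for the image of a natural number.\<close>
      have "N (- i) (l k) \<le> j k"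
        if "int (a ! k) = int m * j k + i * mu * lam (l k)" for k
        using that of_nat_0_le_iff[of "a ! k"]
        unfolding N_le_iff by simp
      then show "((\<forall>k\<le>s. int (a ! k) = int m * j k + i * mu * lam (l k)) \<and>
          1 \<le> i \<and> i \<le> int m - 1 \<and> (\<Sum>k=0..s. j k) = T i) \<longleftrightarrow>
        (map int a = map (\<lambda>k. int m * j k + i * mu * lam (l k)) [0..<s + 1] \<and>
             1 \<le> i \<and> i \<le> int m - 1 \<and>
             (\<forall>k\<in>{0..s}. j k \<ge> N (- i) (l k)) \<and>
             (\<Sum>k=0..s. j k) = T i)"
        unfolding eq by auto
    qed
  next
    fix i :: int and j :: "nat \<Rightarrow> int"
    assume "1 \<le> i \<and> i \<le> int m - 1 \<and> (\<forall>k\<in>{0..s}. 1 \<le> int m * j k + i * mu * lam (l k)) \<and>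
        (\<forall>k\<in>{0..s}. j k \<ge> N (- i) (l k)) \<and> (\<Sum>k=0..s. j k) = T i"
    then show "pole_divisor C ((\<Prod>k=s+1..r. z (l k) powi N i (l k)) /
           (y powi (i * mu) * (\<Prod>k=0..s. z (l k) powi j k)))
        = divisor_sum (map (\<lambda>k. int m * j k + i * mu * lam (l k)) [0..<s + 1]) Rs"
      using elt_pole_divisor[of j i] unfolding elt_def by auto
  next
    show "min_gen_set C Rs = {} \<longleftrightarrow>
        Max ((\<lambda>i::int. \<Sum>k=0..r. \<lceil>real_of_int (i * lam k) / real m\<rceil> * int (d k)) ` {1..int m}) \<le> int s"
      unfolding min_gen_set_empty_iff ceil using m0 by (subst Max_le_iff) auto
  qed
qed

end
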